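(* Consider the setting, the AGP-UCB algorithm (with feedback at every step) and the quantities $\gamma_T$, $R_T$, $\varphi_n$ defined in the context, where $k$ is a squared exponential kernel $k(x,x')=\exp\big(-\frac1{2\ell^2}\|x-x'\|^2\big)$, $\ell>0$. Assume: (i) for every $t$, the function $-V(\cdot;t)$ is convex and $L$-strongly smooth over $D$, uniformly in $t$, i.e. $-V(x;t)+V(y;t)\le -\nabla V(y;t)^{\top}(x-y)+\frac L2\|x-y\|_2^2$ for all $x,y\in D$; (ii) $D\subseteq[0,r]^d$ is compact and convex, $d\in\mathbb N$, $r>0$, and there are constants $a,b>0$ such that the sample paths $U$ of $\mathrm{GP}(0,k)$ satisfy $\Pr\{\sup_{x\in D}|\partial U/\partial x_j|>M\}\le a\,e^{-(M/b)^2}$ for all $M>0$ and $j=1,\dots,d$; (iii) there is $\Delta<\infty$ such that $\Delta_n:=\max_{x\in D}|V(x;t_n)-V(x;t_{n-1})|\le\Delta$ for all $n$; (iv) the approximate optimizers produced by the algorithm satisfy, for a constant $\eta<1$ and every $n$, $\varphi_n^*-\varphi_n(x_n)\le\eta\,(\varphi_n^*-\varphi_n(x_{n-1}))$, where $\varphi_n^*=\max_{x\in D}\varphi_n(x)$; (v) the kernel $k$ is not degenerate, and the mean and variance are well-behaved, so that they can be represented by generalized Fourier series in the kernel (eigenfunction) basis. Pick $\delta\in(0,1)$ and run AGP-UCB with $\beta_n=2\log(2n^2\pi^2/(3\delta))+2d\log\big(d\,n^2\,b\,r\sqrt{\log(4da/\delta)}\big)$, $n\ge1$. Then $\gamma_T=O((\log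 T)^{d+1})$, and (with probability at least $1-\delta$) the cumulative regret $R_T$ is of the order of $O^*\big(\sqrt{dT(\log T)^{d+1}}\big)+O(T)$.
   Context: Setting. $V(x;t)$ is a known deterministic time-varying function and $U(x)$ is an unknown time-invariant function, $x\in D\subset\mathbb R^d$; $f(x;t)=V(x;t)+U(x)$ is to be maximized over $D$ at sampling times $t_1,t_2,\dots$ (with constant sampling period). $U$ is a sample path of a Gaussian process $\mathrm{GP}(0,k)$ with kernel $k$, $k(x,x)\le1$ on $D$. Feedback and posterior. Feedback at a point $x_i\in D$ is $y_i=U(x_i)+\varepsilon_i$, with $\varepsilon_i\sim N(0,\sigma^2)$ i.i.d. Given $x_1,\dots,x_n$ and $\mathbf y_n=(y_1,\dots,y_n)^\top$, let $\mathbf k_n(x)=(k(x_1,x),\dots,k(x_n,x))^\top$, $K_n=[k(x_i,x_j)]_{i,j\le n}$, and $\mu_n(x)=\mathbf k_n(x)^\top(K_n+\sigma^2I_n)^{-1}\mathbf y_n$, $k_n(x,x')=k(x,x')-\mathbf k_n(x)^\top(K_n+\sigma^2I_n)^{-1}\mathbf k_n(x')$, $\sigma_n^2(x)=k_n(x,x)$; $\mu_0\equiv0$, $\sigma_0^2(x)=k(x,x)$. AGP-UCB algorithm (feedback received at every time step, so the time index $k$ and the data index $n$ coincide). Start from $x_0\in D$. At each time $t_n$, $n\ge1$: (S1) set $\hat U_n(x)=\mu_{n-1}(x)+\sqrt{\beta_n}\,\sigma_{n-1}(x)$; (S2) with $\varphi_n(x):=V(x;t_n)+\hat U_n(x)$,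 compute an approximate maximizer $x_n\in D$ of $\varphi_n$ over $D$ by running finitely many steps of a given optimization scheme $\mathcal M$ on $\varphi_n$ started at $x_{n-1}$; (S3) collect $y_n=U(x_n)+\varepsilon_n$ and update the posterior to $\mu_n,\sigma_n$. Information gain: $\gamma_T:=\max_{A\subset D,|A|=T}\frac12\log|I+\sigma^{-2}K_A|$, $K_A=[k(x,x')]_{x,x'\in A}$, where $|\cdot|$ of a matrix is the determinant. Regret: $R_T:=\sum_{n=1}^T\big(f_n^*-f(x_n;t_n)\big)$, $f_n^*=\max_{x\in D}f(x;t_n)$. Notation: $O^*$ is a big-$O$ (in $T$) up to polylogarithmic factors. The kernel (eigenfunction) basis consists of the eigenfunctions $\phi_i$ of the kernel $k$, with eigenvalues $\lambda_i$; non-degenerate means that there are not just finitely many nonzero eigenvalues. *)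

theory Defs
  imports
    "HOL-Probability.Probability"
    "HOL-Library.Landau_Symbols"
    "Jordan_Normal_Form.Gauss_Jordan_Elimination"
    "Jordan_Normal_Form.Determinant"
begin

no_notation vec_index (infixl \<open>$\<close> 100)
no_notation scalar_prod (infix \<open>\<bullet>\<close> 70)

definition se_kernel :: "real \<Rightarrow> 'a::real_normed_vector \<Rightarrow> 'a \<Rightarrow> real" where
  "se_kernel l x x' = exp (- 1 / (2 * l\<^sup>2) * (norm (x - x'))\<^sup>2)"


text \<open>Univariate normal laws include the point masses (standard deviation 0).\<close>

definition normal_rv :: "'w measure \<Rightarrow> ('w \<Rightarrow> real) \<Rightarrow> bool" where
  "normal_rv P Z \<longleftrightarrow>
     (\<exists>m s. s > 0 \<and> distributed P lborel Z (normal_density m s)) \<or>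
     Z \<in> borel_measurable P \<and> (\<exists>m. AE \<omega> in P. Z \<omega> = m)"

text \<open>All finite-dimensional marginals on \<open>D\<close> are jointly normal, i.e. all their linear combinations
  are univariate normal.\<close>

definition gaussian_process ::
    "'w measure \<Rightarrow> 'a set \<Rightarrow> ('a \<Rightarrow> real) \<Rightarrow> ('a \<Rightarrow> 'a \<Rightarrow> real) \<Rightarrow> ('a \<Rightarrow> 'w \<Rightarrow> real) \<Rightarrow> bool" where
  "gaussian_process P D m k U \<longleftrightarrow>
     (\<forall>F c. finite F \<and> F \<subseteq> D \<longrightarrow> normal_rv P (\<lambda>\<omega>. \<Sum>x\<in>F. c x * U x \<omega>)) \<and>
     (\<forall>x\<in>D. (\<integral>\<omega>. U x \<omega> \<partial>P) = m x) \<and>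
     (\<forall>x\<in>D. \<forall>x'\<in>D. (\<integral>\<omega>. (U x \<omega> - m x) * (U x' \<omega> - m x') \<partial>P) = k x x')"


definition kernel_mat :: "('a \<Rightarrow> 'a \<Rightarrow> real) \<Rightarrow> 'a list \<Rightarrow> real mat" where
  "kernel_mat k xs = mat (length xs) (length xs) (\<lambda>(i, j). k (xs ! i) (xs ! j))"

definition kernel_vec :: "('a \<Rightarrow> 'a \<Rightarrow> real) \<Rightarrow> 'a list \<Rightarrow> 'a \<Rightarrow> real Matrix.vec" where
  "kernel_vec k xs x = Matrix.vec (length xs) (\<lambda>i. k (xs ! i) x)"

definition reg_inverse :: "('a \<Rightarrow> 'a \<Rightarrow> real) \<Rightarrow> real \<Rightarrow> 'a list \<Rightarrow> real mat" where
  "reg_inverse k \<sigma> xs =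
     the (mat_inverse (kernel_mat k xs + \<sigma>\<^sup>2 \<cdot>\<^sub>m 1\<^sub>m (length xs)))"

definition post_mean :: "('a \<Rightarrow> 'a \<Rightarrow> real) \<Rightarrow> real \<Rightarrow> 'a list \<Rightarrow> real list \<Rightarrow> 'a \<Rightarrow> real" where
  "post_mean k \<sigma> xs ys x =
     scalar_prod (kernel_vec k xs x) (reg_inverse k \<sigma> xs *\<^sub>v vec_of_list ys)"

definition post_cov :: "('a \<Rightarrow> 'a \<Rightarrow> real) \<Rightarrow> real \<Rightarrow> 'a list \<Rightarrow> 'a \<Rightarrow> 'a \<Rightarrow> real" where
  "post_cov k \<sigma> xs x x' =
     k x x' - scalar_prod (kernel_vec k xs x) (reg_inverse k \<sigma> xs *\<^sub>v kernel_vec k xs x')"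

definition post_sd :: "('a \<Rightarrow> 'a \<Rightarrow> real) \<Rightarrow> real \<Rightarrow> 'a list \<Rightarrow> 'a \<Rightarrow> real" where
  "post_sd k \<sigma> xs x = sqrt (post_cov k \<sigma> xs x x)"

lemma post_Nil:
  "post_mean k \<sigma> [] [] x = 0" "post_cov k \<sigma> [] x x' = k x x'"
proof -
  let ?A = "kernel_mat k [] + \<sigma>\<^sup>2 \<cdot>\<^sub>m 1\<^sub>m 0 :: real mat"
  have A: "?A \<in> carrier_mat 0 0"
    by (auto simp: kernel_mat_def)
  have AA: "?A * ?A = 1\<^sub>m 0"
    using A by (intro eq_matI) auto
  have "\<exists>B\<in>carrier_mat 0 0. B * ?A = 1\<^sub>m 0 \<and> ?A * B = 1\<^sub>m 0"
    using A AA by blast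
  with A have "?A \<in> Units (ring_mat TYPE(real) 0 ())"
    by (simp add: Units_def ring_mat_def)
  then have "mat_inverse ?A \<noteq> None"
    using mat_inverse(1)[OF A, where b = "()"] by blast
  then obtain B where "mat_inverse ?A = Some B" by blast
  then have "reg_inverse k \<sigma> [] \<in> carrier_mat 0 0"
    using mat_inverse(2)[OF A] by (auto simp: reg_inverse_def)
  then show "post_mean k \<sigma> [] [] x = 0" "post_cov k \<sigma> [] x x' = k x x'"
    by (auto simp: post_mean_def post_cov_def scalar_prod_def)
qed


text \<open>A subset of \<open>D\<close> with \<open>T\<close> elements is enumerated by a duplicate-free list; the determinant does
  not depend on the enumeration. The maximum is read as a supremum.\<close>

definition info_gain :: "('a \<Rightarrow> 'a \<Rightarrow> real) \<Rightarrow> real \<Rightarrow> 'a set \<Rightarrow> nat \<Rightarrow> real" where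
  "info_gain k \<sigma> D T =
     Sup {1 / 2 * ln (Determinant.det (1\<^sub>m T + (1 / \<sigma>\<^sup>2) \<cdot>\<^sub>m kernel_mat k xs)) |
            xs. distinct xs \<and> set xs \<subseteq> D \<and> length xs = T}"


text \<open>For small \<open>n\<close> or extreme constants the arguments of \<open>ln\<close> and \<open>sqrt\<close> may leave the range where the
  formula is meaningful; the totalized library functions are used there (\<open>sqrt\<close> is odd,
  \<open>ln (- x) = ln x\<close>, \<open>ln 0 = 0\<close>).\<close>

definition agp_beta :: "nat \<Rightarrow> real \<Rightarrow> real \<Rightarrow> real \<Rightarrow> real \<Rightarrow> nat \<Rightarrow> real" where
  "agp_beta d a b r \<delta> n =
     2 * ln (2 * (real n)\<^sup>2 * pi\<^sup>2 / (3 * \<delta>)) +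
     2 * real d * ln (real d * (real n)\<^sup>2 * b * r * sqrt (ln (4 * real d * a / \<delta>)))"

text \<open>The data available in round \<open>n\<close> are the queries and feedbacks with indices \<open>1, \<dots>, n - 1\<close>;
  \<open>v\<close> is the known part \<open>V(\<sqdot>; t\<^sub>n)\<close>, \<open>X\<close> and \<open>Y\<close> are the queries and feedbacks along one run.\<close>

definition agp_acquisition ::
    "('a \<Rightarrow> 'a \<Rightarrow> real) \<Rightarrow> real \<Rightarrow> (nat \<Rightarrow> real) \<Rightarrow> (nat \<Rightarrow> 'a) \<Rightarrow> (nat \<Rightarrow> real) \<Rightarrow> nat \<Rightarrow>
     ('a \<Rightarrow> real) \<Rightarrow> 'a \<Rightarrow> real" where
  "agp_acquisition k \<sigma> \<beta> X Y n v x =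
     v x + (post_mean k \<sigma> (map X [1..<n]) (map Y [1..<n]) x +
            sqrt (\<beta> n) * post_sd k \<sigma> (map X [1..<n]) x)"

definition cum_regret :: "'a set \<Rightarrow> (nat \<Rightarrow> 'a \<Rightarrow> real) \<Rightarrow> (nat \<Rightarrow> 'a) \<Rightarrow> nat \<Rightarrow> real" where
  "cum_regret D f X T = (\<Sum>n=1..T. (SUP x\<in>D. f n x) - f n (X n))"


text \<open>The gradient is taken within \<open>D\<close>; only its inner products with differences of points of \<open>D\<close>
  matter, and these are determined by \<open>f\<close>.\<close>

definition strongly_smooth_on :: "real \<Rightarrow> 'a::euclidean_space set \<Rightarrow> ('a \<Rightarrow> real) \<Rightarrow> bool" where
  "strongly_smooth_on L D f \<longleftrightarrow>
     (\<exists>g. (\<forall>y\<in>D. (f has_derivative (\<lambda>h. g y \<bullet> h)) (at y within D)) \<and>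
          (\<forall>x\<in>D. \<forall>y\<in>D. f x - f y \<le> g y \<bullet> (x - y) + L / 2 * (norm (x - y))\<^sup>2))"


text \<open>\<open>e\<close> is an orthonormal basis of \<open>L\<^sup>2(\<nu>)\<close> consisting of eigenfunctions of the integral operator
  with kernel \<open>k\<close>, where \<open>\<nu>\<close> is a measure concentrated on \<open>D\<close>; \<open>lam\<close> are the eigenvalues.\<close>

definition kernel_eigenbasis ::
    "'a::euclidean_space measure \<Rightarrow> 'a set \<Rightarrow> ('a \<Rightarrow> 'a \<Rightarrow> real) \<Rightarrow> (nat \<Rightarrow> 'a \<Rightarrow> real) \<Rightarrow> (nat \<Rightarrow> real) \<Rightarrow>
     bool" where
  "kernel_eigenbasis \<nu> D k e lam \<longleftrightarrow>
     (\<forall>i. e i \<in> borel_measurable \<nu> \<and> integrable \<nu> (\<lambda>x. (e i x)\<^sup>2)) \<and>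
     (\<forall>i. \<forall>x\<in>D. (\<integral>x'. k x x' * e i x' \<partial>\<nu>) = lam i * e i x) \<and>
     (\<forall>i j. (\<integral>x. e i x * e j x \<partial>\<nu>) = (if i = j then 1 else 0)) \<and>
     (\<forall>g\<in>borel_measurable \<nu>. integrable \<nu> (\<lambda>x. (g x)\<^sup>2) \<and> (\<forall>i. (\<integral>x. g x * e i x \<partial>\<nu>) = 0) \<longrightarrow>
        (AE x in \<nu>. g x = 0))"

text \<open>Convergence of the generalized Fourier series of \<open>g\<close> to \<open>g\<close>, in \<open>L\<^sup>2(\<nu>)\<close>.\<close>

definition fourier_representable ::
    "'a measure \<Rightarrow> (nat \<Rightarrow> 'a \<Rightarrow> real) \<Rightarrow> ('a \<Rightarrow> real) \<Rightarrow> bool" where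
  "fourier_representable \<nu> e g \<longleftrightarrow>
     g \<in> borel_measurable \<nu> \<and> integrable \<nu> (\<lambda>x. (g x)\<^sup>2) \<and>
     (\<lambda>N. \<integral>x. (g x - (\<Sum>i<N. (\<integral>z. g z * e i z \<partial>\<nu>) * e i x))\<^sup>2 \<partial>\<nu>) \<longlonglongrightarrow> 0"


definition bigo_star :: "(nat \<Rightarrow> real) \<Rightarrow> (nat \<Rightarrow> real) set" where
  "bigo_star g = (\<Union>p::nat. O(\<lambda>T. g T * ln (real T) ^ p))"

end

theory Submission
  imports Defs "HOL-Real_Asymp.Real_Asymp"
begin

text \<open>The linear part of the claimed order absorbs every term that is polylogarithmic in the horizon \<open>T\<close>, so
it suffices to bound the regret, on one event of probability at least \<open>1 - \<delta>\<close> and for all \<open>T\<close>, by a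
constant multiple of \<open>T\<close> plus a polylogarithmic term. The point is that sums over the rounds of the
posterior variances at the queries grow only polylogarithmically, while everything else in the regret of a
round is bounded.

\<^bold>\<open>Posterior and information gain.\<close> The posterior is described by conditioning on one observation at a time
(\<open>cond_cov\<close>, \<open>cond_mean\<close>; \<open>post_eq_cond\<close> identifies this with the matrix formulas). An LDL factorisation
of \<open>K + s\<^sup>2 I\<close> shows that \<open>det (I + K / s\<^sup>2)\<close> is the product of the factors
\<open>1 + (predictive variance) / s\<^sup>2\<close>, so a bound for the information gain is also a bound for the
sum of the predictive variances along a run, which may revisit points. Adding a feature \<open>f \<otimes> f\<close> to the
kernel multiplies this product by at most \<open>1 + (\<Sum>i. (f (x i))\<^sup>2) / s\<^sup>2\<close>
(\<open>gain_product_add_feature\<close>). The squared exponential kernel is a sum of features indexed by multi-indices;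
\<open>(ln T)\<^sup>d\<close> of them contribute a factor of order \<open>T\<close> each, and a Chernoff bound makes the rest
negligible. This gives the order \<open>(ln T)\<^sup>d\<^sup>+\<^sup>1\<close> for the logarithm.

\<^bold>\<open>Confidence.\<close> The queries depend on the data, and the data on the unknown path. For a fixed path the data
are a triangular function of the noise, with density equal to the product of the Gaussian likelihoods.
By Tonelli the path may be averaged first, for fixed data and hence for a fixed design, and there
the weighted law of a path value is exactly the Gaussian posterior (\<open>gaussian_posterior_char\<close>). Hence each
path value obeys the Gaussian tail bound around the adaptive posterior mean
(\<open>adaptive_gaussian_confidence\<close>). A net with \<open>n\<^sup>2\<^sup>d\<close> points in round \<open>n\<close> and Lipschitz
bounds for the path, the posterior mean and the posterior deviation extend this to all points of the domain
(\<open>uniform_confidence_event\<close>).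

\<^bold>\<open>Regret.\<close> Let \<open>e\<^sub>n\<close> be the optimisation error in round \<open>n\<close>. Passing from one acquisition function to the
next changes it uniformly by a bounded amount plus a multiple of the posterior deviation at the last query,
so the contraction hypothesis makes the sum of the \<open>e\<^sub>n\<close> at most linear. The confidence bounds convert
\<open>e\<^sub>n\<close> into the regret of the round at the cost of a bounded amount and another multiple of the posterior
deviation at the query. All multiples of deviations are split by \<open>2xy \<le> 1 + x\<^sup>2y\<^sup>2\<close> into
a constant and a variance (\<open>regret_bound\<close>).

The exploration rate has the growth \<open>(4 + 4d) ln n\<close> that the union bound requires unless a logarithm in it
vanishes. That logarithm is positive as soon as the domain has two points
(\<open>gradient_tail_constant_ge_1\<close>), and on a one-point domain there is no regret.\<close>

section \<open>Posterior by successive conditioning\<close>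

lemma sum_upto_Suc: "(\<Sum>j=1..Suc n. f j) = (\<Sum>j=1..n. f j) + f (Suc n)"
  by simp

text \<open>The posterior covariance after observing at \<open>x 1, \<dots>, x n\<close> with noise deviation \<open>s\<close>, one observation at a time.
In this form statements about posteriors are proved by induction on \<open>n\<close>, without matrix inverses.\<close>

fun cond_cov :: "('a \<Rightarrow> 'a \<Rightarrow> real) \<Rightarrow> real \<Rightarrow> (nat \<Rightarrow> 'a) \<Rightarrow> nat \<Rightarrow> 'a \<Rightarrow> 'a \<Rightarrow> real" where
  "cond_cov k s x 0 u v = k u v"
| "cond_cov k s x (Suc n) u v = cond_cov k s x n u v -
     cond_cov k s x n u (x (Suc n)) * cond_cov k s x n v (x (Suc n)) /
       (s\<^sup>2 + cond_cov k s x n (x (Suc n)) (x (Suc n)))"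

fun cond_mean :: "('a \<Rightarrow> 'a \<Rightarrow> real) \<Rightarrow> real \<Rightarrow> (nat \<Rightarrow> 'a) \<Rightarrow> (nat \<Rightarrow> real) \<Rightarrow> nat \<Rightarrow> 'a \<Rightarrow> real" where
  "cond_mean k s x y 0 u = 0"
| "cond_mean k s x y (Suc n) u = cond_mean k s x y n u +
     cond_cov k s x n u (x (Suc n)) * (y (Suc n) - cond_mean k s x y n (x (Suc n))) /
       (s\<^sup>2 + cond_cov k s x n (x (Suc n)) (x (Suc n)))"

text \<open>The quadratic form is taken over finite sequences of points, not over sets, because a run may query a point repeatedly.\<close>

definition psd_kernel :: "('a \<Rightarrow> 'a \<Rightarrow> real) \<Rightarrow> bool" where
  "psd_kernel k \<longleftrightarrow> (\<forall>u v. k u v = k v u) \<and>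
     (\<forall>(n::nat) x c. 0 \<le> (\<Sum>i<n. \<Sum>j<n. c i * c j * k (x i) (x j)))"

lemma psd_kernel_sym: "psd_kernel k \<Longrightarrow> k u v = k v u"
  by (simp add: psd_kernel_def)

lemma psd_kernel_nonneg:
  "psd_kernel k \<Longrightarrow> 0 \<le> (\<Sum>i<n. \<Sum>j<n. c i * c j * k (x i) (x j))" for n :: nat and c :: "nat \<Rightarrow> real"
  by (simp add: psd_kernel_def)

lemma psd_kernel_diag_nonneg: "psd_kernel k \<Longrightarrow> 0 \<le> k u u"
  using psd_kernel_nonneg[of k "\<lambda>_. 1" "\<lambda>_. u" 1] by simp

text \<open>Enlarging a sample by the point \<open>w\<close> with coefficient \<open>t\<close> gives a quadratic polynomial in \<open>t\<close>. Special values
of \<open>t\<close> yield the Cauchy-Schwarz inequalities and the positivity of conditioned kernels.\<close>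

lemma psd_kernel_extend:
  fixes c :: "nat \<Rightarrow> real"
  assumes "psd_kernel k"
  shows "0 \<le> (\<Sum>i<n. \<Sum>j<n. c i * c j * k (x i) (x j)) + 2 * t * (\<Sum>i<n. c i * k (x i) w) + t\<^sup>2 * k w w"
proof -
  let ?c = "c(n := t)" and ?x = "x(n := w)"
  have "0 \<le> (\<Sum>i<Suc n. \<Sum>j<Suc n. ?c i * ?c j * k (?x i) (?x j))"
    by (rule psd_kernel_nonneg[OF assms])
  also have "\<dots> = (\<Sum>i<n. (\<Sum>j<n. c i * c j * k (x i) (x j)) + c i * t * k (x i) w)
      + ((\<Sum>j<n. t * c j * k w (x j)) + t * t * k w w)"
    by simp
  also have "\<dots> = (\<Sum>i<n. \<Sum>j<n. c i * c j * k (x i) (x j)) + 2 * t * (\<Sum>i<n. c i * k (x i) w) + t\<^sup>2 * k w w"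
  proof -
    have "(\<Sum>j<n. t * c j * k w (x j)) = t * (\<Sum>i<n. c i * k (x i) w)"
      unfolding sum_distrib_left
      by (rule sum.cong) (simp_all add: psd_kernel_sym[OF assms, of w] mult.assoc)
    moreover have "(\<Sum>i<n. c i * t * k (x i) w) = t * (\<Sum>i<n. c i * k (x i) w)"
      by (simp add: sum_distrib_left mult_ac)
    ultimately show ?thesis
      by (simp add: sum.distrib power2_eq_square)
  qed
  finally show ?thesis .
qed

lemma psd_kernel_cauchy_schwarz:
  assumes "psd_kernel k"
  shows "(k u v)\<^sup>2 \<le> k u u * k v v"
proof -
  have *: "0 \<le> k u u + 2 * t * k u v + t\<^sup>2 * k v v" for t
    using psd_kernel_extend[OF assms, of "\<lambda>_. 1" "\<lambda>_. u" 1 t v] by simp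
  show ?thesis
  proof (cases "k v v = 0")
    case True
    have "k u v = 0"
    proof (rule ccontr)
      assume "k u v \<noteq> 0"
      then have "2 * (- (k u u + 1) / (2 * k u v)) * k u v = - (k u u + 1)" by simp
      with *[of "- (k u u + 1) / (2 * k u v)"] True show False by simp
    qed
    with True show ?thesis by simp
  next
    case False
    with psd_kernel_diag_nonneg[OF assms, of v] have "k v v > 0" by simp
    have "0 \<le> k u u + 2 * (- k u v / k v v) * k u v + (- k u v / k v v)\<^sup>2 * k v v"
      by (rule *)
    also have "\<dots> = k u u - (k u v)\<^sup>2 / k v v"
      using \<open>k v v > 0\<close> by (simp add: power2_eq_square)
    finally show ?thesis
      using \<open>k v v > 0\<close> by (simp add: pos_divide_le_eq)
  qed
qed

text \<open>The coefficient \<open>t = - B / d\<close> removes the component of the sample along \<open>w\<close>, as far as the noise permits.\<close>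

lemma psd_kernel_condition:
  assumes pd: "psd_kernel k" and s: "s > 0"
  shows "psd_kernel (\<lambda>u v. k u v - k u w * k v w / (s\<^sup>2 + k w w))"
  unfolding psd_kernel_def
proof (intro conjI allI)
  fix u v
  show "k u v - k u w * k v w / (s\<^sup>2 + k w w) = k v u - k v w * k u w / (s\<^sup>2 + k w w)"
    using psd_kernel_sym[OF pd] by (simp add: mult.commute)
next
  fix n :: nat and x and c :: "nat \<Rightarrow> real"
  define Q where "Q = (\<Sum>i<n. \<Sum>j<n. c i * c j * k (x i) (x j))"
  define B where "B = (\<Sum>i<n. c i * k (x i) w)"
  define d where "d = s\<^sup>2 + k w w"
  have d: "d > 0" "k w w \<le> d"
    using psd_kernel_diag_nonneg[OF pd, of w] s by (auto simp: d_def add_pos_nonneg)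
  have "0 \<le> Q + 2 * (- B / d) * B + (- B / d)\<^sup>2 * k w w"
    unfolding Q_def B_def by (rule psd_kernel_extend[OF pd])
  also have "\<dots> \<le> Q + 2 * (- B / d) * B + (- B / d)\<^sup>2 * d"
    using d by (intro add_left_mono mult_left_mono) auto
  also have "\<dots> = Q - B * B / d"
    using d by (simp add: field_simps power2_eq_square)
  also have "B * B = (\<Sum>i<n. \<Sum>j<n. c i * c j * (k (x i) w * k (x j) w))"
    by (simp add: B_def sum_product algebra_simps)
  also have "Q - \<dots> / d = (\<Sum>i<n. \<Sum>j<n. c i * c j * (k (x i) (x j) - k (x i) w * k (x j) w / d))"
    by (simp add: Q_def sum_divide_distrib right_diff_distrib sum_subtractf)
  finally show "0 \<le> (\<Sum>i<n. \<Sum>j<n. c i * c j * (k (x i) (x j) - k (x i) w * k (x j) w / (s\<^sup>2 + k w w)))"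
    unfolding d_def .
qed

lemma psd_cond_cov: "psd_kernel k \<Longrightarrow> s > 0 \<Longrightarrow> psd_kernel (cond_cov k s x n)"
proof (induction n)
  case 0
  have "cond_cov k s x 0 = k" by (intro ext) simp
  with 0 show ?case by simp
next
  case (Suc n)
  have "cond_cov k s x (Suc n) = (\<lambda>u v. cond_cov k s x n u v -
     cond_cov k s x n u (x (Suc n)) * cond_cov k s x n v (x (Suc n)) /
       (s\<^sup>2 + cond_cov k s x n (x (Suc n)) (x (Suc n))))"
    by (intro ext) simp
  then show ?case
    using psd_kernel_condition[OF Suc.IH[OF Suc.prems] Suc.prems(2)] by (simp only:)
qed

context
  fixes k :: "'a \<Rightarrow> 'a \<Rightarrow> real" and s :: real
  assumes pd: "psd_kernel k" and s_pos: "s > 0"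
begin

lemmas psd_cond_cov_ctx = psd_cond_cov[OF pd s_pos]
lemmas cond_cov_sym = psd_kernel_sym[OF psd_cond_cov_ctx]
lemmas cond_cov_nonneg = psd_kernel_diag_nonneg[OF psd_cond_cov_ctx]

lemma cond_cov_denom_pos: "0 < s\<^sup>2 + cond_cov k s x n u u"
  using cond_cov_nonneg[of x n u] s_pos by (simp add: add_pos_nonneg)

lemma cond_cov_Suc_le: "cond_cov k s x (Suc n) u u \<le> cond_cov k s x n u u"
  using cond_cov_denom_pos[of x n "x (Suc n)"] by simp

lemma cond_cov_le_prior: "cond_cov k s x n u u \<le> k u u"
proof (induction n)
  case (Suc n)
  then show ?case using cond_cov_Suc_le[of x n u] by linarith
qed simp

text \<open>Noisy observations never determine a value completely: by Cauchy-Schwarz the variance removed at \<open>u\<close> by an observation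
at \<open>z\<close> is at most \<open>c u u * c z z / (s\<^sup>2 + c z z)\<close>, for the current posterior covariance \<open>c\<close>.\<close>

lemma cond_cov_pos:
  assumes "\<And>u. k u u > 0"
  shows "cond_cov k s x n u u > 0"
proof (induction n arbitrary: u)
  case (Suc n)
  let ?c = "cond_cov k s x n"
  let ?z = "x (Suc n)"
  have "?c u ?z * ?c u ?z \<le> ?c u u * ?c ?z ?z"
    using psd_kernel_cauchy_schwarz[OF psd_cond_cov_ctx, of x n u ?z] by (simp add: power2_eq_square)
  also have "\<dots> < ?c u u * (s\<^sup>2 + ?c ?z ?z)"
    using Suc s_pos by simp
  finally show ?case
    using cond_cov_denom_pos[of x n ?z] by (simp add: field_simps)
qed (simp add: assms)

text \<open>With \<open>A\<close> and \<open>B\<close> the deviations at \<open>u\<close> before and after, \<open>A * (A - B) \<le> A\<^sup>2 - B\<^sup>2\<close>, and Cauchy-Schwarz bounds the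
right-hand side by \<open>A\<^sup>2\<close> times the variance at the new point over \<open>s\<^sup>2\<close>. The bound is uniform in \<open>u\<close>; it controls
how far the exploration bonus can drop in one round.\<close>

lemma sqrt_cond_cov_decrement:
  "sqrt (cond_cov k s x n u u) - sqrt (cond_cov k s x (Suc n) u u)
     \<le> sqrt (cond_cov k s x n u u) * cond_cov k s x n (x (Suc n)) (x (Suc n)) / s\<^sup>2"
proof -
  let ?c = "cond_cov k s x n"
  let ?z = "x (Suc n)"
  define A B where "A = sqrt (?c u u)" and "B = sqrt (cond_cov k s x (Suc n) u u)"
  have AB: "0 \<le> B" "B \<le> A" "A\<^sup>2 = ?c u u" "B\<^sup>2 = cond_cov k s x (Suc n) u u"
    using cond_cov_nonneg[of x n u] cond_cov_nonneg[of x "Suc n" u] cond_cov_Suc_le[of x n u] 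
    by (auto simp: A_def B_def simp del: cond_cov.simps)
  have "A * (A - B) \<le> (A + B) * (A - B)"
    using AB by (intro mult_right_mono) auto
  also have "\<dots> = A\<^sup>2 - B\<^sup>2" by (simp add: power2_eq_square algebra_simps)
  also have "\<dots> = (?c u ?z)\<^sup>2 / (s\<^sup>2 + ?c ?z ?z)"
    using AB by (simp add: power2_eq_square)
  also have "\<dots> \<le> (?c u u * ?c ?z ?z) / (s\<^sup>2 + ?c ?z ?z)"
    using psd_kernel_cauchy_schwarz[OF psd_cond_cov_ctx, of x n u ?z] cond_cov_denom_pos[of x n ?z]
    by (intro divide_right_mono) auto
  also have "\<dots> \<le> (?c u u * ?c ?z ?z) / s\<^sup>2"
    using cond_cov_nonneg s_pos by (intro divide_left_mono) (auto simp: add_pos_nonneg)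
  also have "\<dots> = A * (A * ?c ?z ?z / s\<^sup>2)"
    using AB(3) by (simp add: power2_eq_square flip: AB(3))
  finally have *: "A * (A - B) \<le> A * (A * ?c ?z ?z / s\<^sup>2)" .
  show ?thesis
  proof (cases "A = 0")
    case True
    then show ?thesis using AB by (simp add: A_def B_def del: cond_cov.simps)
  next
    case False
    with AB have "A > 0" by simp
    with * have "A - B \<le> A * ?c ?z ?z / s\<^sup>2" by (simp only: mult_le_cancel_left_pos)
    then show ?thesis unfolding A_def B_def .
  qed
qed

lemma cond_mean_step_bound:
  "\<bar>cond_mean k s x y (Suc n) u - cond_mean k s x y n u\<bar>
     \<le> sqrt (cond_cov k s x n u u) * sqrt (cond_cov k s x n (x (Suc n)) (x (Suc n))) *
        \<bar>y (Suc n) - cond_mean k s x y n (x (Suc n))\<bar> / s\<^sup>2"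
proof -
  let ?c = "cond_cov k s x n"
  let ?z = "x (Suc n)"
  have "\<bar>?c u ?z\<bar> \<le> sqrt (?c u u) * sqrt (?c ?z ?z)"
    using psd_kernel_cauchy_schwarz[OF psd_cond_cov_ctx, of x n u ?z]
    by (metis real_sqrt_abs real_sqrt_le_iff real_sqrt_mult)
  moreover have "s\<^sup>2 \<le> s\<^sup>2 + ?c ?z ?z" using cond_cov_nonneg by simp
  ultimately show ?thesis
    using s_pos cond_cov_denom_pos[of x n ?z] cond_cov_nonneg
    by (auto simp: abs_mult intro!: frac_le mult_right_mono)
qed

text \<open>The covariance with \<open>u\<close> is the error in predicting the section \<open>k u\<close> from its own values at the design.
Results on posterior means therefore apply to covariances.\<close>

lemma cond_cov_eq_residual:
  "cond_cov k s x n u v = k u v - cond_mean k s x (\<lambda>i. k (x i) u) n v"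
proof (induction n arbitrary: v)
  case (Suc n)
  have "k (x (Suc n)) u - cond_mean k s x (\<lambda>i. k (x i) u) n (x (Suc n)) = cond_cov k s x n u (x (Suc n))"
    using Suc[of "x (Suc n)"] psd_kernel_sym[OF pd, of u "x (Suc n)"] by simp
  then show ?case using Suc[of v] by simp
qed simp

text \<open>The weights are \<open>a = (K + s\<^sup>2 I)\<^sup>-\<^sup>1 y\<close>, and the second claim writes the quadratic form of \<open>y\<close> as the sum of
normalised squared one-step prediction errors. A new observation at \<open>z\<close> changes the old weights by a multiple of the
weights for the section \<open>k z\<close>; this is why the induction varies \<open>y\<close>.\<close>

lemma regression_weights:
  "\<exists>a. (\<forall>i\<in>{1..n}. (\<Sum>j=1..n. (k (x i) (x j) + (if i = j then s\<^sup>2 else 0)) * a j) = y i) \<and>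
       (\<Sum>j=1..n. y j * a j) = (\<Sum>i=1..n. (y i - cond_mean k s x y (i - 1) (x i))\<^sup>2 /
           (s\<^sup>2 + cond_cov k s x (i - 1) (x i) (x i))) \<and>
       (\<forall>u. cond_mean k s x y n u = (\<Sum>j=1..n. a j * k (x j) u))"
proof (induction n arbitrary: y)
  case 0
  show ?case by simp
next
  case (Suc n)
  let ?c = "cond_cov k s x n"
  define z where "z = x (Suc n)"
  define g where "g = (y (Suc n) - cond_mean k s x y n z) / (s\<^sup>2 + ?c z z)"
  obtain a where
    u1: "\<And>i. i \<in> {1..n} \<Longrightarrow> (\<Sum>j=1..n. (k (x i) (x j) + (if i = j then s\<^sup>2 else 0)) * a j) = y i"
    and u2: "(\<Sum>j=1..n. y j * a j) = (\<Sum>i=1..n. (y i - cond_mean k s x y (i - 1) (x i))\<^sup>2 /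
           (s\<^sup>2 + cond_cov k s x (i - 1) (x i) (x i)))"
    and u3: "\<And>u. cond_mean k s x y n u = (\<Sum>j=1..n. a j * k (x j) u)"
    using Suc[of y] by blast
  obtain wz where
    z1: "\<And>i. i \<in> {1..n} \<Longrightarrow> (\<Sum>j=1..n. (k (x i) (x j) + (if i = j then s\<^sup>2 else 0)) * wz j) = k (x i) z"
    and wz: "\<And>u. cond_mean k s x (\<lambda>i. k (x i) z) n u = (\<Sum>j=1..n. wz j * k (x j) u)"
    using Suc[of "\<lambda>i. k (x i) z"] by blast
  have z2: "?c z v = k z v - (\<Sum>j=1..n. wz j * k (x j) v)" for v
    by (simp only: cond_cov_eq_residual wz)
  have z3: "cond_mean k s x y n z = (\<Sum>j=1..n. wz j * y j)"
  proof -
    have "(\<Sum>j=1..n. wz j * y j) = (\<Sum>j=1..n. wz j * (\<Sum>i=1..n. (k (x j) (x i) + (if j = i then s\<^sup>2 else 0)) * a i))"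
      by (rule sum.cong[OF refl]) (simp only: u1)
    also have "\<dots> = (\<Sum>i=1..n. \<Sum>j=1..n. wz j * ((k (x j) (x i) + (if j = i then s\<^sup>2 else 0)) * a i))"
      unfolding sum_distrib_left by (rule sum.swap)
    also have "\<dots> = (\<Sum>i=1..n. a i * (\<Sum>j=1..n. (k (x i) (x j) + (if i = j then s\<^sup>2 else 0)) * wz j))"
    proof -
      have "wz j * ((k (x j) (x i) + (if j = i then s\<^sup>2 else 0)) * a i) =
          a i * ((k (x i) (x j) + (if i = j then s\<^sup>2 else 0)) * wz j)" for i j
        using psd_kernel_sym[OF pd, of "x j" "x i"] by simp
      then show ?thesis unfolding sum_distrib_left by (intro sum.cong refl)
    qed
    also have "\<dots> = (\<Sum>i=1..n. a i * k (x i) z)"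
      by (rule sum.cong[OF refl]) (simp only: z1)
    finally show ?thesis by (simp only: u3)
  qed
  define w where "w = (\<lambda>j. if j = Suc n then g else a j - g * wz j)"
  have w_old: "(\<Sum>j=1..n. f j * w j) = (\<Sum>j=1..n. f j * a j) - g * (\<Sum>j=1..n. f j * wz j)" for f
  proof -
    have "(\<Sum>j=1..n. f j * w j) = (\<Sum>j=1..n. f j * a j - g * (f j * wz j))"
      by (rule sum.cong) (auto simp: w_def algebra_simps)
    then show ?thesis by (simp add: sum_subtractf sum_distrib_left)
  qed
  have sum_ksym: "(\<Sum>j=1..n. k z (x j) * f j) = (\<Sum>j=1..n. f j * k (x j) z)" for f
    by (rule sum.cong) (simp_all add: psd_kernel_sym[OF pd, of z] mult.commute)
  have A1: "(\<Sum>j=1..n. k z (x j) * a j) = cond_mean k s x y n z"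
    by (simp only: sum_ksym u3)
  have A2: "(\<Sum>j=1..n. k z (x j) * wz j) = k z z - ?c z z"
    by (simp only: sum_ksym z2)
  have gd: "g * (s\<^sup>2 + ?c z z) = y (Suc n) - cond_mean k s x y n z"
    using cond_cov_denom_pos[of x n z] by (simp add: g_def)
  show ?case
  proof (intro exI[of _ w] conjI ballI allI)
    fix i assume i: "i \<in> {1..Suc n}"
    show "(\<Sum>j=1..Suc n. (k (x i) (x j) + (if i = j then s\<^sup>2 else 0)) * w j) = y i"
    proof (cases "i = Suc n")
      case False
      with i have i': "i \<in> {1..n}" by auto
      have "(\<Sum>j=1..Suc n. (k (x i) (x j) + (if i = j then s\<^sup>2 else 0)) * w j)
          = (\<Sum>j=1..n. (k (x i) (x j) + (if i = j then s\<^sup>2 else 0)) * w j) + k (x i) z * g"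
        using False by (simp add: z_def w_def)
      also have "\<dots> = y i"
        unfolding w_old u1[OF i'] z1[OF i'] by (simp add: algebra_simps)
      finally show ?thesis .
    next
      case True
      have *: "(\<Sum>j=1..n. (k (x i) (x j) + (if i = j then s\<^sup>2 else 0)) * w j) = (\<Sum>j=1..n. k z (x j) * w j)"
        using True by (intro sum.cong) (auto simp: z_def)
      have "(\<Sum>j=1..Suc n. (k (x i) (x j) + (if i = j then s\<^sup>2 else 0)) * w j)
         = (\<Sum>j=1..n. k z (x j) * w j) + (k z z + s\<^sup>2) * g"
        by (simp only: sum_upto_Suc *) (simp add: True z_def w_def)
      also have "\<dots> = cond_mean k s x y n z - g * (k z z - ?c z z) + (k z z + s\<^sup>2) * g"
        by (simp only: w_old[of "\<lambda>j. k z (x j)"] A1 A2)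
      also have "\<dots> = y (Suc n)" using gd by (simp add: ring_distribs mult.commute[of g])
      finally show ?thesis using True by simp
    qed
  next
    have "(\<Sum>j=1..n. y j * wz j) = cond_mean k s x y n z"
      by (simp add: z3 mult.commute)
    then have "(\<Sum>j=1..Suc n. y j * w j) = (\<Sum>j=1..n. y j * a j) + g * (y (Suc n) - cond_mean k s x y n z)"
      by (simp only: sum_upto_Suc w_old) (simp add: w_def algebra_simps)
    also have "\<dots> = (\<Sum>j=1..n. y j * a j) + (y (Suc n) - cond_mean k s x y n z)\<^sup>2 / (s\<^sup>2 + ?c z z)"
      by (simp add: g_def power2_eq_square)
    finally show "(\<Sum>j=1..Suc n. y j * w j) = (\<Sum>i=1..Suc n. (y i - cond_mean k s x y (i - 1) (x i))\<^sup>2 /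
           (s\<^sup>2 + cond_cov k s x (i - 1) (x i) (x i)))"
      by (simp only: sum_upto_Suc u2 z_def diff_Suc_1)
  next
    fix u
    have "cond_mean k s x y (Suc n) u = cond_mean k s x y n u + g * ?c z u"
      using cond_cov_sym[of x n u z] by (simp add: g_def z_def)
    also have "\<dots> = (\<Sum>j=1..n. k (x j) u * w j) + g * k z u"
      unfolding w_old u3 z2 by (simp add: algebra_simps)
    also have "\<dots> = (\<Sum>j=1..Suc n. w j * k (x j) u)"
      by (simp add: w_def z_def mult.commute)
    finally show "cond_mean k s x y (Suc n) u = (\<Sum>j=1..Suc n. w j * k (x j) u)" .
  qed
qed

text \<open>The left-hand side is the quadratic form of the inverse of \<open>K + s\<^sup>2 I\<close>, and this matrix dominates \<open>s\<^sup>2 I\<close>.\<close>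

lemma prediction_energy:
  "(\<Sum>i=1..n. (y i - cond_mean k s x y (i - 1) (x i))\<^sup>2 / (s\<^sup>2 + cond_cov k s x (i - 1) (x i) (x i)))
     \<le> (\<Sum>i=1..n. (y i)\<^sup>2) / s\<^sup>2"
proof -
  obtain a where
    a1: "\<And>i. i \<in> {1..n} \<Longrightarrow> (\<Sum>j=1..n. (k (x i) (x j) + (if i = j then s\<^sup>2 else 0)) * a j) = y i"
    and a2: "(\<Sum>j=1..n. y j * a j) = (\<Sum>i=1..n. (y i - cond_mean k s x y (i - 1) (x i))\<^sup>2 /
           (s\<^sup>2 + cond_cov k s x (i - 1) (x i) (x i)))"
    using regression_weights[of n x y] by blast
  define S where "S = (\<Sum>j=1..n. y j * a j)"
  have "S = (\<Sum>i=1..n. a i * (\<Sum>j=1..n. (k (x i) (x j) + (if i = j then s\<^sup>2 else 0)) * a j))"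
    unfolding S_def by (rule sum.cong[OF refl]) (metis a1 mult.commute)
  also have "\<dots> = (\<Sum>i=1..n. (\<Sum>j=1..n. a i * a j * k (x i) (x j)) + s\<^sup>2 * (a i)\<^sup>2)"
  proof (rule sum.cong, rule refl)
    fix i assume "i \<in> {1..n}"
    then have "(\<Sum>j=1..n. (if i = j then s\<^sup>2 else 0) * a j) = s\<^sup>2 * a i"
      by (simp add: if_distrib[of "\<lambda>c. c * _"] cong: if_cong)
    then show "a i * (\<Sum>j=1..n. (k (x i) (x j) + (if i = j then s\<^sup>2 else 0)) * a j)
        = (\<Sum>j=1..n. a i * a j * k (x i) (x j)) + s\<^sup>2 * (a i)\<^sup>2"
      by (simp add: distrib_right sum.distrib distrib_left sum_distrib_left power2_eq_square algebra_simps)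
  qed
  also have "\<dots> = (\<Sum>i=1..n. \<Sum>j=1..n. a i * a j * k (x i) (x j)) + s\<^sup>2 * (\<Sum>i=1..n. (a i)\<^sup>2)"
    by (simp add: sum.distrib sum_distrib_left)
  also have "(\<Sum>i=1..n. \<Sum>j=1..n. a i * a j * k (x i) (x j)) =
      (\<Sum>i<n. \<Sum>j<n. a (Suc i) * a (Suc j) * k (x (Suc i)) (x (Suc j)))"
    by (simp add: sum.atLeast1_atMost_eq)
  finally have S_ge: "s\<^sup>2 * (\<Sum>i=1..n. (a i)\<^sup>2) \<le> S"
    using psd_kernel_nonneg[OF pd, of "\<lambda>i. a (Suc i)" "\<lambda>i. x (Suc i)" n] by simp
  have "2 * S = (\<Sum>j=1..n. 2 * (y j * a j))" by (simp add: S_def sum_distrib_left)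
  also have "\<dots> \<le> (\<Sum>j=1..n. (y j)\<^sup>2 / s\<^sup>2 + s\<^sup>2 * (a j)\<^sup>2)"
  proof (rule sum_mono)
    fix j
    have "0 \<le> (y j / s - s * a j)\<^sup>2" by simp
    then show "2 * (y j * a j) \<le> (y j)\<^sup>2 / s\<^sup>2 + s\<^sup>2 * (a j)\<^sup>2"
      using s_pos by (simp add: power2_diff power_divide power_mult_distrib)
  qed
  also have "\<dots> = (\<Sum>j=1..n. (y j)\<^sup>2) / s\<^sup>2 + s\<^sup>2 * (\<Sum>j=1..n. (a j)\<^sup>2)"
    by (simp add: sum.distrib sum_divide_distrib sum_distrib_left)
  finally show ?thesis using S_ge a2 by (simp add: S_def)
qed

end

section \<open>Determinants and the information gain\<close>

text \<open>The determinant of \<open>I + K / s\<^sup>2\<close>, written so that its logarithm is a sum over the rounds; the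
logarithm is twice the information gain.\<close>

definition gain_product :: "('a \<Rightarrow> 'a \<Rightarrow> real) \<Rightarrow> real \<Rightarrow> (nat \<Rightarrow> 'a) \<Rightarrow> nat \<Rightarrow> real" where
  "gain_product k s x n = (\<Prod>i=1..n. 1 + cond_cov k s x (i - 1) (x i) (x i) / s\<^sup>2)"

context
  fixes k :: "'a \<Rightarrow> 'a \<Rightarrow> real" and s :: real
  assumes pd: "psd_kernel k" and s_pos: "s > 0"
begin

lemma prior_decomposition:
  "k u v = cond_cov k s x n u v +
     (\<Sum>m=1..n. cond_cov k s x (m - 1) u (x m) * cond_cov k s x (m - 1) v (x m) /
        (s\<^sup>2 + cond_cov k s x (m - 1) (x m) (x m)))"
proof (induction n)
  case (Suc n)
  then show ?case by (simp only: sum_upto_Suc cond_cov.simps diff_Suc_1)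
qed simp

text \<open>The lower triangular factor has the normalised posterior covariances with the earlier points below its unit diagonal, and
the predictive variances of the observations form the diagonal factor: the sum is the telescoped recursion.\<close>

lemma regularised_matrix_ldl:
  fixes x n
  defines "d \<equiv> \<lambda>m. s\<^sup>2 + cond_cov k s x (m - 1) (x m) (x m)"
  defines "L \<equiv> \<lambda>i m. if m < i then cond_cov k s x (m - 1) (x i) (x m) / d m else if m = i then 1 else 0"
  assumes i: "1 \<le> i" "i \<le> n" and j: "1 \<le> j" "j \<le> n"
  shows "k (x i) (x j) + (if i = j then s\<^sup>2 else 0) = (\<Sum>m=1..n. L i m * (d m * L j m))"
proof -
  have d: "d m > 0" for m unfolding d_def by (rule cond_cov_denom_pos[OF pd s_pos])
  have le: "k (x i) (x j) + (if i = j then s\<^sup>2 else 0) = (\<Sum>m=1..n. L i m * (d m * L j m))"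
    if i: "1 \<le> i" and j: "j \<le> n" and ij: "i \<le> j" for i j
  proof -
    obtain i' where i': "i = Suc i'" using i by (cases i) auto
    have "(\<Sum>m=1..n. L i m * (d m * L j m)) = (\<Sum>m=1..i. L i m * (d m * L j m))"
      using ij j by (intro sum.mono_neutral_right) (auto simp: L_def)
    also have "\<dots> = (\<Sum>m=1..i'. L i m * (d m * L j m)) + d i * L j i"
      by (simp only: i' sum_upto_Suc) (simp add: L_def)
    also have "(\<Sum>m=1..i'. L i m * (d m * L j m)) =
        (\<Sum>m=1..i'. cond_cov k s x (m - 1) (x i) (x m) * cond_cov k s x (m - 1) (x j) (x m) / d m)"
    proof (rule sum.cong[OF refl])
      fix m assume "m \<in> {1..i'}"
      with i' ij have "m < i" "m < j" by auto
      then show "L i m * (d m * L j m) =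
          cond_cov k s x (m - 1) (x i) (x m) * cond_cov k s x (m - 1) (x j) (x m) / d m"
        using d[of m] by (simp add: L_def)
    qed
    also have "\<dots> = k (x i) (x j) - cond_cov k s x i' (x i) (x j)"
      using prior_decomposition[of "x i" "x j" x i'] by (simp add: d_def)
    also have "d i * L j i = cond_cov k s x i' (x i) (x j) + (if i = j then s\<^sup>2 else 0)"
      using d[of i] ij cond_cov_sym[OF pd s_pos, of x i' "x i" "x j"] by (auto simp: L_def d_def i')
    finally show ?thesis by simp
  qed
  show ?thesis
  proof (cases "i \<le> j")
    case True
    then show ?thesis using le i j by blast
  next
    case False
    then have "k (x j) (x i) + (if j = i then s\<^sup>2 else 0) = (\<Sum>m=1..n. L j m * (d m * L i m))"
      using le[of j i] i j by simp
    then show ?thesis using False psd_kernel_sym[OF pd, of "x i" "x j"] by (simp add: mult_ac)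
  qed
qed

lemma det_regularised_kernel_mat:
  "Determinant.det (kernel_mat k (map x [1..<Suc n]) + s\<^sup>2 \<cdot>\<^sub>m 1\<^sub>m n) = s ^ (2 * n) * gain_product k s x n"
proof -
  let ?K = "kernel_mat k (map x [1..<Suc n])"
  define d where "d = (\<lambda>m. s\<^sup>2 + cond_cov k s x (m - 1) (x m) (x m))"
  define L where "L = (\<lambda>i m. if m < i then cond_cov k s x (m - 1) (x i) (x m) / d m else if m = i then 1 else 0)"
  define M where "M = mat n n (\<lambda>(i, j). L (Suc i) (Suc j))"
  define N where "N = mat n n (\<lambda>(i, j). d (Suc i) * L (Suc j) (Suc i))"
  have M: "M \<in> carrier_mat n n" and N: "N \<in> carrier_mat n n" by (auto simp: M_def N_def)
  have "?K + s\<^sup>2 \<cdot>\<^sub>m 1\<^sub>m n = M * N"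
  proof (rule eq_matI)
    fix i j assume ij: "i < dim_row (M * N)" "j < dim_col (M * N)"
    then have ij': "i < n" "j < n" using M N by auto
    have "(?K + s\<^sup>2 \<cdot>\<^sub>m 1\<^sub>m n) $$ (i, j) = k (x (Suc i)) (x (Suc j)) + (if Suc i = Suc j then s\<^sup>2 else 0)"
      using ij' by (simp add: kernel_mat_def del: upt_Suc)
    also have "\<dots> = (\<Sum>m=1..n. L (Suc i) m * (d m * L (Suc j) m))"
      unfolding L_def d_def by (rule regularised_matrix_ldl) (use ij' in auto)
    also have "\<dots> = (\<Sum>m=0..<n. L (Suc i) (Suc m) * (d (Suc m) * L (Suc j) (Suc m)))"
      by (simp add: sum.atLeast1_atMost_eq lessThan_atLeast0)
    also have "\<dots> = (M * N) $$ (i, j)"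
      using ij' M N by (simp add: M_def N_def scalar_prod_def)
    finally show "(?K + s\<^sup>2 \<cdot>\<^sub>m 1\<^sub>m n) $$ (i, j) = (M * N) $$ (i, j)" .
  qed (use M N in \<open>auto simp: kernel_mat_def\<close>)
  moreover have "Determinant.det M = 1"
  proof -
    have "Determinant.det M = prod_list (diag_mat M)"
      by (rule det_lower_triangular[OF _ M]) (auto simp: M_def L_def)
    also have "\<dots> = 1"
      by (simp add: prod_list_diag_prod) (simp add: M_def L_def)
    finally show ?thesis .
  qed
  moreover have "Determinant.det N = (\<Prod>i=1..n. d i)"
  proof -
    have "Determinant.det N = prod_list (diag_mat N)"
      by (rule det_upper_triangular[OF _ N]) (auto simp: N_def L_def upper_triangular_def)
    also have "\<dots> = (\<Prod>i=0..<n. d (Suc i))"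
      by (simp add: prod_list_diag_prod) (simp add: N_def L_def)
    finally show ?thesis by (simp add: prod.atLeast1_atMost_eq lessThan_atLeast0)
  qed
  moreover have "(\<Prod>i=1..n. d i) = s ^ (2 * n) * gain_product k s x n"
  proof -
    have "(\<Prod>i=1..n. d i) = (\<Prod>i=1..n. s\<^sup>2 * (1 + cond_cov k s x (i - 1) (x i) (x i) / s\<^sup>2))"
      using s_pos by (intro prod.cong) (auto simp: d_def field_simps)
    also have "\<dots> = (s\<^sup>2) ^ n * gain_product k s x n"
      unfolding gain_product_def by (simp add: prod.distrib)
    finally show ?thesis by (simp add: power_mult)
  qed
  ultimately show ?thesis using det_mult[OF M N] by simp
qed

lemma gain_product_pos: "gain_product k s x n > 0"
  unfolding gain_product_def using cond_cov_nonneg[OF pd s_pos] by (intro prod_pos ballI) (auto intro!: add_pos_nonneg)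

lemma det_eq_gain_product:
  assumes "length xs = n" and x: "\<And>i. i < n \<Longrightarrow> x (Suc i) = xs ! i"
  shows "Determinant.det (1\<^sub>m n + (1 / s\<^sup>2) \<cdot>\<^sub>m kernel_mat k xs) = gain_product k s x n"
proof -
  have xs: "map x [1..<Suc n] = xs"
    using assms by (intro nth_equalityI) (auto simp del: upt_Suc)
  have [simp]: "kernel_mat k xs \<in> carrier_mat n n" using assms by (simp add: kernel_mat_def)
  have "1\<^sub>m n + (1 / s\<^sup>2) \<cdot>\<^sub>m kernel_mat k xs = (1 / s\<^sup>2) \<cdot>\<^sub>m (kernel_mat k xs + s\<^sup>2 \<cdot>\<^sub>m 1\<^sub>m n)"
    using s_pos assms by (intro eq_matI) (auto simp: kernel_mat_def field_simps)
  also have "Determinant.det \<dots> = (1 / s\<^sup>2) ^ n * (s ^ (2 * n) * gain_product k s x n)"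
    using det_regularised_kernel_mat[of x n] xs assms by (simp add: kernel_mat_def del: upt_Suc)
  also have "\<dots> = gain_product k s x n"
    using s_pos by (simp add: power_mult power_divide)
  finally show ?thesis .
qed

text \<open>The matrix formulas and the recursion use weights solving the same linear system, which is regular because its
determinant is a product of positive predictive variances.\<close>

lemma post_eq_cond:
  "post_cov k s (map x [1..<Suc n]) u v = cond_cov k s x n u v" (is ?cov)
  "post_mean k s (map x [1..<Suc n]) (map y [1..<Suc n]) u = cond_mean k s x y n u" (is ?mean)
proof -
  let ?xs = "map x [1..<Suc n]"
  let ?A = "kernel_mat k ?xs + s\<^sup>2 \<cdot>\<^sub>m 1\<^sub>m n"
  have A: "?A \<in> carrier_mat n n" by (simp add: kernel_mat_def)
  have "Determinant.det ?A \<noteq> 0"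
    unfolding det_regularised_kernel_mat using gain_product_pos[of x n] s_pos by simp
  then have "?A \<in> Units (ring_mat TYPE(real) n ())"
    by (rule det_non_zero_imp_unit[OF A])
  then have "mat_inverse ?A \<noteq> None"
    using mat_inverse(1)[OF A, where b = "()"] by blast
  then obtain B where B: "mat_inverse ?A = Some B" by blast
  have reg: "reg_inverse k s ?xs = B" unfolding reg_inverse_def using B by (simp del: upt_Suc)
  from mat_inverse(2)[OF A B] have B: "B * ?A = 1\<^sub>m n" "B \<in> carrier_mat n n" by auto
  have solve: "B *\<^sub>v b = Matrix.vec n (\<lambda>j. a (Suc j))"
    if b: "b \<in> carrier_vec n"
      and eq: "\<And>i. i \<in> {1..n} \<Longrightarrow> (\<Sum>j=1..n. (k (x i) (x j) + (if i = j then s\<^sup>2 else 0)) * a j) = vec_index b (i - 1)"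
    for a b
  proof -
    let ?a = "Matrix.vec n (\<lambda>j. a (Suc j))"
    have "?A *\<^sub>v ?a = b"
    proof (rule eq_vecI)
      fix i assume "i < dim_vec b"
      then have i: "i < n" using b by simp
      have "vec_index (?A *\<^sub>v ?a) i = (\<Sum>j=0..<n. (k (x (Suc i)) (x (Suc j)) + (if i = j then s\<^sup>2 else 0)) * a (Suc j))"
        using i by (auto simp: kernel_mat_def scalar_prod_def simp del: upt_Suc intro!: sum.cong)
      also have "\<dots> = (\<Sum>j=1..n. (k (x (Suc i)) (x j) + (if Suc i = j then s\<^sup>2 else 0)) * a j)"
        by (simp add: sum.atLeast1_atMost_eq lessThan_atLeast0)
      also have "\<dots> = vec_index b i" using eq[of "Suc i"] i by simp
      finally show "vec_index (?A *\<^sub>v ?a) i = vec_index b i" .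
    qed (use b in \<open>auto simp: kernel_mat_def\<close>)
    then have "B *\<^sub>v b = B *\<^sub>v (?A *\<^sub>v ?a)" by simp
    also have "\<dots> = (B * ?A) *\<^sub>v ?a" by (rule assoc_mult_mat_vec[symmetric, OF B(2) A]) simp
    also have "\<dots> = ?a" using B by simp
    finally show ?thesis .
  qed
  have prod: "scalar_prod (kernel_vec k ?xs u) (Matrix.vec n (\<lambda>j. a (Suc j))) = (\<Sum>j=1..n. a j * k (x j) u)" for a
    by (simp add: kernel_vec_def scalar_prod_def sum.atLeast1_atMost_eq lessThan_atLeast0 mult.commute del: upt_Suc)
  obtain w where w1: "\<And>i. i \<in> {1..n} \<Longrightarrow> (\<Sum>j=1..n. (k (x i) (x j) + (if i = j then s\<^sup>2 else 0)) * w j) = k (x i) v"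
    and "\<And>u. cond_mean k s x (\<lambda>i. k (x i) v) n u = (\<Sum>j=1..n. w j * k (x j) u)"
    using regression_weights[OF pd s_pos, of n x "\<lambda>i. k (x i) v"] by blast
  then have w2: "cond_cov k s x n v u = k v u - (\<Sum>j=1..n. w j * k (x j) u)" for u
    by (simp only: cond_cov_eq_residual[OF pd s_pos])
  have "B *\<^sub>v kernel_vec k ?xs v = Matrix.vec n (\<lambda>j. w (Suc j))"
  proof (rule solve)
    show "kernel_vec k ?xs v \<in> carrier_vec n"
      by (simp add: kernel_vec_def del: upt_Suc)
    fix i assume i: "i \<in> {1..n}"
    then have "vec_index (kernel_vec k ?xs v) (i - 1) = k (x i) v"
      by (auto simp: kernel_vec_def simp del: upt_Suc)
    with w1[OF i] show "(\<Sum>j=1..n. (k (x i) (x j) + (if i = j then s\<^sup>2 else 0)) * w j) =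
        vec_index (kernel_vec k ?xs v) (i - 1)" by simp
  qed
  then show ?cov
    unfolding post_cov_def reg using prod[of w] w2[of u] psd_kernel_sym[OF pd, of u v] cond_cov_sym[OF pd s_pos, of x n u v]
    by (simp del: upt_Suc)
  obtain a where a1: "\<And>i. i \<in> {1..n} \<Longrightarrow> (\<Sum>j=1..n. (k (x i) (x j) + (if i = j then s\<^sup>2 else 0)) * a j) = y i"
    and a2: "\<And>u. cond_mean k s x y n u = (\<Sum>j=1..n. a j * k (x j) u)"
    using regression_weights[OF pd s_pos, of n x y] by blast
  have "B *\<^sub>v vec_of_list (map y [1..<Suc n]) = Matrix.vec n (\<lambda>j. a (Suc j))"
  proof (rule solve)
    show "vec_of_list (map y [1..<Suc n]) \<in> carrier_vec n"
      by (metis carrier_vecI dim_vec_of_list length_map length_upt diff_Suc_1)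
    fix i assume i: "i \<in> {1..n}"
    have "vec_index (vec_of_list (map y [1..<Suc n])) (i - 1) = map y [1..<Suc n] ! (i - 1)"
      by (rule vec_of_list_index)
    also have "\<dots> = y i"
      using i by (subst nth_map) (auto simp del: upt_Suc)
    finally show "(\<Sum>j=1..n. (k (x i) (x j) + (if i = j then s\<^sup>2 else 0)) * a j) =
        vec_index (vec_of_list (map y [1..<Suc n])) (i - 1)" using a1[OF i] by simp
  qed
  then show ?mean
    unfolding post_mean_def reg using prod[of a] a2[of u] by (simp del: upt_Suc)
qed

end

text \<open>Here \<open>p\<close>, \<open>q\<close>, \<open>r\<close> are the residuals of a feature at two points and at the new design point, \<open>a\<close> and \<open>b\<close> the covariances
of the two points with the new one, \<open>d\<close> its predictive variance and \<open>t\<close> the normaliser of the feature. The left-hand side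
conditions the kernel with the feature, the right-hand side conditions the kernel, the residuals and the normaliser.\<close>

lemma add_feature_algebra:
  fixes d t :: real
  assumes "d > 0" "t > 0"
  shows "C + p * q / t - (a + p * r / t) * (b + q * r / t) / (d + r * r / t)
       = C - a * b / d + (p - a * r / d) * (q - b * r / d) / (t + r\<^sup>2 / d)"
proof -
  define D where "D = d * t + r\<^sup>2"
  have D: "D > 0" using assms by (simp add: D_def add_pos_nonneg)
  have 1: "d + r * r / t = D / t" "t + r\<^sup>2 / d = D / d"
    using assms by (simp_all add: D_def field_simps power2_eq_square)
  have 2: "a + p * r / t = (a * t + p * r) / t" "b + q * r / t = (b * t + q * r) / t"
      "p - a * r / d = (p * d - a * r) / d" "q - b * r / d = (q * d - b * r) / d"
    using assms by (simp_all add: field_simps)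
  have "p * q / t - (a * t + p * r) * (b * t + q * r) / (t * D)
      = - a * b / d + (p * d - a * r) * (q * d - b * r) / (d * D)"
  proof -
    have "d * D * (p * q) - d * ((a * t + p * r) * (b * t + q * r))
       = t * ((p * d - a * r) * (q * d - b * r)) - t * D * (a * b)"
      by (simp add: D_def algebra_simps power2_eq_square)
    then have "(d * D * (p * q) - d * ((a * t + p * r) * (b * t + q * r))) / (t * d * D)
       = (t * ((p * d - a * r) * (q * d - b * r)) - t * D * (a * b)) / (t * d * D)" by simp
    then show ?thesis using assms D by (simp add: diff_divide_distrib mult_ac)
  qed
  moreover have "X / u * (Y / u) / (D / u) = X * Y / (u * D)" if "u > 0" for X Y u
    using that D by (simp add: field_simps)
  ultimately show ?thesis
    unfolding 1 2 using assms by simp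
qed

lemma psd_kernel_add_feature:
  assumes "psd_kernel k"
  shows "psd_kernel (\<lambda>u v. k u v + f u * f v)"
  unfolding psd_kernel_def
proof (intro conjI allI)
  show "k u v + f u * f v = k v u + f v * f u" for u v
    using psd_kernel_sym[OF assms, of u v] by simp
  fix n :: nat and x c
  have "(\<Sum>i<n. \<Sum>j<n. c i * c j * (k (x i) (x j) + f (x i) * f (x j)))
      = (\<Sum>i<n. \<Sum>j<n. c i * c j * k (x i) (x j)) + (\<Sum>i<n. c i * f (x i))\<^sup>2"
    by (simp add: power2_eq_square sum_product sum.distrib algebra_simps)
  then show "0 \<le> (\<Sum>i<n. \<Sum>j<n. c i * c j * (k (x i) (x j) + f (x i) * f (x j)))"
    using psd_kernel_nonneg[OF assms, of c x n] by simp
qed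

text \<open>Conditioning \<open>k + f \<otimes> f\<close> gives the conditioned \<open>k\<close> plus \<open>r \<otimes> r / t\<close>, where \<open>r\<close> is the error in predicting \<open>f\<close> and \<open>t\<close>
is 1 plus the sum of the squared normalised prediction errors so far. The factors of the two products then differ by the
ratio of consecutive values of \<open>t\<close>, so the products differ by the final \<open>t\<close>, which \<open>prediction_energy\<close> bounds.\<close>

lemma gain_product_add_feature:
  assumes pd: "psd_kernel k" and s_pos: "s > 0"
  shows "gain_product (\<lambda>u v. k u v + f u * f v) s x n \<le> gain_product k s x n * (1 + (\<Sum>i=1..n. (f (x i))\<^sup>2) / s\<^sup>2)"
proof -
  let ?k' = "\<lambda>u v. k u v + f u * f v"
  define m where "m = cond_mean k s x (\<lambda>i. f (x i))"
  define c where "c = cond_cov k s x"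
  define r where "r = (\<lambda>n u. f u - m n u)"
  define t where "t = (\<lambda>n. 1 + (\<Sum>i=1..n. (r (i - 1) (x i))\<^sup>2 / (s\<^sup>2 + c (i - 1) (x i) (x i))))"
  have d_pos: "s\<^sup>2 + c n u u > 0" for n u
    unfolding c_def by (rule cond_cov_denom_pos[OF pd s_pos])
  have t_pos: "t n > 0" for n
    unfolding t_def using d_pos by (intro add_pos_nonneg sum_nonneg) (auto intro!: divide_nonneg_pos)
  have t_Suc: "t (Suc n) = t n + (r n (x (Suc n)))\<^sup>2 / (s\<^sup>2 + c n (x (Suc n)) (x (Suc n)))" for n
    by (simp add: t_def)
  have r_Suc: "r (Suc n) u = r n u - c n u (x (Suc n)) * r n (x (Suc n)) / (s\<^sup>2 + c n (x (Suc n)) (x (Suc n)))" for n u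
    by (simp add: r_def m_def c_def)
  have c_Suc: "c (Suc n) u v = c n u v - c n u (x (Suc n)) * c n v (x (Suc n)) / (s\<^sup>2 + c n (x (Suc n)) (x (Suc n)))" for n u v
    by (simp add: c_def)
  have cc': "cond_cov ?k' s x n u v = c n u v + r n u * r n v / t n" for n u v
  proof (induction n arbitrary: u v)
    case 0
    show ?case by (simp add: c_def r_def m_def t_def)
  next
    case (Suc n)
    let ?z = "x (Suc n)"
    have "cond_cov ?k' s x (Suc n) u v = c n u v + r n u * r n v / t n -
       (c n u ?z + r n u * r n ?z / t n) * (c n v ?z + r n v * r n ?z / t n) /
       ((s\<^sup>2 + c n ?z ?z) + r n ?z * r n ?z / t n)"
      by (simp add: Suc add.assoc)
    also have "\<dots> = c (Suc n) u v + r (Suc n) u * r (Suc n) v / t (Suc n)"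
      unfolding add_feature_algebra[OF d_pos t_pos] c_Suc r_Suc t_Suc by simp
    finally show ?case .
  qed
  have "gain_product ?k' s x n = gain_product k s x n * t n"
  proof (induction n)
    case 0
    show ?case by (simp add: gain_product_def t_def)
  next
    case (Suc n)
    let ?z = "x (Suc n)"
    have "t n * (1 + (c n ?z ?z + r n ?z * r n ?z / t n) / s\<^sup>2) = (1 + c n ?z ?z / s\<^sup>2) * t (Suc n)"
    proof -
      have "(1 + c n ?z ?z / s\<^sup>2) * t (Suc n) = (s\<^sup>2 + c n ?z ?z) / s\<^sup>2 * t (Suc n)"
        using s_pos by (simp add: field_simps)
      also have "\<dots> = ((s\<^sup>2 + c n ?z ?z) * t n + (r n ?z)\<^sup>2) / s\<^sup>2"
      proof -
        have "D / s\<^sup>2 * (t n + R / D) = (D * t n + R) / s\<^sup>2" if "D > 0" for D R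
          using that s_pos by (simp add: field_simps)
        from this[OF d_pos[of n ?z]] show ?thesis unfolding t_Suc .
      qed
      also have "\<dots> = t n * (1 + (c n ?z ?z + r n ?z * r n ?z / t n) / s\<^sup>2)"
        using s_pos t_pos[of n] by (simp add: field_simps power2_eq_square)
      finally show ?thesis ..
    qed
    then show ?case
      using Suc
      by (simp add: gain_product_def cc' c_def[symmetric] mult.assoc)
  qed
  also have "t n \<le> 1 + (\<Sum>i=1..n. (f (x i))\<^sup>2) / s\<^sup>2"
    using prediction_energy[OF pd s_pos, of "\<lambda>i. f (x i)" x n]
    by (simp add: t_def r_def m_def c_def)
  finally show ?thesis
    using gain_product_pos[OF pd s_pos, of x n] by simp
qed

section \<open>The squared exponential kernel\<close>

text \<open>The power series of \<open>exp (z * z' / l\<^sup>2)\<close> gives a feature expansion of the one-dimensional kernel after multiplication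
with Gaussian envelopes.\<close>

definition se_feature1 :: "real \<Rightarrow> nat \<Rightarrow> real \<Rightarrow> real" where
  "se_feature1 l m z = exp (- z\<^sup>2 / (2 * l\<^sup>2)) * (z / l) ^ m / sqrt (fact m)"

definition se_feature :: "real \<Rightarrow> ('d::finite \<Rightarrow> nat) \<Rightarrow> real ^ 'd \<Rightarrow> real" where
  "se_feature l \<alpha> u = (\<Prod>i\<in>UNIV. se_feature1 l (\<alpha> i) (u $ i))"

lemma se_feature1_product:
  "se_feature1 l m z * se_feature1 l m z' =
     exp (- (z\<^sup>2 + z'\<^sup>2) / (2 * l\<^sup>2)) * ((z * z' / l\<^sup>2) ^ m / fact m)"
proof -
  have "exp (- (z\<^sup>2 + z'\<^sup>2) / (2 * l\<^sup>2)) = exp (- z\<^sup>2 / (2 * l\<^sup>2)) * exp (- z'\<^sup>2 / (2 * l\<^sup>2))"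
    by (simp add: add_divide_distrib diff_divide_distrib flip: exp_add)
  moreover have "(z * z' / l\<^sup>2) ^ m = (z / l) ^ m * (z' / l) ^ m"
    by (simp add: power_mult_distrib power_divide power2_eq_square)
  ultimately show ?thesis
    by (simp add: se_feature1_def)
qed

lemma se_feature1_sums:
  assumes "l > 0"
  shows "(\<lambda>m. se_feature1 l m z * se_feature1 l m z') sums exp (- 1 / (2 * l\<^sup>2) * (z - z')\<^sup>2)"
proof -
  have "(\<lambda>m. exp (- (z\<^sup>2 + z'\<^sup>2) / (2 * l\<^sup>2)) * ((z * z' / l\<^sup>2) ^ m / fact m)) sums
     (exp (- (z\<^sup>2 + z'\<^sup>2) / (2 * l\<^sup>2)) * exp (z * z' / l\<^sup>2))"
    using exp_converges[of "z * z' / l\<^sup>2"] by (intro sums_mult) (simp add: divide_inverse mult.commute)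
  moreover have "exp (- (z\<^sup>2 + z'\<^sup>2) / (2 * l\<^sup>2)) * exp (z * z' / l\<^sup>2) = exp (- 1 / (2 * l\<^sup>2) * (z - z')\<^sup>2)"
  proof -
    have "- (z\<^sup>2 + z'\<^sup>2) / (2 * l\<^sup>2) + z * z' / l\<^sup>2 = - 1 / (2 * l\<^sup>2) * (z - z')\<^sup>2"
      using assms by (simp add: field_simps power2_diff)
    then show ?thesis by (simp flip: exp_add)
  qed
  ultimately show ?thesis by (simp add: se_feature1_product)
qed

text \<open>The truncation keeps the multi-indices in a cube, which makes the partial sums products over the coordinates.\<close>

definition se_trunc :: "real \<Rightarrow> nat \<Rightarrow> real ^ 'd::finite \<Rightarrow> real ^ 'd \<Rightarrow> real" where
  "se_trunc l M u v = (\<Sum>\<alpha>\<in>UNIV \<rightarrow>\<^sub>E {..<M}. se_feature l \<alpha> u * se_feature l \<alpha> v)"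

lemma se_kernel_prod: "se_kernel l u v = (\<Prod>i\<in>UNIV. exp (- 1 / (2 * l\<^sup>2) * (u $ i - v $ i)\<^sup>2))"
  for u v :: "real ^ 'd"
proof -
  have "(norm (u - v))\<^sup>2 = (\<Sum>i\<in>UNIV. (u $ i - v $ i)\<^sup>2)"
    by (simp add: norm_vec_def L2_set_def sum_nonneg)
  then show ?thesis
    by (simp add: se_kernel_def sum_distrib_left flip: exp_sum)
qed

lemma se_trunc_tendsto:
  fixes u v :: "real ^ 'd"
  assumes "l > 0"
  shows "(\<lambda>M. se_trunc l M u v) \<longlonglongrightarrow> se_kernel l u v"
proof -
  have "se_trunc l M u v = (\<Prod>i\<in>UNIV. \<Sum>m<M. se_feature1 l m (u $ i) * se_feature1 l m (v $ i))" for M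
    by (simp add: se_trunc_def se_feature_def prod_sum_PiE flip: prod.distrib)
  moreover have "(\<lambda>M. \<Prod>i\<in>UNIV. \<Sum>m<M. se_feature1 l m (u $ i) * se_feature1 l m (v $ i)) \<longlonglongrightarrow> se_kernel l u v"
    unfolding se_kernel_prod using se_feature1_sums[OF assms]
    by (intro tendsto_prod) (auto simp: sums_def)
  ultimately show ?thesis by simp
qed

lemma psd_kernel_sum_features:
  assumes "finite J"
  shows "psd_kernel (\<lambda>u v. \<Sum>\<alpha>\<in>J. f \<alpha> u * f \<alpha> v)"
  using assms
proof (induction J)
  case empty
  show ?case by (simp add: psd_kernel_def)
next
  case (insert a J)
  then show ?case using psd_kernel_add_feature[OF insert.IH, of "f a"] by (simp add: add.commute)
qed

lemma gain_product_sum_features: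
  assumes "finite J" and s: "s > 0"
  shows "gain_product (\<lambda>u v. \<Sum>\<alpha>\<in>J. f \<alpha> u * f \<alpha> v) s x n \<le> (\<Prod>\<alpha>\<in>J. 1 + (\<Sum>i=1..n. (f \<alpha> (x i))\<^sup>2) / s\<^sup>2)"
  using assms(1)
proof (induction J)
  case empty
  have "cond_cov (\<lambda>u v. 0) s x n u v = 0" for n u v
    by (induction n arbitrary: u v) auto
  then show ?case by (simp add: gain_product_def)
next
  case (insert a J)
  have "gain_product (\<lambda>u v. \<Sum>\<alpha>\<in>insert a J. f \<alpha> u * f \<alpha> v) s x n
      = gain_product (\<lambda>u v. (\<Sum>\<alpha>\<in>J. f \<alpha> u * f \<alpha> v) + f a u * f a v) s x n"
    using insert by (simp add: add.commute)
  also have "\<dots> \<le> gain_product (\<lambda>u v. \<Sum>\<alpha>\<in>J. f \<alpha> u * f \<alpha> v) s x n * (1 + (\<Sum>i=1..n. (f a (x i))\<^sup>2) / s\<^sup>2)"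
    by (rule gain_product_add_feature[OF psd_kernel_sum_features[OF insert(1)] s])
  also have "\<dots> \<le> (\<Prod>\<alpha>\<in>J. 1 + (\<Sum>i=1..n. (f \<alpha> (x i))\<^sup>2) / s\<^sup>2) * (1 + (\<Sum>i=1..n. (f a (x i))\<^sup>2) / s\<^sup>2)"
    using insert.IH by (intro mult_right_mono add_nonneg_nonneg divide_nonneg_nonneg sum_nonneg) auto
  finally show ?case using insert by (simp add: mult.commute)
qed

lemma psd_kernel_limit:
  assumes lim: "\<And>u v. (\<lambda>M. K M u v) \<longlonglongrightarrow> k u v" and pd: "\<And>M. psd_kernel (K M)"
  shows "psd_kernel k"
  unfolding psd_kernel_def
proof (intro conjI allI)
  fix u v
  have "(\<lambda>M. K M u v) = (\<lambda>M. K M v u)" using psd_kernel_sym[OF pd] by auto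
  then show "k u v = k v u" using LIMSEQ_unique[OF lim[of u v]] lim[of v u] by simp
next
  fix n :: nat and x c
  have "(\<lambda>M. \<Sum>i<n. \<Sum>j<n. c i * c j * K M (x i) (x j)) \<longlonglongrightarrow> (\<Sum>i<n. \<Sum>j<n. c i * c j * k (x i) (x j))"
    by (intro tendsto_intros lim)
  then show "0 \<le> (\<Sum>i<n. \<Sum>j<n. c i * c j * k (x i) (x j))"
    by (rule LIMSEQ_le_const) (use psd_kernel_nonneg[OF pd] in auto)
qed

lemma cond_cov_tendsto:
  assumes lim: "\<And>u v. (\<lambda>M. K M u v) \<longlonglongrightarrow> k u v" and pd: "psd_kernel k" and s: "s > 0"
  shows "(\<lambda>M. cond_cov (K M) s x n u v) \<longlonglongrightarrow> cond_cov k s x n u v"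
proof (induction n arbitrary: u v)
  case (Suc n)
  have "s\<^sup>2 + cond_cov k s x n (x (Suc n)) (x (Suc n)) \<noteq> 0"
    using cond_cov_denom_pos[OF pd s, of x n "x (Suc n)"] by simp
  then show ?case by (auto intro!: tendsto_intros Suc)
qed (simp add: lim)

lemma gain_product_tendsto:
  assumes lim: "\<And>u v. (\<lambda>M. K M u v) \<longlonglongrightarrow> k u v" and pd: "psd_kernel k" and s: "s > 0"
  shows "(\<lambda>M. gain_product (K M) s x n) \<longlonglongrightarrow> gain_product k s x n"
  unfolding gain_product_def using s by (intro tendsto_intros cond_cov_tendsto[OF lim pd s]) auto

lemma psd_se_kernel: "l > 0 \<Longrightarrow> psd_kernel (se_kernel l :: real ^ 'd \<Rightarrow> real ^ 'd \<Rightarrow> real)"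
proof (rule psd_kernel_limit)
  show "psd_kernel (se_trunc l M :: real ^ 'd \<Rightarrow> real ^ 'd \<Rightarrow> real)" for M
  proof -
    have "se_trunc l M = (\<lambda>u v :: real ^ 'd. \<Sum>\<alpha>\<in>UNIV \<rightarrow>\<^sub>E {..<M}. se_feature l \<alpha> u * se_feature l \<alpha> v)"
      by (intro ext) (simp add: se_trunc_def)
    then show ?thesis by (simp only:) (intro psd_kernel_sum_features finite_PiE; simp)
  qed
qed (rule se_trunc_tendsto)

lemma sum_le_sums: "f sums a \<Longrightarrow> finite I \<Longrightarrow> (\<And>n. f n \<ge> 0) \<Longrightarrow> sum f I \<le> a" for a :: real
  using sum_le_suminf[of f I] by (simp add: sums_iff)

lemma se_feature1_sq_le_1: "l > 0 \<Longrightarrow> (se_feature1 l m z)\<^sup>2 \<le> 1"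
proof -
  assume l: "l > 0"
  have "(\<Sum>j\<in>{m}. se_feature1 l j z * se_feature1 l j z) \<le> exp (- 1 / (2 * l\<^sup>2) * (z - z)\<^sup>2)"
    by (rule sum_le_sums[OF se_feature1_sums[OF l]]) auto
  then show ?thesis by (simp add: power2_eq_square)
qed

lemma se_feature_sq_le_1: "l > 0 \<Longrightarrow> (se_feature l \<alpha> u)\<^sup>2 \<le> 1"
  unfolding se_feature_def prod_power_distrib
  by (rule prod_le_1) (simp add: se_feature1_sq_le_1)

text \<open>The squared features are Poisson weights with parameter \<open>q = z\<^sup>2 / l\<^sup>2\<close>, and this is the exponential moment of that law.\<close>

lemma se_feature1_moment:
  assumes l: "l > 0" and z: "z\<^sup>2 \<le> r\<^sup>2"
  shows "(\<Sum>m<M. exp (real m) * (se_feature1 l m z)\<^sup>2) \<le> exp ((exp 1 - 1) * (r\<^sup>2 / l\<^sup>2))"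
proof -
  let ?q = "z\<^sup>2 / l\<^sup>2"
  have eq: "exp (real m) * (se_feature1 l m z)\<^sup>2 = exp (- ?q) * ((exp 1 * ?q) ^ m /\<^sub>R fact m)" for m
    using se_feature1_product[of l m z z]
    by (simp add: power2_eq_square power_mult_distrib exp_of_nat_mult[of m 1, simplified] field_simps)
  have "(\<Sum>m<M. exp (real m) * (se_feature1 l m z)\<^sup>2) = exp (- ?q) * (\<Sum>m<M. (exp 1 * ?q) ^ m /\<^sub>R fact m)"
    by (simp add: eq sum_distrib_left)
  also have "\<dots> \<le> exp (- ?q) * exp (exp 1 * ?q)"
    by (intro mult_left_mono sum_le_sums[OF exp_converges]) auto
  also have "\<dots> = exp ((exp 1 - 1) * ?q)"
    by (simp add: algebra_simps diff_divide_distrib flip: exp_add)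
  also have "\<dots> \<le> exp ((exp 1 - 1) * (r\<^sup>2 / l\<^sup>2))"
    using l z exp_ge_add_one_self[of 1]
    by (simp only: exp_le_cancel_iff) (intro mult_left_mono divide_right_mono; simp)
  finally show ?thesis .
qed

lemma se_feature_moment:
  fixes u :: "real ^ 'd"
  assumes l: "l > 0" and u: "\<And>i. (u $ i)\<^sup>2 \<le> r\<^sup>2"
  shows "(\<Sum>\<alpha>\<in>UNIV \<rightarrow>\<^sub>E {..<M}. exp (\<Sum>i\<in>UNIV. real (\<alpha> i)) * (se_feature l \<alpha> u)\<^sup>2)
     \<le> exp ((exp 1 - 1) * (r\<^sup>2 / l\<^sup>2)) ^ CARD('d)"
proof -
  have "(\<Sum>\<alpha>\<in>UNIV \<rightarrow>\<^sub>E {..<M}. exp (\<Sum>i\<in>UNIV. real (\<alpha> i)) * (se_feature l \<alpha> u)\<^sup>2)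
     = (\<Sum>\<alpha>\<in>UNIV \<rightarrow>\<^sub>E {..<M}. \<Prod>i\<in>UNIV. exp (real (\<alpha> i)) * (se_feature1 l (\<alpha> i) (u $ i))\<^sup>2)"
    by (simp add: se_feature_def exp_sum prod_power_distrib prod.distrib)
  also have "\<dots> = (\<Prod>i\<in>UNIV. \<Sum>m<M. exp (real m) * (se_feature1 l m (u $ i))\<^sup>2)"
    by (simp add: prod_sum_PiE)
  also have "\<dots> \<le> (\<Prod>i\<in>(UNIV :: 'd set). exp ((exp 1 - 1) * (r\<^sup>2 / l\<^sup>2)))"
    using se_feature1_moment[OF l u] by (intro prod_mono conjI sum_nonneg) auto
  finally show ?thesis by simp
qed

text \<open>A multi-index with all entries below \<open>m\<close> contributes at most \<open>ln (1 + n / s\<^sup>2)\<close>, and there are at most \<open>m\<close> to the power of the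
dimension of them. Any other multi-index has total degree at least \<open>m\<close>; inserting the factor \<open>exp (degree - m) \<ge> 1\<close> bounds the
contribution of all of these by \<open>exp (- m)\<close> times an exponential moment, uniformly in the truncation.\<close>

lemma ln_gain_product_se_kernel:
  fixes x :: "nat \<Rightarrow> real ^ 'd"
  assumes l: "l > 0" and s: "s > 0" and x: "\<And>i j. i \<in> {1..n} \<Longrightarrow> (x i $ j)\<^sup>2 \<le> r\<^sup>2"
  shows "ln (gain_product (se_kernel l) s x n) \<le>
     real m ^ CARD('d) * ln (1 + real n / s\<^sup>2) +
     exp (- real m) * (real n * exp ((exp 1 - 1) * (r\<^sup>2 / l\<^sup>2)) ^ CARD('d) / s\<^sup>2)"
    (is "_ \<le> ?A + exp (- real m) * (real n * ?E / s\<^sup>2)")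
proof -
  let ?k = "se_kernel l :: real ^ 'd \<Rightarrow> real ^ 'd \<Rightarrow> real"
  define S where "S = (\<lambda>\<alpha>. (\<Sum>i=1..n. (se_feature l \<alpha> (x i))\<^sup>2) / s\<^sup>2)"
  have S_nonneg: "S \<alpha> \<ge> 0" for \<alpha> unfolding S_def by (intro divide_nonneg_nonneg sum_nonneg) auto
  have S_le: "S \<alpha> \<le> real n / s\<^sup>2" for \<alpha>
  proof -
    have "(\<Sum>i=1..n. (se_feature l \<alpha> (x i))\<^sup>2) \<le> (\<Sum>i=1..n. 1)"
      by (intro sum_mono se_feature_sq_le_1[OF l])
    then show ?thesis unfolding S_def using s by (intro divide_right_mono) auto
  qed
  have bound: "ln (gain_product (se_trunc l M) s x n) \<le> ?A + exp (- real m) * (real n * ?E / s\<^sup>2)" for M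
  proof -
    let ?J = "UNIV \<rightarrow>\<^sub>E {..<M} :: ('d \<Rightarrow> nat) set"
    let ?I = "{\<alpha>\<in>?J. \<forall>i. \<alpha> i < m}"
    have fin: "finite ?J" by (simp add: finite_PiE)
    have tr: "se_trunc l M = (\<lambda>u v :: real ^ 'd. \<Sum>\<alpha>\<in>?J. se_feature l \<alpha> u * se_feature l \<alpha> v)"
      by (intro ext) (simp add: se_trunc_def)
    have "gain_product (se_trunc l M) s x n \<le> (\<Prod>\<alpha>\<in>?J. 1 + S \<alpha>)"
      unfolding tr S_def by (rule gain_product_sum_features[OF fin s])
    moreover have "0 < gain_product (se_trunc l M) s x n"
      unfolding tr by (rule gain_product_pos[OF psd_kernel_sum_features[OF fin] s])
    ultimately have "ln (gain_product (se_trunc l M) s x n) \<le> ln (\<Prod>\<alpha>\<in>?J. 1 + S \<alpha>)"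
      by simp
    also have "\<dots> = (\<Sum>\<alpha>\<in>?J. ln (1 + S \<alpha>))"
    proof (rule ln_prod[OF fin])
      show "1 + S \<alpha> \<noteq> 0" for \<alpha> using S_nonneg[of \<alpha>] by linarith
    qed
    also have "\<dots> = (\<Sum>\<alpha>\<in>?I. ln (1 + S \<alpha>)) + (\<Sum>\<alpha>\<in>?J - ?I. ln (1 + S \<alpha>))"
      using fin by (subst sum.subset_diff[of ?I]) auto
    also have "(\<Sum>\<alpha>\<in>?I. ln (1 + S \<alpha>)) \<le> real (card ?I) * ln (1 + real n / s\<^sup>2)"
      using S_nonneg S_le by (intro sum_bounded_above) (simp add: add_pos_nonneg)
    also have "\<dots> \<le> ?A"
    proof -
      have "card ?I \<le> card (UNIV \<rightarrow>\<^sub>E {..<m} :: ('d \<Rightarrow> nat) set)"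
        by (intro card_mono finite_PiE) auto
      also have "\<dots> = m ^ CARD('d)" by (simp add: card_PiE)
      finally have "real (card ?I) \<le> real m ^ CARD('d)"
        unfolding of_nat_power[symmetric] of_nat_le_iff .
      then show ?thesis using s by (intro mult_right_mono) auto
    qed
    also have "(\<Sum>\<alpha>\<in>?J - ?I. ln (1 + S \<alpha>)) \<le> (\<Sum>\<alpha>\<in>?J - ?I. exp (- real m) * (exp (\<Sum>i\<in>UNIV. real (\<alpha> i)) * S \<alpha>))"
    proof (rule sum_mono)
      fix \<alpha> assume "\<alpha> \<in> ?J - ?I"
      then obtain i where "m \<le> \<alpha> i" by (auto simp: not_less)
      also have "\<alpha> i \<le> (\<Sum>i\<in>UNIV. \<alpha> i)" by (rule member_le_sum) auto
      finally have "real m \<le> (\<Sum>i\<in>UNIV. real (\<alpha> i))" unfolding of_nat_sum[symmetric] of_nat_le_iff .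
      then have "1 \<le> exp (- real m) * exp (\<Sum>i\<in>UNIV. real (\<alpha> i))"
        by (simp flip: exp_add)
      then have "1 * S \<alpha> \<le> exp (- real m) * exp (\<Sum>i\<in>UNIV. real (\<alpha> i)) * S \<alpha>"
        by (rule mult_right_mono) (rule S_nonneg)
      then show "ln (1 + S \<alpha>) \<le> exp (- real m) * (exp (\<Sum>i\<in>UNIV. real (\<alpha> i)) * S \<alpha>)"
        using ln_add_one_self_le_self[OF S_nonneg[of \<alpha>]] by (simp add: mult.assoc)
    qed
    also have "\<dots> \<le> (\<Sum>\<alpha>\<in>?J. exp (- real m) * (exp (\<Sum>i\<in>UNIV. real (\<alpha> i)) * S \<alpha>))"
      using fin S_nonneg by (intro sum_mono2) auto
    also have "\<dots> = exp (- real m) * ((\<Sum>i=1..n. \<Sum>\<alpha>\<in>?J. exp (\<Sum>j\<in>UNIV. real (\<alpha> j)) * (se_feature l \<alpha> (x i))\<^sup>2) / s\<^sup>2)"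
      by (subst sum.swap) (simp add: S_def sum_distrib_left sum_divide_distrib)
    also have "\<dots> \<le> exp (- real m) * ((\<Sum>i=1..n. ?E) / s\<^sup>2)"
      by (intro mult_left_mono divide_right_mono sum_mono se_feature_moment[OF l] x) auto
    finally show ?thesis by simp
  qed
  have "(\<lambda>M. ln (gain_product (se_trunc l M) s x n)) \<longlonglongrightarrow> ln (gain_product ?k s x n)"
    using gain_product_pos[OF psd_se_kernel[OF l] s, of x n]
    by (intro tendsto_ln gain_product_tendsto[OF se_trunc_tendsto[OF l] psd_se_kernel[OF l] s]) auto
  then show ?thesis
    by (rule LIMSEQ_le_const2) (use bound in auto)
qed

text \<open>The previous bound for \<open>m\<close> about \<open>ln n\<close>. The dimension enters only as the cardinality of a type, hence the type argument.\<close>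

definition se_gain_bound :: "real \<Rightarrow> real \<Rightarrow> real \<Rightarrow> 'd::finite itself \<Rightarrow> nat \<Rightarrow> real" where
  "se_gain_bound l s r _ n = (ln (real n) + 1) ^ CARD('d) * ln (1 + real n / s\<^sup>2) +
     exp ((exp 1 - 1) * (r\<^sup>2 / l\<^sup>2)) ^ CARD('d) / s\<^sup>2"

lemma ln_gain_product_le_se_gain_bound:
  fixes x :: "nat \<Rightarrow> real ^ 'd"
  assumes l: "l > 0" and s: "s > 0" and x: "\<And>i j. i \<in> {1..n} \<Longrightarrow> (x i $ j)\<^sup>2 \<le> r\<^sup>2" and n: "n \<ge> 1"
  shows "ln (gain_product (se_kernel l) s x n) \<le> se_gain_bound l s r TYPE('d) n"
proof -
  define m where "m = nat \<lceil>ln (real n)\<rceil>"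
  define E where "E = exp ((exp 1 - 1) * (r\<^sup>2 / l\<^sup>2)) ^ CARD('d)"
  have m: "ln (real n) \<le> real m" "real m \<le> ln (real n) + 1"
    using n ln_ge_zero[of "real n"] unfolding m_def by (simp_all add: of_nat_nat)
  have "exp (- real m) * real n \<le> exp (- ln (real n)) * real n"
    using m by (intro mult_right_mono) auto
  also have "\<dots> = 1" using n by (simp add: exp_minus)
  finally have 1: "exp (- real m) * real n \<le> 1" .
  have "ln (gain_product (se_kernel l) s x n) \<le> real m ^ CARD('d) * ln (1 + real n / s\<^sup>2) + exp (- real m) * (real n * E / s\<^sup>2)"
    unfolding E_def by (rule ln_gain_product_se_kernel[OF l s x])
  also have "exp (- real m) * (real n * E / s\<^sup>2) = (exp (- real m) * real n) * (E / s\<^sup>2)" by simp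
  also have "\<dots> \<le> 1 * (E / s\<^sup>2)"
    using 1 by (rule mult_right_mono) (simp add: E_def)
  also have "real m ^ CARD('d) * ln (1 + real n / s\<^sup>2) \<le> (ln (real n) + 1) ^ CARD('d) * ln (1 + real n / s\<^sup>2)"
    using m n by (intro mult_right_mono power_mono) auto
  finally show ?thesis by (simp add: se_gain_bound_def E_def)
qed

lemma se_gain_bound_bigo: "se_gain_bound l s r TYPE('d::finite) \<in> O(\<lambda>n. ln (real n) ^ (CARD('d) + 1))"
proof -
  have 1: "(\<lambda>n. ln (real n) + 1) \<in> O(\<lambda>n. ln (real n))" by real_asymp
  have "(\<lambda>n. ln (1 + real n * c)) \<in> O(\<lambda>n. ln (real n))" if "c > 0" for c
    using that by real_asymp
  from this[of "1 / s\<^sup>2"] have 2: "(\<lambda>n. ln (1 + real n / s\<^sup>2)) \<in> O(\<lambda>n. ln (real n))" if "s \<noteq> 0"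
    using that by simp
  have 3: "(\<lambda>n. ln (1 + real n / s\<^sup>2)) \<in> O(\<lambda>n. ln (real n))"
    using 2 by (cases "s = 0") auto
  have 4: "(\<lambda>_. c) \<in> O(\<lambda>n. ln (real n) ^ (CARD('d) + 1))" for c :: real
  proof -
    have "(\<lambda>_::nat. 1 :: real) \<in> O(\<lambda>n. ln (real n))" by real_asymp
    from landau_o.big_power[OF this, of "CARD('d) + 1"] show ?thesis
      by (cases "c = 0") simp_all
  qed
  show ?thesis
    unfolding se_gain_bound_def
    by (intro sum_in_bigo 4) (use landau_o.big.mult[OF landau_o.big_power[OF 1] 3, of "CARD('d)"] in \<open>simp add: mult.commute\<close>)
qed

text \<open>If the domain has fewer than \<open>T\<close> points, then the supremum ranges over the empty set; its value is some constant
that does not depend on \<open>T\<close>.\<close>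

lemma info_gain_se_kernel:
  fixes D :: "(real ^ 'd) set"
  assumes l: "l > 0" and s: "s > 0" and D: "\<And>x j. x \<in> D \<Longrightarrow> (x $ j)\<^sup>2 \<le> r\<^sup>2"
  shows "info_gain (se_kernel l) s D \<in> O(\<lambda>T. ln (real T) ^ (CARD('d) + 1))"
proof -
  define c where "c = \<bar>Sup {} :: real\<bar>"
  have "\<bar>info_gain (se_kernel l) s D T\<bar> \<le> \<bar>se_gain_bound l s r TYPE('d) T\<bar> + c" if T: "T \<ge> 1" for T
  proof -
    define S where "S = {1 / 2 * ln (Determinant.det (1\<^sub>m T + (1 / s\<^sup>2) \<cdot>\<^sub>m kernel_mat (se_kernel l) xs)) |
            xs. distinct xs \<and> set xs \<subseteq> D \<and> length xs = T}"
    have info: "info_gain (se_kernel l) s D T = Sup S" unfolding info_gain_def S_def ..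
    have *: "0 \<le> v \<and> v \<le> se_gain_bound l s r TYPE('d) T" if "v \<in> S" for v
    proof -
      from that obtain xs where xs: "set xs \<subseteq> D" "length xs = T"
        and v: "v = 1 / 2 * ln (Determinant.det (1\<^sub>m T + (1 / s\<^sup>2) \<cdot>\<^sub>m kernel_mat (se_kernel l) xs))"
        unfolding S_def by blast
      define x where "x = (\<lambda>i. xs ! (i - 1))"
      have v': "v = 1 / 2 * ln (gain_product (se_kernel l) s x T)"
        unfolding v by (subst det_eq_gain_product[OF psd_se_kernel[OF l] s xs(2)]) (simp_all add: x_def)
      have "ln (gain_product (se_kernel l) s x T) \<le> se_gain_bound l s r TYPE('d) T"
      proof (rule ln_gain_product_le_se_gain_bound[OF l s _ T])
        fix i j assume "i \<in> {1..T}"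
        then have "x i \<in> D" using xs by (auto simp: x_def subset_iff)
        then show "(x i $ j)\<^sup>2 \<le> r\<^sup>2" by (rule D)
      qed
      moreover have "1 \<le> gain_product (se_kernel l) s x T"
        unfolding gain_product_def using cond_cov_nonneg[OF psd_se_kernel[OF l] s] by (intro prod_ge_1) (auto intro!: divide_nonneg_nonneg)
      then have "0 \<le> ln (gain_product (se_kernel l) s x T)" by simp
      ultimately show ?thesis using v' by auto
    qed
    show ?thesis
    proof (cases "S = {}")
      case True
      then show ?thesis unfolding info c_def by simp
    next
      case False
      then obtain v where v: "v \<in> S" by auto
      have "Sup S \<le> se_gain_bound l s r TYPE('d) T"
        using False * by (intro cSup_least) auto
      moreover have "v \<le> Sup S" using v * by (intro cSup_upper bdd_aboveI) auto
      moreover have "0 \<le> v" using * v by auto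
      ultimately show ?thesis unfolding info c_def by linarith
    qed
  qed
  then have "info_gain (se_kernel l) s D \<in> O(\<lambda>T. \<bar>se_gain_bound l s r TYPE('d) T\<bar> + c)"
    by (intro bigoI[of _ 1] eventually_sequentiallyI[of 1]) (auto simp: c_def)
  also have "(\<lambda>T. \<bar>se_gain_bound l s r TYPE('d) T\<bar> + c) \<in> O(\<lambda>T. ln (real T) ^ (CARD('d) + 1))"
  proof (rule sum_in_bigo)
    show "(\<lambda>T. \<bar>se_gain_bound l s r TYPE('d) T\<bar>) \<in> O(\<lambda>T. ln (real T) ^ (CARD('d) + 1))"
      using se_gain_bound_bigo[of l s r, where 'd='d] by simp
    have "(\<lambda>_::nat. 1 :: real) \<in> O(\<lambda>n. ln (real n))" by real_asymp
    from landau_o.big_power[OF this, of "CARD('d) + 1"] show "(\<lambda>_. c) \<in> O(\<lambda>T. ln (real T) ^ (CARD('d) + 1))"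
      by (cases "c = 0") simp_all
  qed
  finally show ?thesis .
qed

section \<open>Gaussian processes under a Gaussian likelihood\<close>

lemma normal_density_char:
  assumes "s > 0"
  shows "(CLINT x|density lborel (normal_density m s). iexp (t * x)) =
    iexp (t * m) * complex_of_real (exp (- (t * s)\<^sup>2 / 2))"
proof -
  let ?M = "density lborel (normal_density m s)"
  interpret N: prob_space ?M by (rule prob_space_normal_density[OF assms])
  have "distributed ?M lborel (\<lambda>x. x) (normal_density m s)"
    by (auto simp: distributed_def intro!: measure_eqI simp: emeasure_distr)
  then have D: "distributed ?M lborel (\<lambda>x. (x - m) / s) std_normal_density"
    using N.normal_standard_normal_convert[OF assms, of "\<lambda>x. x" m] by simp
  have "(CLINT x|?M. iexp (t * x)) = (CLINT x|?M. iexp (t * m) * iexp ((t * s) * ((x - m) / s)))"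
  proof (rule Bochner_Integration.integral_cong[OF refl])
    fix x
    have "t * x = t * m + (t * s) * ((x - m) / s)" using assms by (simp add: field_simps)
    then show "iexp (t * x) = iexp (t * m) * iexp ((t * s) * ((x - m) / s))"
      by (simp only: of_real_add distrib_left exp_add)
  qed
  also have "\<dots> = iexp (t * m) * (CLINT x|?M. iexp ((t * s) * ((x - m) / s)))"
    by simp
  also have "(CLINT x|?M. iexp ((t * s) * ((x - m) / s))) = char (distr ?M lborel (\<lambda>x. (x - m) / s)) (t * s)"
    unfolding char_def by (subst integral_distr) auto
  also have "distr ?M lborel (\<lambda>x. (x - m) / s) = std_normal_distribution"
    by (rule distributed_distr_eq_density[OF D])
  also have "char std_normal_distribution (t * s) = complex_of_real (exp (- (t * s)\<^sup>2 / 2))"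
    by (simp add: char_std_normal_distribution)
  finally show ?thesis .
qed

lemma normal_rv_char:
  assumes "prob_space P" and Z: "normal_rv P Z"
  shows "integrable P Z" "integrable P (\<lambda>\<omega>. (Z \<omega>)\<^sup>2)"
    "(CLINT \<omega>|P. iexp (Z \<omega>)) =
      iexp (\<integral>\<omega>. Z \<omega> \<partial>P) * complex_of_real (exp (- ((\<integral>\<omega>. (Z \<omega>)\<^sup>2 \<partial>P) - (\<integral>\<omega>. Z \<omega> \<partial>P)\<^sup>2) / 2))"
proof -
  interpret prob_space P by fact
  have "integrable P Z \<and> integrable P (\<lambda>\<omega>. (Z \<omega>)\<^sup>2) \<and> (CLINT \<omega>|P. iexp (Z \<omega>)) =
      iexp (\<integral>\<omega>. Z \<omega> \<partial>P) * complex_of_real (exp (- ((\<integral>\<omega>. (Z \<omega>)\<^sup>2 \<partial>P) - (\<integral>\<omega>. Z \<omega> \<partial>P)\<^sup>2) / 2))"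
    using Z unfolding normal_rv_def
  proof (elim disjE exE conjE)
    fix m s assume s: "s > 0" and D: "distributed P lborel Z (normal_density m s)"
    have i1: "integrable P Z"
      using distributed_integrable[OF D, of "\<lambda>x. x"] integrable_normal_moment_nz_1[OF s, of m] by simp
    have "integrable lborel (\<lambda>x. normal_density m s x * (x - m)^2 + 2 * m * (normal_density m s x * (x - m)^1) + m\<^sup>2 * normal_density m s x)"
      by (intro Bochner_Integration.integrable_add integrable_mult_right integrable_normal_moment integrable_normal_density s)
    also have "(\<lambda>x. normal_density m s x * (x - m)^2 + 2 * m * (normal_density m s x * (x - m)^1) + m\<^sup>2 * normal_density m s x) =
       (\<lambda>x. normal_density m s x * x\<^sup>2)"
      by (intro ext) (simp add: power2_eq_square algebra_simps)
    finally have i2: "integrable P (\<lambda>\<omega>. (Z \<omega>)\<^sup>2)"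
      using distributed_integrable[OF D, of "\<lambda>x. x\<^sup>2"] by simp
    have e: "expectation Z = m" by (rule normal_distributed_expectation[OF s D])
    have "expectation (\<lambda>\<omega>. (Z \<omega>)\<^sup>2) - (expectation Z)\<^sup>2 = s\<^sup>2"
      using variance_eq[OF i1 i2] normal_distributed_variance[OF s D] by simp
    moreover have "(CLINT \<omega>|P. iexp (Z \<omega>)) = iexp m * complex_of_real (exp (- s\<^sup>2 / 2))"
    proof -
      have [measurable]: "Z \<in> borel_measurable P" using i1 by simp
      have "(CLINT \<omega>|P. iexp (Z \<omega>)) = (CLINT x|distr P lborel Z. iexp (1 * x))"
        by (subst integral_distr) auto
      also have "distr P lborel Z = density lborel (normal_density m s)"
        by (rule distributed_distr_eq_density[OF D])
      finally show ?thesis using normal_density_char[OF s, of m 1] by simp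
    qed
    ultimately show ?thesis using i1 i2 e by simp
  next
    fix m assume [measurable]: "Z \<in> borel_measurable P" and m: "AE \<omega> in P. Z \<omega> = m"
    have "integrable P (\<lambda>\<omega>. f (Z \<omega>)) \<and>
          (\<integral>\<omega>. f (Z \<omega>) \<partial>P) = f m" if "f \<in> borel_measurable borel" for f :: "real \<Rightarrow> real"
    proof -
      have [measurable]: "f \<in> borel_measurable borel" by fact
      have ae: "AE \<omega> in P. f m = f (Z \<omega>)" using m by eventually_elim simp
      have "integrable P (\<lambda>\<omega>. f (Z \<omega>))"
        by (rule integrable_cong_AE_imp[OF _ _ ae]) auto
      moreover have "(\<integral>\<omega>. f (Z \<omega>) \<partial>P) = (\<integral>\<omega>. f m \<partial>P)"
        by (rule integral_cong_AE) (use ae in auto)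
      ultimately show ?thesis by (simp add: prob_space)
    qed
    from this[of "\<lambda>x. x"] this[of "\<lambda>x. x\<^sup>2"]
    have 1: "integrable P Z" "expectation Z = m" "integrable P (\<lambda>\<omega>. (Z \<omega>)\<^sup>2)"
      "expectation (\<lambda>\<omega>. (Z \<omega>)\<^sup>2) = m\<^sup>2" by auto
    have ae: "AE \<omega> in P. iexp (Z \<omega>) = iexp m" using m by eventually_elim simp
    have "(CLINT \<omega>|P. iexp (Z \<omega>)) = (CLINT \<omega>|P. iexp m)"
      by (rule integral_cong_AE) (use ae in auto)
    with 1 show ?thesis by (simp add: prob_space)
  qed
  then show "integrable P Z" "integrable P (\<lambda>\<omega>. (Z \<omega>)\<^sup>2)"
    "(CLINT \<omega>|P. iexp (Z \<omega>)) =
      iexp (\<integral>\<omega>. Z \<omega> \<partial>P) * complex_of_real (exp (- ((\<integral>\<omega>. (Z \<omega>)\<^sup>2 \<partial>P) - (\<integral>\<omega>. Z \<omega> \<partial>P)\<^sup>2) / 2))"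
    by blast+
qed

text \<open>The variance of the linear combination of the process with coefficients \<open>c\<close> on the finite set \<open>F\<close>.\<close>

definition qform :: "'a set \<Rightarrow> ('a \<Rightarrow> 'a \<Rightarrow> real) \<Rightarrow> ('a \<Rightarrow> real) \<Rightarrow> real" where
  "qform F k c = (\<Sum>u\<in>F. \<Sum>v\<in>F. c u * c v * k u v)"

lemma gaussian_process_char:
  assumes "prob_space P" and gp: "gaussian_process P D (\<lambda>x. 0) k U" and F: "finite F" "F \<subseteq> D"
  shows "(CLINT \<omega>|P. iexp (\<Sum>u\<in>F. c u * U u \<omega>)) = complex_of_real (exp (- qform F k c / 2))"
proof -
  interpret prob_space P by fact
  have lin: "normal_rv P (\<lambda>\<omega>. \<Sum>x\<in>F. c x * U x \<omega>)" if "finite F" "F \<subseteq> D" for F c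
    using gp that by (simp add: gaussian_process_def)
  have mean: "expectation (U u) = 0" if "u \<in> D" for u
    using gp that by (simp add: gaussian_process_def)
  have cov: "expectation (\<lambda>\<omega>. U u \<omega> * U v \<omega>) = k u v" if "u \<in> D" "v \<in> D" for u v
    using gp that by (simp add: gaussian_process_def)
  have U1: "normal_rv P (U u)" if "u \<in> D" for u
    using lin[of "{u}" "\<lambda>_. 1"] that by simp
  have i1: "integrable P (U u)" and i2: "integrable P (\<lambda>\<omega>. (U u \<omega>)\<^sup>2)" if "u \<in> D" for u
    using normal_rv_char[OF assms(1) U1[OF that]] by auto
  have [measurable]: "U u \<in> borel_measurable P" if "u \<in> D" for u
    using i1[OF that] by simp
  have i12: "integrable P (\<lambda>\<omega>. U u \<omega> * U v \<omega>)" if "u \<in> D" "v \<in> D" for u v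
  proof (rule Bochner_Integration.integrable_bound)
    show "integrable P (\<lambda>\<omega>. (U u \<omega>)\<^sup>2 + (U v \<omega>)\<^sup>2)"
      using i2 that by auto
    show "AE \<omega> in P. norm (U u \<omega> * U v \<omega>) \<le> norm ((U u \<omega>)\<^sup>2 + (U v \<omega>)\<^sup>2)"
    proof (rule AE_I2)
      fix \<omega>
      have "0 \<le> (\<bar>U u \<omega>\<bar> - \<bar>U v \<omega>\<bar>)\<^sup>2" by simp
      then have "2 * (\<bar>U u \<omega>\<bar> * \<bar>U v \<omega>\<bar>) \<le> (U u \<omega>)\<^sup>2 + (U v \<omega>)\<^sup>2"
        by (simp add: power2_diff)
      moreover have "0 \<le> \<bar>U u \<omega>\<bar> * \<bar>U v \<omega>\<bar>" by simp
      ultimately have "\<bar>U u \<omega>\<bar> * \<bar>U v \<omega>\<bar> \<le> (U u \<omega>)\<^sup>2 + (U v \<omega>)\<^sup>2"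
        by linarith
      then show "norm (U u \<omega> * U v \<omega>) \<le> norm ((U u \<omega>)\<^sup>2 + (U v \<omega>)\<^sup>2)"
        by (simp add: abs_mult)
    qed
  qed (use that in measurable)
  let ?Z = "\<lambda>\<omega>. \<Sum>u\<in>F. c u * U u \<omega>"
  have Z: "normal_rv P ?Z"
    by (rule lin[OF F])
  have "expectation ?Z = (\<Sum>u\<in>F. c u * expectation (U u))"
    using F i1 by (subst Bochner_Integration.integral_sum) auto
  also have "\<dots> = 0"
    using F mean by (intro sum.neutral) auto
  finally have E1: "expectation ?Z = 0" .
  have "expectation (\<lambda>\<omega>. (?Z \<omega>)\<^sup>2) = expectation (\<lambda>\<omega>. \<Sum>u\<in>F. \<Sum>v\<in>F. c u * c v * (U u \<omega> * U v \<omega>))"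
    by (simp add: power2_eq_square sum_product mult_ac)
  also have "\<dots> = (\<Sum>u\<in>F. \<Sum>v\<in>F. c u * c v * expectation (\<lambda>\<omega>. U u \<omega> * U v \<omega>))"
    using F i12 by (simp add: Bochner_Integration.integral_sum subset_iff)
  also have "\<dots> = qform F k c"
    using F cov unfolding qform_def by (intro sum.cong refl) (auto simp: subset_iff)
  finally have E2: "expectation (\<lambda>\<omega>. (?Z \<omega>)\<^sup>2) = qform F k c" .
  show ?thesis
    using normal_rv_char(3)[OF assms(1) Z] unfolding E1 E2 by simp
qed

text \<open>Completing the square.\<close>

lemma std_normal_tilt:
  assumes p: "p \<ge> 0"
  shows "std_normal_density x * exp (x * a - x\<^sup>2 * p / 2) =
     exp (a\<^sup>2 / (2 * (1 + p))) / sqrt (1 + p) * normal_density (a / (1 + p)) (1 / sqrt (1 + p)) x"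
proof -
  define q where "q = 1 + p"
  have q: "q > 0" using p by (simp add: q_def)
  have "- x\<^sup>2 / 2 + (x * a - x\<^sup>2 * p / 2) = a\<^sup>2 / (2 * q) + - (x - a / q)\<^sup>2 / (2 * (1 / sqrt q)\<^sup>2)"
    using q by (simp add: q_def[symmetric] power_divide power2_diff divide_simps) (simp add: q_def power2_eq_square algebra_simps)
  then have e: "exp (- x\<^sup>2 / 2) * exp (x * a - x\<^sup>2 * p / 2) =
      exp (a\<^sup>2 / (2 * q)) * exp (- (x - a / q)\<^sup>2 / (2 * (1 / sqrt q)\<^sup>2))"
    by (simp only: exp_add[symmetric])
  have "sqrt (2 * pi * (1 / sqrt q)\<^sup>2) = sqrt (2 * pi) / sqrt q"
    using q by (simp add: power_divide real_sqrt_divide)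
  then show ?thesis
    unfolding std_normal_density_def normal_density_def q_def[symmetric]
    using e q by (simp add: mult_ac)
qed

lemma std_normal_quadratic_char:
  assumes p: "p \<ge> 0"
  shows "(CLINT x|std_normal_distribution. iexp (x * b) * complex_of_real (exp (x * a - x\<^sup>2 * p / 2))) =
     complex_of_real (exp ((a\<^sup>2 - b\<^sup>2) / (2 * (1 + p))) / sqrt (1 + p)) * iexp (a * b / (1 + p))"
proof -
  define q where "q = 1 + p"
  have q: "q > 0" using p by (simp add: q_def)
  have "(CLINT x|std_normal_distribution. iexp (x * b) * complex_of_real (exp (x * a - x\<^sup>2 * p / 2)))
    = (CLINT x|lborel. std_normal_density x *\<^sub>R (iexp (x * b) * complex_of_real (exp (x * a - x\<^sup>2 * p / 2))))"
    by (rule integral_density) auto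
  also have "\<dots> = (CLINT x|lborel. complex_of_real (exp (a\<^sup>2 / (2 * q)) / sqrt q) *
       (normal_density (a / q) (1 / sqrt q) x *\<^sub>R iexp (b * x)))"
  proof (rule Bochner_Integration.integral_cong[OF refl])
    fix x
    show "std_normal_density x *\<^sub>R (iexp (x * b) * complex_of_real (exp (x * a - x\<^sup>2 * p / 2))) =
       complex_of_real (exp (a\<^sup>2 / (2 * q)) / sqrt q) * (normal_density (a / q) (1 / sqrt q) x *\<^sub>R iexp (b * x))"
    proof -
      have "std_normal_density x *\<^sub>R (iexp (x * b) * complex_of_real (exp (x * a - x\<^sup>2 * p / 2)))
         = iexp (x * b) * complex_of_real (std_normal_density x * exp (x * a - x\<^sup>2 * p / 2))"
        by (simp add: scaleR_conv_of_real)
      also have "\<dots> = iexp (x * b) * complex_of_real (exp (a\<^sup>2 / (2 * q)) / sqrt q * normal_density (a / q) (1 / sqrt q) x)"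
        unfolding std_normal_tilt[OF p] q_def ..
      finally show ?thesis
        by (simp add: scaleR_conv_of_real mult.commute)
    qed
  qed
  also have "\<dots> = complex_of_real (exp (a\<^sup>2 / (2 * q)) / sqrt q) *
      (CLINT x|density lborel (normal_density (a / q) (1 / sqrt q)). iexp (b * x))"
    unfolding integral_mult_right_zero by (subst integral_density) auto
  also have "\<dots> = complex_of_real (exp (a\<^sup>2 / (2 * q)) / sqrt q) *
      (iexp (b * (a / q)) * complex_of_real (exp (- (b * (1 / sqrt q))\<^sup>2 / 2)))"
    using q by (subst normal_density_char) auto
  also have "(b * (1 / sqrt q))\<^sup>2 = b\<^sup>2 / q"
    using q by (simp add: power_divide)
  also have "complex_of_real (exp (a\<^sup>2 / (2 * q)) / sqrt q) * (iexp (b * (a / q)) * complex_of_real (exp (- (b\<^sup>2 / q) / 2)))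
     = complex_of_real (exp (a\<^sup>2 / (2 * q)) * exp (- (b\<^sup>2 / q) / 2) / sqrt q) * iexp (a * b / q)"
    by (simp add: mult_ac)
  also have "exp (a\<^sup>2 / (2 * q)) * exp (- (b\<^sup>2 / q) / 2) = exp ((a\<^sup>2 - b\<^sup>2) / (2 * q))"
    using q by (simp add: diff_divide_distrib flip: exp_add)
  finally show ?thesis unfolding q_def .
qed

text \<open>The likelihood as a mixture of characters of the observed value: multiplying with it shifts the coefficients of
a linear combination of the process and averages over the shift.\<close>

lemma normal_density_fourier:
  assumes "s > 0"
  shows "complex_of_real (normal_density 0 s v) =
    complex_of_real (1 / sqrt (2 * pi * s\<^sup>2)) * (CLINT x|std_normal_distribution. iexp (x * (v / s)))"
proof -
  have 1: "(CLINT x|std_normal_distribution. iexp (x * (v / s))) = char std_normal_distribution (v / s)"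
    by (simp add: char_def mult.commute)
  show ?thesis
    unfolding 1 char_std_normal_distribution by (simp add: normal_density_def power_divide)
qed

lemma normal_density_le: "normal_density m s v \<le> 1 / sqrt (2 * pi * s\<^sup>2)"
  unfolding normal_density_def by (rule mult_left_le) (auto intro!: divide_nonneg_nonneg)

lemma sum_fun_upd_diff:
  fixes c h :: "'a \<Rightarrow> real"
  assumes "finite F" "w \<in> F"
  shows "(\<Sum>u\<in>F. (c(w := c w - t)) u * h u) = (\<Sum>u\<in>F. c u * h u) - t * h w"
proof -
  have "(\<Sum>u\<in>F. (c(w := c w - t)) u * h u) = (\<Sum>u\<in>F. c u * h u - (if u = w then t * h w else 0))"
    by (rule sum.cong) (auto simp: algebra_simps)
  then show ?thesis using assms by (simp add: sum_subtractf)
qed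

lemma qform_fun_upd_diff:
  assumes F: "finite F" "w \<in> F" and sym: "\<And>u v. k u v = k v u"
  shows "qform F k (c(w := c w - t)) = qform F k c - 2 * t * (\<Sum>u\<in>F. c u * k u w) + t\<^sup>2 * k w w"
proof -
  have *: "qform F k c = (\<Sum>u\<in>F. c u * (\<Sum>v\<in>F. c v * k u v))" for c
    unfolding qform_def by (simp add: sum_distrib_left mult_ac)
  have "qform F k (c(w := c w - t)) = (\<Sum>u\<in>F. (c(w := c w - t)) u * ((\<Sum>v\<in>F. c v * k u v) - t * k u w))"
    unfolding * using sum_fun_upd_diff[OF F] by simp
  also have "\<dots> = (\<Sum>u\<in>F. c u * ((\<Sum>v\<in>F. c v * k u v) - t * k u w)) - t * ((\<Sum>v\<in>F. c v * k w v) - t * k w w)"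
    by (rule sum_fun_upd_diff[OF F])
  also have "(\<Sum>v\<in>F. c v * k w v) = (\<Sum>v\<in>F. c v * k v w)"
    by (simp add: sym[of w])
  also have "(\<Sum>u\<in>F. c u * ((\<Sum>v\<in>F. c v * k u v) - t * k u w)) = qform F k c - t * (\<Sum>u\<in>F. c u * k u w)"
    unfolding * by (simp add: right_diff_distrib sum_subtractf sum_distrib_left mult_ac)
  finally show ?thesis
    by (rule trans) (simp add: power2_eq_square algebra_simps)
qed

lemma qform_condition:
  "qform F (cond_cov k s x (Suc n)) c = qform F (cond_cov k s x n) c -
     (\<Sum>u\<in>F. c u * cond_cov k s x n u (x (Suc n)))\<^sup>2 / (s\<^sup>2 + cond_cov k s x n (x (Suc n)) (x (Suc n)))"
  unfolding qform_def
  by (simp add: right_diff_distrib sum_subtractf power2_eq_square sum_product sum_divide_distrib mult_ac)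

lemma gaussian_process_measurable:
  assumes P: "prob_space P" and gp: "gaussian_process P D (\<lambda>x. 0) k U" and u: "u \<in> D"
  shows "U u \<in> borel_measurable P"
proof -
  have "normal_rv P (\<lambda>\<omega>. \<Sum>x\<in>F. c x * U x \<omega>)" if "finite F" "F \<subseteq> D" for F c
    using gp that by (simp add: gaussian_process_def)
  from this[of "{u}" "\<lambda>_. 1"] have "normal_rv P (U u)" using u by simp
  then show ?thesis using normal_rv_char(1)[OF P, of "U u"] by simp
qed

text \<open>Bayes' rule for Gaussian processes: under the likelihood of fixed data, linear combinations of the process have the
characteristic function of the posterior up to a constant that depends on the data only. In the induction
step the new likelihood factor is expanded into characters; for each of them the induction hypothesis applies to a shifted
linear combination, and the average over the shifts is a Gaussian integral. No density of the process is used, so the design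
may contain repeated points.\<close>

lemma gaussian_posterior_char:
  fixes U :: "'a \<Rightarrow> 'w \<Rightarrow> real"
  assumes P: "prob_space P" and gp: "gaussian_process P D (\<lambda>x. 0) k U"
    and pd: "psd_kernel k" and s: "s > 0"
    and F: "finite F" "F \<subseteq> D"
    and x: "\<And>i. i \<in> {1..n} \<Longrightarrow> x i \<in> F"
  shows "\<exists>C. \<forall>c. (CLINT \<omega>|P. iexp (\<Sum>u\<in>F. c u * U u \<omega>) *
              complex_of_real (\<Prod>i=1..n. normal_density 0 s (y i - U (x i) \<omega>))) =
           C * iexp (\<Sum>u\<in>F. c u * cond_mean k s x y n u) *
             complex_of_real (exp (- qform F (cond_cov k s x n) c / 2))"
  using x
proof (induction n)
  case 0
  show ?case
    using gaussian_process_char[OF P gp F] by (intro exI[of _ 1]) (simp add: qform_def)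
next
  case (Suc n)
  interpret prob_space P by (rule P)
  interpret S: prob_space std_normal_distribution by (rule prob_space_normal_density) simp
  interpret PS: pair_prob_space P std_normal_distribution ..
  have [measurable]: "U u \<in> borel_measurable P" if "u \<in> F" for u
    using gaussian_process_measurable[OF P gp] F(2) that by blast
  define w where "w = x (Suc n)"
  define v where "v = y (Suc n)"
  have w: "w \<in> F" using Suc.prems[of "Suc n"] by (simp add: w_def)
  have xF: "x i \<in> F" if "i \<in> {1..n}" for i using Suc.prems[of i] that by simp
  obtain C where C: "\<And>c. (CLINT \<omega>|P. iexp (\<Sum>u\<in>F. c u * U u \<omega>) *
              complex_of_real (\<Prod>i=1..n. normal_density 0 s (y i - U (x i) \<omega>))) =
           C * iexp (\<Sum>u\<in>F. c u * cond_mean k s x y n u) *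
             complex_of_real (exp (- qform F (cond_cov k s x n) c / 2))"
    using Suc.IH xF by blast
  define L where "L = (\<lambda>\<omega>. \<Prod>i=1..n. normal_density 0 s (y i - U (x i) \<omega>))"
  define \<kappa> where "\<kappa> = 1 / sqrt (2 * pi * s\<^sup>2)"
  define K where "K = cond_cov k s x n"
  define m where "m = cond_mean k s x y n"
  define p where "p = K w w / s\<^sup>2"
  define b where "b = (v - m w) / s"
  have p: "p \<ge> 0" unfolding p_def K_def using cond_cov_nonneg[OF pd s] by simp
  have K_sym: "K u v = K v u" for u v unfolding K_def by (rule cond_cov_sym[OF pd s])
  have L_meas [measurable]: "L \<in> borel_measurable P"
    unfolding L_def by (intro borel_measurable_prod) (use xF in measurable)
  have L_bound: "\<bar>L \<omega>\<bar> \<le> \<kappa> ^ n" for \<omega>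
  proof -
    have "\<bar>L \<omega>\<bar> = (\<Prod>i=1..n. normal_density 0 s (y i - U (x i) \<omega>))"
      unfolding L_def by (rule abs_of_nonneg) (intro prod_nonneg; simp)
    also have "\<dots> \<le> (\<Prod>i=1..n. \<kappa>)"
      unfolding \<kappa>_def by (intro prod_mono) (auto intro: normal_density_le)
    finally show ?thesis by simp
  qed
  define C' where "C' = complex_of_real \<kappa> * C * complex_of_real (exp (- b\<^sup>2 / (2 * (1 + p))) / sqrt (1 + p))"
  show ?case
  proof (intro exI[of _ C'] allI)
    fix c :: "'a \<Rightarrow> real"
    define Z where "Z = (\<lambda>\<omega>. \<Sum>u\<in>F. c u * U u \<omega>)"
    have [measurable]: "Z \<in> borel_measurable P" unfolding Z_def by measurable
    define B where "B = (\<Sum>u\<in>F. c u * K u w)"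
    define a where "a = B / s"
    define f where "f = (\<lambda>\<omega> t. iexp (Z \<omega>) * complex_of_real (L \<omega>) * iexp (t * ((v - U w \<omega>) / s)))"
    have Uw [measurable]: "U w \<in> borel_measurable P" using w by measurable
    have f_int: "integrable (P \<Otimes>\<^sub>M std_normal_distribution) (case_prod f)"
    proof (rule PS.P.integrable_const_bound[where B = "\<kappa> ^ n"])
      show "AE z in P \<Otimes>\<^sub>M std_normal_distribution. norm (case_prod f z) \<le> \<kappa> ^ n"
        using L_bound by (intro AE_I2) (auto simp: f_def norm_mult)
      show "case_prod f \<in> borel_measurable (P \<Otimes>\<^sub>M std_normal_distribution)"
        unfolding f_def by measurable
    qed
    have "(CLINT \<omega>|P. iexp (Z \<omega>) * complex_of_real (\<Prod>i=1..Suc n. normal_density 0 s (y i - U (x i) \<omega>)))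
      = (CLINT \<omega>|P. complex_of_real \<kappa> * (CLINT t|std_normal_distribution. f \<omega> t))"
    proof (rule Bochner_Integration.integral_cong[OF refl])
      fix \<omega>
      have "(\<Prod>i=1..Suc n. normal_density 0 s (y i - U (x i) \<omega>)) = L \<omega> * normal_density 0 s (v - U w \<omega>)"
        by (simp add: L_def v_def w_def)
      then show "iexp (Z \<omega>) * complex_of_real (\<Prod>i=1..Suc n. normal_density 0 s (y i - U (x i) \<omega>)) =
          complex_of_real \<kappa> * (CLINT t|std_normal_distribution. f \<omega> t)"
        unfolding f_def \<kappa>_def
        by (simp only: of_real_mult normal_density_fourier[OF s, of "v - U w \<omega>"]) simp
    qed
    also have "\<dots> = complex_of_real \<kappa> * (CLINT \<omega>|P. CLINT t|std_normal_distribution. f \<omega> t)"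
      by simp
    also have "(CLINT \<omega>|P. CLINT t|std_normal_distribution. f \<omega> t) =
       (CLINT t|std_normal_distribution. CLINT \<omega>|P. f \<omega> t)"
      by (rule PS.Fubini_integral[OF f_int, symmetric])
    also have "\<dots> = (CLINT t|std_normal_distribution.
        C * iexp (\<Sum>u\<in>F. c u * m u) * complex_of_real (exp (- qform F K c / 2)) *
          (iexp (t * b) * complex_of_real (exp (t * a - t\<^sup>2 * p / 2))))"
    proof (rule Bochner_Integration.integral_cong[OF refl])
      fix t
      define c' where "c' = c(w := c w - t / s)"
      have upd: "(\<Sum>u\<in>F. c' u * h u) = (\<Sum>u\<in>F. c u * h u) - t / s * h w" for h
        unfolding c'_def by (rule sum_fun_upd_diff[OF F(1) w])
      have upd2: "qform F K c' = qform F K c - 2 * (t / s) * (\<Sum>u\<in>F. c u * K u w) + (t / s)\<^sup>2 * K w w"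
        unfolding c'_def by (rule qform_fun_upd_diff[OF F(1) w K_sym])
      have "(CLINT \<omega>|P. f \<omega> t) =
        (CLINT \<omega>|P. iexp (t * v / s) * (iexp (\<Sum>u\<in>F. c' u * U u \<omega>) * complex_of_real (L \<omega>)))"
      proof (rule Bochner_Integration.integral_cong[OF refl])
        fix \<omega>
        have "Z \<omega> + t * ((v - U w \<omega>) / s) = t * v / s + (\<Sum>u\<in>F. c' u * U u \<omega>)"
          unfolding upd Z_def using s by (simp add: field_simps)
        then have "iexp (Z \<omega>) * iexp (t * ((v - U w \<omega>) / s)) = iexp (t * v / s) * iexp (\<Sum>u\<in>F. c' u * U u \<omega>)"
          by (simp only: exp_add[symmetric] distrib_left[symmetric] of_real_add[symmetric])
        then show "f \<omega> t = iexp (t * v / s) * (iexp (\<Sum>u\<in>F. c' u * U u \<omega>) * complex_of_real (L \<omega>))"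
          unfolding f_def by (simp only: mult_ac)
      qed
      also have "\<dots> = iexp (t * v / s) * (C * iexp (\<Sum>u\<in>F. c' u * m u) * complex_of_real (exp (- qform F K c' / 2)))"
        unfolding L_def C m_def K_def integral_mult_right_zero ..
      also have "\<dots> = C * (iexp (t * v / s) * iexp (\<Sum>u\<in>F. c' u * m u)) * complex_of_real (exp (- qform F K c' / 2))"
        by (simp only: mult_ac)
      also have "iexp (t * v / s) * iexp (\<Sum>u\<in>F. c' u * m u) = iexp (\<Sum>u\<in>F. c u * m u) * iexp (t * b)"
      proof -
        have "t * v / s + (\<Sum>u\<in>F. c' u * m u) = (\<Sum>u\<in>F. c u * m u) + t * b"
          unfolding upd b_def using s by (simp add: field_simps)
        then show ?thesis
          by (simp only: exp_add[symmetric] distrib_left[symmetric] of_real_add[symmetric])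
      qed
      also have "exp (- qform F K c' / 2) = exp (- qform F K c / 2) * exp (t * a - t\<^sup>2 * p / 2)"
      proof -
        have "- qform F K c' / 2 = - qform F K c / 2 + (t * a - t\<^sup>2 * p / 2)"
          unfolding upd2 a_def p_def B_def
          using s by (simp add: field_simps power2_eq_square)
        then show ?thesis by (simp only: exp_add)
      qed
      finally show "(CLINT \<omega>|P. f \<omega> t) = C * iexp (\<Sum>u\<in>F. c u * m u) * complex_of_real (exp (- qform F K c / 2)) *
          (iexp (t * b) * complex_of_real (exp (t * a - t\<^sup>2 * p / 2)))"
        by (simp only: of_real_mult mult_ac)
    qed
    also have "\<dots> = C * iexp (\<Sum>u\<in>F. c u * m u) * complex_of_real (exp (- qform F K c / 2)) *
        (complex_of_real (exp ((a\<^sup>2 - b\<^sup>2) / (2 * (1 + p))) / sqrt (1 + p)) * iexp (a * b / (1 + p)))"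
      unfolding integral_mult_right_zero std_normal_quadratic_char[OF p] ..
    also have "complex_of_real \<kappa> * \<dots> = C' * (iexp (\<Sum>u\<in>F. c u * m u) * iexp (a * b / (1 + p))) *
        complex_of_real (exp (- qform F K c / 2) * exp (a\<^sup>2 / (2 * (1 + p))))"
    proof -
      have "exp ((a\<^sup>2 - b\<^sup>2) / (2 * (1 + p))) / sqrt (1 + p) =
          (exp (- b\<^sup>2 / (2 * (1 + p))) / sqrt (1 + p)) * exp (a\<^sup>2 / (2 * (1 + p)))"
        by (simp add: diff_divide_distrib flip: exp_add)
      then show ?thesis unfolding C'_def by (simp only: of_real_mult mult_ac)
    qed
    also have "iexp (\<Sum>u\<in>F. c u * m u) * iexp (a * b / (1 + p)) =
        iexp (\<Sum>u\<in>F. c u * cond_mean k s x y (Suc n) u)"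
    proof -
      have "(\<Sum>u\<in>F. c u * cond_mean k s x y (Suc n) u) =
          (\<Sum>u\<in>F. c u * m u) + B * (v - m w) / (s\<^sup>2 + K w w)"
        by (simp add: m_def K_def B_def v_def w_def distrib_left sum.distrib sum_distrib_right sum_divide_distrib mult.assoc)
      also have "B * (v - m w) / (s\<^sup>2 + K w w) = a * b / (1 + p)"
      proof -
        have "s\<^sup>2 + K w w = s\<^sup>2 * (1 + p)" using s by (simp add: p_def field_simps)
        then show ?thesis using s by (simp add: a_def b_def power2_eq_square)
      qed
      finally show ?thesis by (simp only: exp_add[symmetric] distrib_left[symmetric] of_real_add[symmetric])
    qed
    also have "exp (- qform F K c / 2) * exp (a\<^sup>2 / (2 * (1 + p))) = exp (- qform F (cond_cov k s x (Suc n)) c / 2)"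
    proof -
      have "s\<^sup>2 + K w w = s\<^sup>2 * (1 + p)" using s by (simp add: p_def field_simps)
      then have "B\<^sup>2 / (s\<^sup>2 + K w w) = a\<^sup>2 / (1 + p)" using s by (simp add: a_def power_divide)
      then have "qform F (cond_cov k s x (Suc n)) c = qform F K c - a\<^sup>2 / (1 + p)"
        unfolding qform_condition by (simp add: K_def[symmetric] w_def[symmetric] B_def)
      then have "- qform F K c / 2 + a\<^sup>2 / (2 * (1 + p)) = - qform F (cond_cov k s x (Suc n)) c / 2"
        by (simp add: diff_divide_distrib)
      then show ?thesis by (simp only: exp_add[symmetric])
    qed
    finally show "(CLINT \<omega>|P. iexp (\<Sum>u\<in>F. c u * U u \<omega>) *
              complex_of_real (\<Prod>i=1..Suc n. normal_density 0 s (y i - U (x i) \<omega>))) =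
           C' * iexp (\<Sum>u\<in>F. c u * cond_mean k s x y (Suc n) u) *
             complex_of_real (exp (- qform F (cond_cov k s x (Suc n)) c / 2))"
      unfolding Z_def .
  qed
qed

text \<open>On the event, the density is dominated by \<open>exp (- c\<^sup>2 / 2)\<close> times the normal density shifted to the edge of the event. The sign
\<open>e\<close> selects the side.\<close>

lemma std_normal_one_sided_tail:
  assumes c: "c \<ge> 0" and e: "e * e = (1::real)"
  shows "emeasure std_normal_distribution {x. e * x > c} \<le> ennreal (exp (- c\<^sup>2 / 2))"
proof -
  have "emeasure std_normal_distribution {x. e * x > c} =
      (\<integral>\<^sup>+x. ennreal (std_normal_density x) * indicator {x. e * x > c} x \<partial>lborel)"
    by (rule emeasure_density) auto
  also have "\<dots> \<le> (\<integral>\<^sup>+x. ennreal (exp (- c\<^sup>2 / 2)) * ennreal (normal_density (e * c) 1 x) \<partial>lborel)"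
  proof (rule nn_integral_mono)
    fix x
    have "std_normal_density x \<le> exp (- c\<^sup>2 / 2) * normal_density (e * c) 1 x" if "e * x > c"
    proof -
      have "c * c \<le> c * (e * x)" using c that by (intro mult_left_mono) auto
      then have "c\<^sup>2 \<le> x * (e * c)" by (simp add: power2_eq_square mult_ac)
      then have "std_normal_density x * 1 \<le> std_normal_density x * (exp (- c\<^sup>2) * exp (x * (e * c) - x\<^sup>2 * 0 / 2))"
        by (intro mult_left_mono) (simp_all flip: exp_add)
      also have "\<dots> = exp (- c\<^sup>2) * (std_normal_density x * exp (x * (e * c) - x\<^sup>2 * 0 / 2))"
        by (simp only: mult_ac)
      also have "\<dots> = exp (- c\<^sup>2) * exp ((e * c)\<^sup>2 / 2) * normal_density (e * c) 1 x"
        by (subst std_normal_tilt) (simp_all add: mult_ac)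
      also have "exp (- c\<^sup>2) * exp ((e * c)\<^sup>2 / 2) = exp (- c\<^sup>2 / 2)"
        using e by (simp add: power_mult_distrib power2_eq_square[of e] flip: exp_add)
      finally show ?thesis by simp
    qed
    then show "ennreal (std_normal_density x) * indicator {x. e * x > c} x \<le>
        ennreal (exp (- c\<^sup>2 / 2)) * ennreal (normal_density (e * c) 1 x)"
      by (auto simp: indicator_def ennreal_mult[symmetric])
  qed
  also have "\<dots> = ennreal (exp (- c\<^sup>2 / 2)) * (\<integral>\<^sup>+x. ennreal (normal_density (e * c) 1 x) \<partial>lborel)"
    by (rule nn_integral_cmult) auto
  also have "(\<integral>\<^sup>+x. ennreal (normal_density (e * c) 1 x) \<partial>lborel) = 1"
    by (subst nn_integral_eq_integral) auto
  finally show ?thesis by simp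
qed

lemma std_normal_tail:
  assumes c: "c \<ge> 0"
  shows "emeasure std_normal_distribution {x. \<bar>x\<bar> > c} \<le> ennreal (2 * exp (- c\<^sup>2 / 2))"
proof -
  have "{x. \<bar>x\<bar> > c} = {x. 1 * x > c} \<union> {x. -1 * x > c}" by auto
  then have "emeasure std_normal_distribution {x. \<bar>x\<bar> > c} \<le>
      emeasure std_normal_distribution {x. 1 * x > c} + emeasure std_normal_distribution {x. -1 * x > c}"
    by (simp only:) (rule emeasure_subadditive; simp)
  also have "\<dots> \<le> ennreal (exp (- c\<^sup>2 / 2)) + ennreal (exp (- c\<^sup>2 / 2))"
    by (intro add_mono std_normal_one_sided_tail c) auto
  also have "\<dots> = ennreal (2 * exp (- c\<^sup>2 / 2))" by (simp flip: ennreal_plus)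
  finally show ?thesis .
qed

text \<open>Normalising the likelihood gives a probability measure under which the standardised posterior error has the characteristic
function of the standard normal law, so it has that law.\<close>

lemma gaussian_posterior_tail:
  fixes U :: "'a \<Rightarrow> 'w \<Rightarrow> real" and y :: "nat \<Rightarrow> real"
  assumes P: "prob_space P" and gp: "gaussian_process P D (\<lambda>x. 0) k U"
    and pd: "psd_kernel k" and k_pos: "\<And>u. k u u > 0" and s: "s > 0"
    and z: "z \<in> D" and x: "\<And>i. i \<in> {1..n} \<Longrightarrow> x i \<in> D" and c: "c \<ge> 0"
  defines "L \<equiv> \<lambda>\<omega>. \<Prod>i=1..n. normal_density 0 s (y i - U (x i) \<omega>)"
  shows "(\<integral>\<^sup>+\<omega>. indicator {\<omega>. \<bar>U z \<omega> - cond_mean k s x y n z\<bar> > c * sqrt (cond_cov k s x n z z)} \<omega> * ennreal (L \<omega>) \<partial>P)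
     \<le> ennreal (2 * exp (- c\<^sup>2 / 2)) * (\<integral>\<^sup>+\<omega>. ennreal (L \<omega>) \<partial>P)"
proof -
  interpret prob_space P by (rule P)
  have U_meas: "U u \<in> borel_measurable P" if "u \<in> D" for u
    by (rule gaussian_process_measurable[OF P gp that])
  note [measurable] = U_meas[OF z]
  define \<mu> where "\<mu> = cond_mean k s x y n z"
  define sd where "sd = sqrt (cond_cov k s x n z z)"
  have sd: "sd > 0" unfolding sd_def using cond_cov_pos[OF pd s k_pos] by simp
  have [measurable]: "L \<in> borel_measurable P"
    unfolding L_def by (intro borel_measurable_prod) (use U_meas[OF x] in measurable)
  have L_pos: "L \<omega> > 0" for \<omega>
    unfolding L_def by (intro prod_pos ballI normal_density_pos s)
  have L_bound: "L \<omega> \<le> (1 / sqrt (2 * pi * s\<^sup>2)) ^ n" for \<omega>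
  proof -
    have "L \<omega> \<le> (\<Prod>i=1..n. 1 / sqrt (2 * pi * s\<^sup>2))"
      unfolding L_def by (intro prod_mono) (auto intro: normal_density_le)
    then show ?thesis by simp
  qed
  have L_int: "integrable P L"
    using L_pos L_bound by (intro integrable_const_bound[of _ "(1 / sqrt (2 * pi * s\<^sup>2)) ^ n"]) (auto simp: less_imp_le)
  define CL where "CL = expectation L"
  have "CL \<noteq> 0"
  proof
    assume "CL = 0"
    then have "AE \<omega> in P. L \<omega> = 0"
      using integral_nonneg_eq_0_iff_AE[OF L_int] L_pos by (simp add: CL_def less_imp_le)
    then have "AE \<omega> in P. False" using L_pos by (auto simp: less_le)
    then show False by simp
  qed
  moreover have "CL \<ge> 0" unfolding CL_def using L_pos by (intro Bochner_Integration.integral_nonneg) (auto simp: less_imp_le)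
  ultimately have CL: "CL > 0" by simp
  have nn_L: "(\<integral>\<^sup>+\<omega>. ennreal (L \<omega>) \<partial>P) = ennreal CL"
    unfolding CL_def using L_pos by (intro nn_integral_eq_integral L_int) (auto simp: less_imp_le)
  define Q where "Q = density P (\<lambda>\<omega>. ennreal (L \<omega> / CL))"
  have Q_prob: "prob_space Q"
  proof (rule prob_spaceI)
    have "emeasure Q (space Q) = (\<integral>\<^sup>+\<omega>. ennreal (L \<omega> / CL) \<partial>P)"
      unfolding Q_def by (simp add: emeasure_density)
    also have "\<dots> = (\<integral>\<^sup>+\<omega>. ennreal (1 / CL) * ennreal (L \<omega>) \<partial>P)"
      using CL L_pos by (intro nn_integral_cong) (simp add: ennreal_mult[symmetric] less_imp_le)
    also have "\<dots> = ennreal (1 / CL) * ennreal CL" by (simp add: nn_integral_cmult nn_L)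
    also have "\<dots> = 1" using CL by (simp add: ennreal_mult[symmetric])
    finally show "emeasure Q (space Q) = 1" .
  qed
  define W where "W = (\<lambda>\<omega>. (U z \<omega> - \<mu>) / sd)"
  have [measurable]: "W \<in> borel_measurable P" unfolding W_def by measurable
  have W_Q: "W \<in> borel_measurable Q" unfolding Q_def by simp
  have "char (distr Q borel W) = char std_normal_distribution"
  proof
    fix t
    define F where "F = insert z (x ` {1..n})"
    have F: "finite F" "F \<subseteq> D" "z \<in> F" using z x by (auto simp: F_def)
    obtain C where C: "\<And>c. (CLINT \<omega>|P. iexp (\<Sum>u\<in>F. c u * U u \<omega>) * complex_of_real (L \<omega>)) =
           C * iexp (\<Sum>u\<in>F. c u * cond_mean k s x y n u) *
             complex_of_real (exp (- qform F (cond_cov k s x n) c / 2))"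
      using gaussian_posterior_char[OF P gp pd s F(1,2), of n x y] unfolding L_def by (auto simp: F_def)
    have C_eq: "C = complex_of_real CL"
      using C[of "\<lambda>_. 0"] by (simp add: qform_def CL_def)
    have delta: "(\<Sum>u\<in>F. (if u = z then t / sd else 0) * h u) = t / sd * h z" for h :: "'a \<Rightarrow> real"
      using F by (simp add: if_distrib[of "\<lambda>c. c * _"] cong: if_cong)
    have q: "qform F (cond_cov k s x n) (\<lambda>u. if u = z then t / sd else 0) = t\<^sup>2"
    proof -
      have "qform F (cond_cov k s x n) (\<lambda>u. if u = z then t / sd else 0) =
         (\<Sum>u\<in>F. (if u = z then t / sd else 0) * (\<Sum>v\<in>F. (if v = z then t / sd else 0) * cond_cov k s x n u v))"
        unfolding qform_def by (simp add: sum_distrib_left mult.assoc)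
      also have "\<dots> = t / sd * (t / sd * cond_cov k s x n z z)" unfolding delta ..
      also have "\<dots> = t\<^sup>2"
        using sd by (simp add: sd_def power2_eq_square)
      finally show ?thesis .
    qed
    have "char (distr Q borel W) t = (CLINT \<omega>|Q. iexp (t * W \<omega>))"
      unfolding char_def using W_Q by (subst integral_distr) auto
    also have "\<dots> = (CLINT \<omega>|P. (L \<omega> / CL) *\<^sub>R iexp (t * W \<omega>))"
      unfolding Q_def using CL L_pos by (subst integral_density) (auto simp: less_imp_le)
    also have "\<dots> = (CLINT \<omega>|P. (iexp (- (t / sd * \<mu>)) / complex_of_real CL) * (iexp (t / sd * U z \<omega>) * complex_of_real (L \<omega>)))"
    proof (rule Bochner_Integration.integral_cong[OF refl])
      fix \<omega>
      have "t * W \<omega> = - (t / sd * \<mu>) + t / sd * U z \<omega>"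
        using sd by (simp add: W_def field_simps)
      then have "iexp (t * W \<omega>) = iexp (- (t / sd * \<mu>)) * iexp (t / sd * U z \<omega>)"
        by (simp only: exp_add[symmetric] distrib_left[symmetric] of_real_add[symmetric])
      then show "(L \<omega> / CL) *\<^sub>R iexp (t * W \<omega>) =
          (iexp (- (t / sd * \<mu>)) / complex_of_real CL) * (iexp (t / sd * U z \<omega>) * complex_of_real (L \<omega>))"
        by (simp only: scaleR_conv_of_real of_real_divide) simp
    qed
    also have "\<dots> = (iexp (- (t / sd * \<mu>)) / complex_of_real CL) *
        (CLINT \<omega>|P. iexp (t / sd * U z \<omega>) * complex_of_real (L \<omega>))"
      by (rule integral_mult_right_zero)
    also have "(CLINT \<omega>|P. iexp (t / sd * U z \<omega>) * complex_of_real (L \<omega>)) =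
        complex_of_real CL * iexp (t / sd * \<mu>) * complex_of_real (exp (- t\<^sup>2 / 2))"
      using C[of "\<lambda>u. if u = z then t / sd else 0"] unfolding delta q C_eq \<mu>_def .
    also have "(iexp (- (t / sd * \<mu>)) / complex_of_real CL) * (complex_of_real CL * iexp (t / sd * \<mu>) * complex_of_real (exp (- t\<^sup>2 / 2)))
        = iexp (- (t / sd * \<mu>)) * iexp (t / sd * \<mu>) * complex_of_real (exp (- t\<^sup>2 / 2))"
      using CL by simp
    also have "iexp (- (t / sd * \<mu>)) * iexp (t / sd * \<mu>) = 1"
      by (simp only: exp_add[symmetric] distrib_left[symmetric] of_real_add[symmetric]) simp
    finally show "char (distr Q borel W) t = char std_normal_distribution t"
      by (simp add: char_std_normal_distribution)
  qed
  then have distr_W: "distr Q borel W = std_normal_distribution"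
    by (intro Levy_uniqueness prob_space.real_distribution_distr[OF Q_prob] W_Q real_dist_normal_dist)
  let ?A = "{\<omega>\<in>space P. \<bar>W \<omega>\<bar> > c}"
  have "emeasure Q ?A = emeasure (distr Q borel W) {x. \<bar>x\<bar> > c}"
    using W_Q by (subst emeasure_distr) (auto simp: Q_def intro!: arg_cong[where f = "emeasure _"])
  also have "\<dots> \<le> ennreal (2 * exp (- c\<^sup>2 / 2))"
    unfolding distr_W by (rule std_normal_tail[OF c])
  finally have QA: "emeasure Q ?A \<le> ennreal (2 * exp (- c\<^sup>2 / 2))" .
  have "(\<integral>\<^sup>+\<omega>. indicator {\<omega>. \<bar>U z \<omega> - \<mu>\<bar> > c * sd} \<omega> * ennreal (L \<omega>) \<partial>P)
     = (\<integral>\<^sup>+\<omega>. ennreal CL * (ennreal (L \<omega> / CL) * indicator ?A \<omega>) \<partial>P)"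
  proof (rule nn_integral_cong)
    fix \<omega> assume "\<omega> \<in> space P"
    moreover have "\<bar>W \<omega>\<bar> > c \<longleftrightarrow> \<bar>U z \<omega> - \<mu>\<bar> > c * sd"
      using sd by (simp add: W_def field_simps)
    moreover have "ennreal CL * ennreal (L \<omega> / CL) = ennreal (L \<omega>)"
      using CL L_pos[of \<omega>] by (simp add: ennreal_mult[symmetric] less_imp_le)
    ultimately show "indicator {\<omega>. \<bar>U z \<omega> - \<mu>\<bar> > c * sd} \<omega> * ennreal (L \<omega>) =
        ennreal CL * (ennreal (L \<omega> / CL) * indicator ?A \<omega>)"
      by (auto simp: indicator_def)
  qed
  also have "\<dots> = ennreal CL * emeasure Q ?A"
    unfolding Q_def by (simp add: nn_integral_cmult emeasure_density)
  also have "\<dots> \<le> ennreal CL * ennreal (2 * exp (- c\<^sup>2 / 2))"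
    by (intro mult_left_mono QA) auto
  finally show ?thesis
    unfolding nn_L \<mu>_def sd_def by (simp add: mult.commute)
qed

section \<open>Adaptively chosen queries\<close>

text \<open>Evaluation of a path at a random point is the limit of evaluations at nearby points of a countable dense set, and for
countably many points measurability is clear.\<close>

lemma measurable_path_evaluation:
  fixes U :: "'a::{second_countable_topology, metric_space} \<Rightarrow> 'w \<Rightarrow> real"
  assumes U: "\<And>u. u \<in> D \<Longrightarrow> U u \<in> borel_measurable M"
    and cont: "\<And>\<omega>. \<omega> \<in> space M \<Longrightarrow> continuous_on D (\<lambda>u. U u \<omega>)"
    and g [measurable]: "g \<in> borel_measurable N" and gD: "\<And>v. v \<in> space N \<Longrightarrow> g v \<in> D"
    and w [measurable]: "w \<in> measurable N M"
  shows "(\<lambda>v. U (g v) (w v)) \<in> borel_measurable N"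
proof (cases "D = {}")
  case True
  then have "space N = {}" using gD by blast
  then show ?thesis by (simp add: measurable_def)
next
  case False
  obtain T where T: "countable T" "T \<subseteq> D" "D \<subseteq> closure T" by (rule separable)
  with False have "T \<noteq> {}" by auto
  define f where "f = from_nat_into T"
  have f: "range f = T" using T \<open>T \<noteq> {}\<close> by (simp add: f_def range_from_nat_into)
  have fD: "f i \<in> D" for i using f T by blast
  define sel where "sel = (\<lambda>m v. LEAST i. dist (g v) (f i) < 1 / real (Suc m))"
  have sel: "dist (g v) (f (sel m v)) < 1 / real (Suc m)" if "v \<in> space N" for m v
  proof -
    have "g v \<in> closure T" using gD[OF that] T by blast
    then obtain u where "u \<in> T" "dist u (g v) < 1 / real (Suc m)"
      using closure_approachable[of "g v" T] by (metis of_nat_0_less_iff zero_less_Suc zero_less_divide_1_iff)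
    moreover obtain i where "f i = u" using \<open>u \<in> T\<close> f by (metis imageE)
    ultimately have "dist (g v) (f i) < 1 / real (Suc m)" by (simp add: dist_commute)
    then show ?thesis unfolding sel_def by (rule LeastI)
  qed
  have [measurable]: "sel m \<in> measurable N (count_space UNIV)" for m
    unfolding sel_def by measurable
  have meas: "(\<lambda>v. U (f (sel m v)) (w v)) \<in> borel_measurable N" for m
  proof (rule measurable_compose_countable)
    show "(\<lambda>v. U (f i) (w v)) \<in> borel_measurable N" for i
      using measurable_compose[OF w U[OF fD]] .
  qed simp
  show ?thesis
  proof (rule borel_measurable_LIMSEQ_real[OF _ meas])
    fix v assume v: "v \<in> space N"
    have "(\<lambda>m. f (sel m v)) \<longlonglongrightarrow> g v"
    proof (rule tendstoI)
      fix e :: real assume "e > 0"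
      then have "eventually (\<lambda>m. inverse (real (Suc m)) < e) sequentially"
        using LIMSEQ_inverse_real_of_nat by (rule order_tendstoD(2)[rotated])
      then show "eventually (\<lambda>m. dist (f (sel m v)) (g v) < e) sequentially"
      proof eventually_elim
        case (elim m)
        then show ?case using sel[OF v, of m] by (simp add: dist_commute inverse_eq_divide)
      qed
    qed
    then show "(\<lambda>m. U (f (sel m v)) (w v)) \<longlonglongrightarrow> U (g v) (w v)"
      using cont[OF measurable_space[OF w v]] fD gD[OF v]
      by (auto simp: continuous_on_sequentially comp_def)
  qed
qed

lemma cond_cov_measurable:
  fixes k :: "'a::topological_space \<Rightarrow> 'a \<Rightarrow> real"
  assumes k [measurable]: "(\<lambda>p. k (fst p) (snd p)) \<in> borel_measurable (borel \<Otimes>\<^sub>M borel)"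
    and x: "\<And>i. i \<in> {1..n} \<Longrightarrow> x i \<in> borel_measurable M"
    and "u \<in> borel_measurable M" "v \<in> borel_measurable M"
  shows "(\<lambda>\<omega>. cond_cov k s (\<lambda>i. x i \<omega>) n (u \<omega>) (v \<omega>)) \<in> borel_measurable M"
  using assms(2-)
proof (induction n arbitrary: u v)
  case 0
  have "(\<lambda>\<omega>. (u \<omega>, v \<omega>)) \<in> measurable M (borel \<Otimes>\<^sub>M borel)" using 0 by measurable
  from measurable_compose[OF this k] show ?case by simp
next
  case (Suc n)
  have z: "x (Suc n) \<in> borel_measurable M" using Suc.prems(1)[of "Suc n"] by simp
  have IH: "(\<lambda>\<omega>. cond_cov k s (\<lambda>i. x i \<omega>) n (u \<omega>) (v \<omega>)) \<in> borel_measurable M"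
    if "u \<in> borel_measurable M" "v \<in> borel_measurable M" for u v
    using Suc.IH[OF _ that] Suc.prems(1) by simp
  note [measurable] = IH[OF Suc.prems(2,3)] IH[OF Suc.prems(2) z] IH[OF Suc.prems(3) z] IH[OF z z]
  show ?case unfolding cond_cov.simps by measurable
qed

lemma cond_mean_measurable:
  fixes k :: "'a::topological_space \<Rightarrow> 'a \<Rightarrow> real"
  assumes k: "(\<lambda>p. k (fst p) (snd p)) \<in> borel_measurable (borel \<Otimes>\<^sub>M borel)"
    and x: "\<And>i. i \<in> {1..n} \<Longrightarrow> x i \<in> borel_measurable M"
    and y: "\<And>i. i \<in> {1..n} \<Longrightarrow> y i \<in> borel_measurable M"
    and u: "u \<in> borel_measurable M"
  shows "(\<lambda>\<omega>. cond_mean k s (\<lambda>i. x i \<omega>) (\<lambda>i. y i \<omega>) n (u \<omega>)) \<in> borel_measurable M"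
  using assms(2-)
proof (induction n arbitrary: u)
  case 0
  show ?case by simp
next
  case (Suc n)
  have z: "x (Suc n) \<in> borel_measurable M" and [measurable]: "y (Suc n) \<in> borel_measurable M"
    using Suc.prems(1,2)[of "Suc n"] by simp_all
  have x': "\<And>i. i \<in> {1..n} \<Longrightarrow> x i \<in> borel_measurable M" using Suc.prems by simp
  have IH: "(\<lambda>\<omega>. cond_mean k s (\<lambda>i. x i \<omega>) (\<lambda>i. y i \<omega>) n (u \<omega>)) \<in> borel_measurable M"
    if "u \<in> borel_measurable M" for u
    using Suc.IH[OF _ _ that] Suc.prems(1,2) by simp
  note [measurable] = IH[OF Suc.prems(3)] IH[OF z] cond_cov_measurable[OF k x' Suc.prems(3) z] cond_cov_measurable[OF k x' z z]
  show ?case unfolding cond_mean.simps by measurable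
qed

lemma cond_cov_cong:
  "(\<And>i. i \<in> {1..n} \<Longrightarrow> x i = x' i) \<Longrightarrow> cond_cov k s x n u v = cond_cov k s x' n u v"
proof (induction n arbitrary: u v)
  case (Suc n)
  have "cond_cov k s x n u v = cond_cov k s x' n u v" for u v
    by (rule Suc.IH) (simp add: Suc.prems)
  then show ?case using Suc.prems[of "Suc n"] by simp
qed simp

lemma cond_mean_cong:
  "(\<And>i. i \<in> {1..n} \<Longrightarrow> x i = x' i) \<Longrightarrow> (\<And>i. i \<in> {1..n} \<Longrightarrow> y i = y' i) \<Longrightarrow>
    cond_mean k s x y n u = cond_mean k s x' y' n u"
proof (induction n arbitrary: u)
  case (Suc n)
  have "cond_mean k s x y n u = cond_mean k s x' y' n u" for u
    by (rule Suc.IH) (simp_all add: Suc.prems)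
  moreover have "cond_cov k s x n u v = cond_cov k s x' n u v" for u v
    by (rule cond_cov_cong) (simp add: Suc.prems)
  ultimately show ?case using Suc.prems[of "Suc n"] by simp
qed simp

text \<open>The first \<open>n\<close> observations, as a function of the noise \<open>e\<close>, when the noise-free value of observation \<open>i\<close> is the function \<open>h i\<close>
of the earlier observations. The base case is the unique element of the empty product space.\<close>

fun noisy_path :: "(nat \<Rightarrow> (nat \<Rightarrow> real) \<Rightarrow> real) \<Rightarrow> nat \<Rightarrow> (nat \<Rightarrow> real) \<Rightarrow> nat \<Rightarrow> real" where
  "noisy_path h 0 e = (\<lambda>_. undefined)"
| "noisy_path h (Suc n) e = (noisy_path h n e)(Suc n := h (Suc n) (noisy_path h n e) + e (Suc n))"

lemma noisy_path_cong:
  "(\<And>i. i \<in> {1..n} \<Longrightarrow> e i = e' i) \<Longrightarrow> noisy_path h n e = noisy_path h n e'"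
proof (induction n)
  case (Suc n)
  have "noisy_path h n e = noisy_path h n e'" by (rule Suc.IH) (simp add: Suc.prems)
  then show ?case using Suc.prems[of "Suc n"] by simp
qed simp

lemma measurable_noisy_path:
  assumes h: "\<And>i. i \<in> {1..n} \<Longrightarrow> (\<lambda>p. h (fst p) i (snd p)) \<in> borel_measurable (MU \<Otimes>\<^sub>M PiM {1..<i} (\<lambda>_. borel))"
    and w: "w \<in> measurable N MU"
    and e: "\<And>i. i \<in> {1..n} \<Longrightarrow> (\<lambda>v. e v i) \<in> borel_measurable N"
  shows "(\<lambda>v. noisy_path (h (w v)) n (e v)) \<in> measurable N (PiM {1..n} (\<lambda>_. borel))"
  using assms(1,3)
proof (induction n)
  case 0
  show ?case by (simp add: space_PiM_empty)
next
  case (Suc n)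
  have IH: "(\<lambda>v. noisy_path (h (w v)) n (e v)) \<in> measurable N (PiM {1..n} (\<lambda>_. borel))"
    by (rule Suc.IH) (use Suc.prems in \<open>auto simp del: One_nat_def\<close>)
  have "(\<lambda>v. (w v, noisy_path (h (w v)) n (e v))) \<in> measurable N (MU \<Otimes>\<^sub>M PiM {1..<Suc n} (\<lambda>_. borel))"
    using w IH by (intro measurable_Pair) (simp_all add: atLeastLessThanSuc_atLeastAtMost)
  from measurable_compose[OF this Suc.prems(1)[of "Suc n"]]
  have "(\<lambda>v. h (w v) (Suc n) (noisy_path (h (w v)) n (e v))) \<in> borel_measurable N" by simp
  moreover have "(\<lambda>v. e v (Suc n)) \<in> borel_measurable N" using Suc.prems(2)[of "Suc n"] by simp
  ultimately have "(\<lambda>v. h (w v) (Suc n) (noisy_path (h (w v)) n (e v)) + e v (Suc n)) \<in> borel_measurable N"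
    by measurable
  then show ?case
    unfolding noisy_path.simps
    by (intro measurable_fun_upd[OF _ IH]) auto
qed

abbreviation gauss_measure :: "real \<Rightarrow> real measure" where
  "gauss_measure s \<equiv> density lborel (normal_density 0 s)"

lemma sets_PiM_gauss: "sets (PiM I (\<lambda>_. gauss_measure s)) = sets (PiM I (\<lambda>_. borel))"
  by (intro sets_PiM_cong) auto

lemma sets_PiM_lborel: "sets (PiM I (\<lambda>_. lborel)) = sets (PiM I (\<lambda>_. borel))"
  by (intro sets_PiM_cong) auto

text \<open>The map from noise to data is triangular and translates each coordinate, so the density of the data is the density of
the noise at the recovered noise values.\<close>

lemma nn_integral_noisy_path:
  assumes s: "s > 0"
    and h: "\<And>i. i \<in> {1..n} \<Longrightarrow> h i \<in> borel_measurable (PiM {1..<i} (\<lambda>_. borel))"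
    and G: "G \<in> borel_measurable (PiM {1..n} (\<lambda>_. borel))"
  shows "(\<integral>\<^sup>+e. G (noisy_path h n e) \<partial>PiM {1..n} (\<lambda>_. gauss_measure s)) =
    (\<integral>\<^sup>+y. (\<Prod>i=1..n. ennreal (normal_density 0 s (y i - h i (restrict y {1..<i})))) * G y \<partial>PiM {1..n} (\<lambda>_. lborel))"
  using h G
proof (induction n arbitrary: G)
  case 0
  interpret E: prob_space "gauss_measure s" by (rule prob_space_normal_density[OF s])
  show ?case by (simp add: PiM_empty nn_integral_count_space_finite)
next
  case (Suc n)
  interpret E: prob_space "gauss_measure s" by (rule prob_space_normal_density[OF s])
  interpret PE: product_sigma_finite "\<lambda>_::nat. gauss_measure s" ..
  interpret PL: product_sigma_finite "\<lambda>_::nat. lborel" ..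
  let ?I = "{1..n}"
  have ins: "{1..Suc n} = insert (Suc n) ?I" by auto
  have less: "{1..<Suc n} = ?I" by auto
  note G [measurable] = Suc.prems(2)
  have h' [measurable]: "h (Suc n) \<in> borel_measurable (PiM ?I (\<lambda>_. borel))"
    using Suc.prems(1)[of "Suc n"] unfolding less by simp
  have upd: "(\<lambda>p. (fst p)(Suc n := snd p)) \<in> measurable (PiM ?I (\<lambda>_. borel) \<Otimes>\<^sub>M borel) (PiM {1..Suc n} (\<lambda>_. borel))"
    unfolding ins by (rule measurable_fun_upd) auto
  define G' where "G' = (\<lambda>y. \<integral>\<^sup>+v. ennreal (normal_density 0 s (v - h (Suc n) y)) * G (y(Suc n := v)) \<partial>lborel)"
  have G_upd: "(\<lambda>p. G ((fst p)(Suc n := snd p))) \<in> borel_measurable (PiM ?I (\<lambda>_. borel) \<Otimes>\<^sub>M borel)"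
    by (rule measurable_compose[OF upd G])
  have G'_meas: "G' \<in> borel_measurable (PiM ?I (\<lambda>_. borel))"
    unfolding G'_def
  proof (rule lborel.borel_measurable_nn_integral)
    show "(\<lambda>(y, v). ennreal (normal_density 0 s (v - h (Suc n) y)) * G (y(Suc n := v))) \<in> borel_measurable (PiM ?I (\<lambda>_. borel) \<Otimes>\<^sub>M lborel)"
    proof -
      have hf [measurable]: "(\<lambda>p. h (Suc n) (fst p)) \<in> borel_measurable (PiM ?I (\<lambda>_. borel) \<Otimes>\<^sub>M (borel :: real measure))"
        by (rule measurable_compose[OF measurable_fst h'])
      have "(\<lambda>p. ennreal (normal_density 0 s (snd p - h (Suc n) (fst p)))) \<in> borel_measurable (PiM ?I (\<lambda>_. borel) \<Otimes>\<^sub>M (borel :: real measure))"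
        by measurable
      from borel_measurable_times_ennreal[OF this G_upd]
      have "(\<lambda>(y, v). ennreal (normal_density 0 s (v - h (Suc n) y)) * G (y(Suc n := v))) \<in> borel_measurable (PiM ?I (\<lambda>_. borel) \<Otimes>\<^sub>M borel)"
        by (simp add: case_prod_beta)
      moreover have "sets (PiM ?I (\<lambda>_. borel :: real measure) \<Otimes>\<^sub>M lborel) = sets (PiM ?I (\<lambda>_. borel :: real measure) \<Otimes>\<^sub>M (borel :: real measure))"
        by (rule sets_pair_measure_cong) auto
      ultimately show ?thesis using measurable_cong_sets[OF _ refl] by blast
    qed
  qed
  have shift: "(\<integral>\<^sup>+t. G (y(Suc n := h (Suc n) y + t)) \<partial>gauss_measure s) = G' y"
    if y: "y \<in> space (PiM ?I (\<lambda>_. borel))" for y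
  proof -
    have [measurable]: "(\<lambda>v. G (y(Suc n := v))) \<in> borel_measurable borel"
      using measurable_compose[OF measurable_Pair1'[OF y] G_upd] by simp
    have "(\<integral>\<^sup>+t. G (y(Suc n := h (Suc n) y + t)) \<partial>gauss_measure s) =
       (\<integral>\<^sup>+t. ennreal (normal_density 0 s t) * G (y(Suc n := h (Suc n) y + t)) \<partial>lborel)"
      by (subst nn_integral_density) auto
    also have "\<dots> = G' y"
      unfolding G'_def
      by (subst nn_integral_real_affine[where c = 1 and t = "h (Suc n) y"]) auto
    finally show ?thesis .
  qed
  have sp: "space (PiM ?I (\<lambda>_. gauss_measure s)) = space (PiM ?I (\<lambda>_. borel))"
    by (rule sets_eq_imp_space_eq[OF sets_PiM_gauss])
  have np: "noisy_path h m \<in> measurable (PiM {1..m} (\<lambda>_. borel)) (PiM {1..m} (\<lambda>_. borel))" if "m \<le> Suc n" for m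
  proof -
    have "(\<lambda>v. noisy_path ((\<lambda>_. h) (0::nat)) m v) \<in> measurable (PiM {1..m} (\<lambda>_. borel)) (PiM {1..m} (\<lambda>_. borel))"
    proof (rule measurable_noisy_path[where MU = "count_space UNIV" and h = "\<lambda>_. h" and w = "\<lambda>_. 0"])
      show "(\<lambda>p. h i (snd p)) \<in> borel_measurable (count_space UNIV \<Otimes>\<^sub>M PiM {1..<i} (\<lambda>_. borel))" if "i \<in> {1..m}" for i
        using Suc.prems(1)[of i] that \<open>m \<le> Suc n\<close> by (intro measurable_compose[OF measurable_snd]) auto
    qed auto
    then show ?thesis by simp
  qed
  have "(\<integral>\<^sup>+e. G (noisy_path h (Suc n) e) \<partial>PiM {1..Suc n} (\<lambda>_. gauss_measure s)) =
      (\<integral>\<^sup>+e. (\<integral>\<^sup>+t. G (noisy_path h (Suc n) (e(Suc n := t))) \<partial>gauss_measure s) \<partial>PiM ?I (\<lambda>_. gauss_measure s))"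
    unfolding ins
  proof (rule PE.product_nn_integral_insert)
    have "(\<lambda>e. G (noisy_path h (Suc n) e)) \<in> borel_measurable (PiM {1..Suc n} (\<lambda>_. borel))"
      by (rule measurable_compose[OF np[OF order_refl] G])
    then show "(\<lambda>e. G (noisy_path h (Suc n) e)) \<in> borel_measurable (PiM (insert (Suc n) ?I) (\<lambda>_. gauss_measure s))"
      unfolding ins[symmetric] measurable_cong_sets[OF sets_PiM_gauss refl] .
  qed auto
  also have "\<dots> = (\<integral>\<^sup>+e. G' (noisy_path h n e) \<partial>PiM ?I (\<lambda>_. gauss_measure s))"
  proof (rule nn_integral_cong)
    fix e assume "e \<in> space (PiM ?I (\<lambda>_. gauss_measure s))"
    then have y: "noisy_path h n e \<in> space (PiM ?I (\<lambda>_. borel))"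
      unfolding sp using measurable_space[OF np[of n]] by simp
    have "noisy_path h n (e(Suc n := t)) = noisy_path h n e" for t
      by (rule noisy_path_cong) auto
    then show "(\<integral>\<^sup>+t. G (noisy_path h (Suc n) (e(Suc n := t))) \<partial>gauss_measure s) = G' (noisy_path h n e)"
      using shift[OF y] by simp
  qed
  also have "\<dots> = (\<integral>\<^sup>+y. (\<Prod>i=1..n. ennreal (normal_density 0 s (y i - h i (restrict y {1..<i})))) * G' y \<partial>PiM ?I (\<lambda>_. lborel))"
    by (rule Suc.IH[OF _ G'_meas]) (rule Suc.prems(1), simp)
  also have "\<dots> = (\<integral>\<^sup>+y. (\<integral>\<^sup>+v. (\<Prod>i=1..Suc n. ennreal (normal_density 0 s ((y(Suc n := v)) i - h i (restrict (y(Suc n := v)) {1..<i})))) * G (y(Suc n := v)) \<partial>lborel)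
       \<partial>PiM ?I (\<lambda>_. lborel))"
  proof (rule nn_integral_cong)
    fix y assume "y \<in> space (PiM ?I (\<lambda>_::nat. lborel :: real measure))"
    then have y: "y \<in> space (PiM ?I (\<lambda>_. borel))"
      by (simp add: space_PiM)
    have [measurable]: "(\<lambda>v. G (y(Suc n := v))) \<in> borel_measurable borel"
      using measurable_compose[OF measurable_Pair1'[OF y] G_upd] by simp
    let ?p = "\<Prod>i=1..n. ennreal (normal_density 0 s (y i - h i (restrict y {1..<i})))"
    have "(\<Prod>i=1..Suc n. ennreal (normal_density 0 s ((y(Suc n := v)) i - h i (restrict (y(Suc n := v)) {1..<i})))) =
        ?p * ennreal (normal_density 0 s (v - h (Suc n) y))" for v
    proof -
      have r: "restrict (y(Suc n := v)) {1..<i} = restrict y {1..<i}" if "i \<le> Suc n" for i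
        using that by (auto simp: restrict_def)
      have "restrict y {1..<Suc n} = y"
        using y unfolding less by (simp add: space_PiM PiE_def extensional_restrict)
      moreover have "(\<Prod>i=1..n. ennreal (normal_density 0 s ((y(Suc n := v)) i - h i (restrict (y(Suc n := v)) {1..<i})))) = ?p"
        by (rule prod.cong) (auto simp: r)
      ultimately show ?thesis by (simp add: r del: One_nat_def)
    qed
    then show "?p * G' y = (\<integral>\<^sup>+v. (\<Prod>i=1..Suc n. ennreal (normal_density 0 s ((y(Suc n := v)) i - h i (restrict (y(Suc n := v)) {1..<i})))) * G (y(Suc n := v)) \<partial>lborel)"
      unfolding G'_def by (subst nn_integral_cmult[symmetric]) (auto simp: mult.assoc)
  qed
  also have "\<dots> = (\<integral>\<^sup>+y. (\<Prod>i=1..Suc n. ennreal (normal_density 0 s (y i - h i (restrict y {1..<i})))) * G y \<partial>PiM {1..Suc n} (\<lambda>_. lborel))"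
    unfolding ins
  proof (rule PL.product_nn_integral_insert[symmetric])
    have "(\<lambda>y. (\<Prod>i=1..Suc n. ennreal (normal_density 0 s (y i - h i (restrict y {1..<i})))) * G y) \<in> borel_measurable (PiM {1..Suc n} (\<lambda>_. borel))"
    proof (intro borel_measurable_times_ennreal borel_measurable_prod_ennreal G)
      fix i assume i: "i \<in> {1..Suc n}"
      have "(\<lambda>y. restrict y {1..<i}) \<in> measurable (PiM {1..Suc n} (\<lambda>_. borel)) (PiM {1..<i} (\<lambda>_. borel :: real measure))"
        using i by (intro measurable_restrict_subset) auto
      from measurable_compose[OF this Suc.prems(1)[OF i]]
      have [measurable]: "(\<lambda>y. h i (restrict y {1..<i})) \<in> borel_measurable (PiM {1..Suc n} (\<lambda>_. borel))" .
      have [measurable]: "(\<lambda>y. y i) \<in> borel_measurable (PiM {1..Suc n} (\<lambda>_. borel :: real measure))"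
        using i by (rule measurable_component_singleton)
      show "(\<lambda>y. ennreal (normal_density 0 s (y i - h i (restrict y {1..<i})))) \<in> borel_measurable (PiM {1..Suc n} (\<lambda>_. borel))"
        by measurable
    qed
    then show "(\<lambda>y. (\<Prod>i\<in>insert (Suc n) ?I. ennreal (normal_density 0 s (y i - h i (restrict y {1..<i})))) * G y) \<in> borel_measurable (PiM (insert (Suc n) ?I) (\<lambda>_. lborel))"
      unfolding ins[symmetric] measurable_cong_sets[OF sets_PiM_lborel refl] .
  qed auto
  finally show ?case .
qed

text \<open>The path and the noise are independent, so the probability is an integral over path and noise; for a fixed path the noise
is replaced by the data with their density. After exchanging the integrals, the data and hence the queries are fixed
while the path is averaged, and \<open>gaussian_posterior_tail\<close> applies.

The first factor of the product carries the \<open>\<sigma>\<close>-algebra generated by the process alone, since independence of the noise is known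
for this \<open>\<sigma>\<close>-algebra only.\<close>

lemma adaptive_gaussian_confidence:
  fixes P :: "'w measure"
    and U :: "'a::euclidean_space \<Rightarrow> 'w \<Rightarrow> real" and k :: "'a \<Rightarrow> 'a \<Rightarrow> real"
    and n :: nat and \<epsilon> Y :: "nat \<Rightarrow> 'w \<Rightarrow> real" and X :: "nat \<Rightarrow> 'w \<Rightarrow> 'a"
  assumes P: "prob_space P" and gp: "gaussian_process P D (\<lambda>x. 0) k U"
    and pd: "psd_kernel k" and k_pos: "\<And>u. k u u > 0"
    and k_meas: "(\<lambda>p. k (fst p) (snd p)) \<in> borel_measurable (borel \<Otimes>\<^sub>M borel)"
    and s: "s > 0"
    and noise_indep: "prob_space.indep_vars P (\<lambda>n. borel) \<epsilon> {1..}"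
    and noise_law: "\<And>n. n \<ge> 1 \<Longrightarrow> distributed P lborel (\<epsilon> n) (normal_density 0 s)"
    and noise_U: "prob_space.indep_set P
          (sets (vimage_algebra (space P) (\<lambda>\<omega>. \<lambda>x\<in>D. U x \<omega>) (PiM D (\<lambda>x. borel))))
          (sets (vimage_algebra (space P) (\<lambda>\<omega>. \<lambda>n\<in>{1..}. \<epsilon> n \<omega>) (PiM {1..} (\<lambda>n. borel))))"
    and D_closed: "closed D" and U_cont: "\<And>\<omega>. \<omega> \<in> space P \<Longrightarrow> continuous_on D (\<lambda>u. U u \<omega>)"
    and X_D: "\<And>n \<omega>. n \<ge> 1 \<Longrightarrow> \<omega> \<in> space P \<Longrightarrow> X n \<omega> \<in> D"
    and feedback: "\<And>n \<omega>. n \<ge> 1 \<Longrightarrow> \<omega> \<in> space P \<Longrightarrow> Y n \<omega> = U (X n \<omega>) \<omega> + \<epsilon> n \<omega>"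
    and X_adapted: "\<And>n. n \<ge> 1 \<Longrightarrow>
                      \<exists>q \<in> borel_measurable (PiM {1..<n} (\<lambda>i. borel)).
                        \<forall>\<omega>\<in>space P. X n \<omega> = q (\<lambda>i\<in>{1..<n}. Y i \<omega>)"
    and z: "z \<in> D" and c: "c \<ge> 0"
  defines "bad \<equiv> {\<omega>\<in>space P. \<bar>U z \<omega> - cond_mean k s (\<lambda>i. X i \<omega>) (\<lambda>i. Y i \<omega>) n z\<bar> >
                    c * sqrt (cond_cov k s (\<lambda>i. X i \<omega>) n z z)}"
  shows "bad \<in> sets P" and "emeasure P bad \<le> ennreal (2 * exp (- c\<^sup>2 / 2))"
proof -
  interpret prob_space P by (rule P)
  interpret E: prob_space "gauss_measure s" by (rule prob_space_normal_density[OF s])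
  interpret PE: product_prob_space "\<lambda>_::nat. gauss_measure s" ..
  interpret PL: product_sigma_finite "\<lambda>_::nat. lborel :: real measure" ..
  let ?I = "{1..n}"
  let ?R = "\<lambda>J. PiM J (\<lambda>_::nat. borel :: real measure)"
  define F where "F = vimage_algebra (space P) (\<lambda>\<omega>. \<lambda>x\<in>D. U x \<omega>) (PiM D (\<lambda>x. borel))"
  define MU where "MU = restr_to_subalg P F"
  have U_meas: "U u \<in> borel_measurable P" if "u \<in> D" for u
    by (rule gaussian_process_measurable[OF P gp that])
  have eps_meas: "\<epsilon> i \<in> borel_measurable P" if "i \<ge> 1" for i
    using distributed_measurable[OF noise_law[OF that]] by simp
  have subalg: "subalgebra P F"
    unfolding subalgebra_def F_def
  proof (intro conjI)
    have "(\<lambda>\<omega>. \<lambda>x\<in>D. U x \<omega>) \<in> measurable P (PiM D (\<lambda>x. borel))"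
      using U_meas by (rule measurable_restrict)
    then show "sets (vimage_algebra (space P) (\<lambda>\<omega>. \<lambda>x\<in>D. U x \<omega>) (PiM D (\<lambda>x. borel))) \<subseteq> sets P"
      by (auto simp: sets_vimage_algebra2 measurable_def)
  qed simp
  have MU_space: "space MU = space P" and MU_sets: "sets MU = sets F"
    unfolding MU_def by (simp_all add: space_restr_to_subalg sets_restr_to_subalg[OF subalg])
  interpret MU: prob_space MU unfolding MU_def by (rule prob_space_restr_to_subalg[OF subalg P])
  have U_MU: "U u \<in> borel_measurable MU" if "u \<in> D" for u
  proof -
    have "(\<lambda>\<omega>. \<lambda>x\<in>D. U x \<omega>) \<in> measurable F (PiM D (\<lambda>x. borel))"
      unfolding F_def by (rule measurable_vimage_algebra1) (auto simp: space_PiM)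
    from measurable_compose[OF this measurable_component_singleton[OF that]]
    have "U u \<in> borel_measurable F" using that by simp
    then show ?thesis unfolding MU_def by (rule measurable_in_subalg[OF subalg])
  qed
  have id_MU: "(\<lambda>\<omega>. \<omega>) \<in> measurable P MU"
    using subalg MU_space MU_sets by (auto simp: measurable_def subalgebra_def dest: sets.sets_into_space)
  obtain q where q_meas: "\<And>i. i \<ge> 1 \<Longrightarrow> q i \<in> borel_measurable (?R {1..<i})"
    and q_X: "\<And>i \<omega>. i \<ge> 1 \<Longrightarrow> \<omega> \<in> space P \<Longrightarrow> X i \<omega> = q i (\<lambda>j\<in>{1..<i}. Y j \<omega>)"
    using X_adapted by metis
  define q' where "q' = (\<lambda>i y. if q i y \<in> D then q i y else z)"
  have q'_D: "q' i y \<in> D" for i y unfolding q'_def using z by simp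
  have q'_meas: "q' i \<in> borel_measurable (?R {1..<i})" if "i \<ge> 1" for i
    unfolding q'_def
  proof (rule measurable_If)
    show "{y \<in> space (?R {1..<i}). q i y \<in> D} \<in> sets (?R {1..<i})"
      using measurable_sets[OF q_meas[OF that] borel_closed[OF D_closed]]
      by (simp add: vimage_def Int_def conj_commute)
  qed (use q_meas[OF that] in auto)
  have q'_X: "X i \<omega> = q' i (\<lambda>j\<in>{1..<i}. Y j \<omega>)" if "i \<ge> 1" "\<omega> \<in> space P" for i \<omega>
    using q_X[OF that] X_D[OF that] by (simp add: q'_def)
  define h where "h = (\<lambda>\<omega> i y. U (q' i y) \<omega>)"
  have h_meas: "(\<lambda>p. h (fst p) i (snd p)) \<in> borel_measurable (MU \<Otimes>\<^sub>M ?R {1..<i})" if "i \<ge> 1" for i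
    unfolding h_def
  proof (rule measurable_path_evaluation[where D = D and M = MU])
    show "(\<lambda>p. q' i (snd p)) \<in> borel_measurable (MU \<Otimes>\<^sub>M ?R {1..<i})"
      by (rule measurable_compose[OF measurable_snd q'_meas[OF that]])
  qed (use U_MU U_cont q'_D MU_space in auto)
  have h_meas1: "h \<omega> i \<in> borel_measurable (?R {1..<i})" if "i \<ge> 1" "\<omega> \<in> space P" for \<omega> i
    using measurable_compose[OF measurable_Pair1' h_meas[OF that(1)], of \<omega>] that MU_space by simp
  have restr: "(\<lambda>y. restrict y {1..<i}) \<in> measurable (?R ?I) (?R {1..<i})" if "i \<in> ?I" for i
    using that by (intro measurable_restrict_subset) auto
  define x where "x = (\<lambda>y i. q' i (restrict y {1..<i}))"
  have x_meas: "(\<lambda>y. x y i) \<in> borel_measurable (?R ?I)" if "i \<in> ?I" for i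
    unfolding x_def using that by (intro measurable_compose[OF restr q'_meas]) auto
  have y_meas: "(\<lambda>y. y i) \<in> borel_measurable (?R ?I)" if "i \<in> ?I" for i
    using that by (rule measurable_component_singleton)
  define B where "B = {(\<omega>, y). \<bar>U z \<omega> - cond_mean k s (x y) y n z\<bar> > c * sqrt (cond_cov k s (x y) n z z)}"
  define \<Lambda> where "\<Lambda> = (\<lambda>\<omega> y. \<Prod>i=1..n. normal_density 0 s (y i - U (x y i) \<omega>))"
  have B_meas: "(\<lambda>p. indicator B (fst p, snd p) :: ennreal) \<in> borel_measurable (MU \<Otimes>\<^sub>M ?R ?I)"
  proof -
    have [measurable]: "(\<lambda>y. cond_mean k s (x y) y n z) \<in> borel_measurable (?R ?I)"
      by (rule cond_mean_measurable[OF k_meas x_meas y_meas, where u = "\<lambda>_. z" and s = s]) simp_all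
    have [measurable]: "(\<lambda>y. cond_cov k s (x y) n z z) \<in> borel_measurable (?R ?I)"
      by (rule cond_cov_measurable[OF k_meas x_meas, where u = "\<lambda>_. z" and v = "\<lambda>_. z" and s = s]) simp_all
    note [measurable] = U_MU[OF z]
    have "Measurable.pred (MU \<Otimes>\<^sub>M ?R ?I) (\<lambda>p. \<bar>U z (fst p) - cond_mean k s (x (snd p)) (snd p) n z\<bar> >
        c * sqrt (cond_cov k s (x (snd p)) n z z))"
      by measurable
    then have "(\<lambda>p. if \<bar>U z (fst p) - cond_mean k s (x (snd p)) (snd p) n z\<bar> >
        c * sqrt (cond_cov k s (x (snd p)) n z z) then 1 else 0 :: ennreal) \<in> borel_measurable (MU \<Otimes>\<^sub>M ?R ?I)"
      by measurable
    moreover have "(\<lambda>p. indicator B (fst p, snd p) :: ennreal) =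
        (\<lambda>p. if \<bar>U z (fst p) - cond_mean k s (x (snd p)) (snd p) n z\<bar> >
        c * sqrt (cond_cov k s (x (snd p)) n z z) then 1 else 0)"
      by (auto simp: B_def indicator_def fun_eq_iff)
    ultimately show ?thesis by (simp only:)
  qed
  have Ux_meas: "(\<lambda>p. U (x (snd p) i) (fst p)) \<in> borel_measurable (MU \<Otimes>\<^sub>M ?R ?I)" if "i \<in> ?I" for i
  proof (rule measurable_path_evaluation[where D = D and M = MU])
    show "(\<lambda>p. x (snd p) i) \<in> borel_measurable (MU \<Otimes>\<^sub>M ?R ?I)"
      by (rule measurable_compose[OF measurable_snd x_meas[OF that]])
  qed (use U_MU U_cont q'_D MU_space in \<open>auto simp: x_def\<close>)
  have \<Lambda>_meas: "(\<lambda>p. \<Lambda> (fst p) (snd p)) \<in> borel_measurable (MU \<Otimes>\<^sub>M ?R ?I)"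
    unfolding \<Lambda>_def
  proof (rule borel_measurable_prod)
    fix i assume i: "i \<in> ?I"
    note [measurable] = Ux_meas[OF i] measurable_compose[OF measurable_snd y_meas[OF i]]
    show "(\<lambda>p. normal_density 0 s (snd p i - U (x (snd p) i) (fst p))) \<in> borel_measurable (MU \<Otimes>\<^sub>M ?R ?I)"
      by measurable
  qed
  \<comment> \<open>Substituting the feedback equation round by round expresses the data by the path and the noise alone.\<close>
  have data: "(\<lambda>j\<in>{1..m}. Y j \<omega>) = noisy_path (h \<omega>) m (\<lambda>j\<in>?I. \<epsilon> j \<omega>)"
    if "m \<le> n" "\<omega> \<in> space P" for m \<omega>
    using that(1)
  proof (induction m)
    case 0
    show ?case by auto
  next
    case (Suc m)
    have less: "{1..<Suc m} = {1..m}" by auto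
    have IH: "noisy_path (h \<omega>) m (\<lambda>j\<in>?I. \<epsilon> j \<omega>) = (\<lambda>j\<in>{1..m}. Y j \<omega>)"
      by (rule Suc.IH[symmetric]) (use Suc.prems in simp)
    have "Y (Suc m) \<omega> = h \<omega> (Suc m) (\<lambda>j\<in>{1..m}. Y j \<omega>) + \<epsilon> (Suc m) \<omega>"
      using feedback[of "Suc m" \<omega>] q'_X[of "Suc m" \<omega>] that(2) unfolding less by (simp add: h_def)
    then show ?case
      unfolding noisy_path.simps IH using Suc.prems by (auto simp: restrict_def)
  qed
  define eI where "eI = (\<lambda>\<omega>. \<lambda>j\<in>?I. \<epsilon> j \<omega>)"
  have eI_meas: "eI \<in> measurable P (?R ?I)"
    unfolding eI_def by (rule measurable_restrict) (use eps_meas in auto)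
  have bad_iff: "\<omega> \<in> bad \<longleftrightarrow> (\<omega>, noisy_path (h \<omega>) n (eI \<omega>)) \<in> B" if "\<omega> \<in> space P" for \<omega>
  proof -
    define y where "y = noisy_path (h \<omega>) n (eI \<omega>)"
    have y: "y = (\<lambda>j\<in>?I. Y j \<omega>)" unfolding y_def eI_def using data[of n \<omega>] that by simp
    have xy: "x y i = X i \<omega>" if "i \<in> ?I" for i
    proof -
      have "restrict y {1..<i} = (\<lambda>j\<in>{1..<i}. Y j \<omega>)"
        using that unfolding y by (auto simp: restrict_def)
      then show ?thesis using q'_X[of i \<omega>] that \<open>\<omega> \<in> space P\<close> by (simp add: x_def)
    qed
    have "cond_cov k s (x y) n z z = cond_cov k s (\<lambda>i. X i \<omega>) n z z"
      by (rule cond_cov_cong) (rule xy)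
    moreover have "cond_mean k s (x y) y n z = cond_mean k s (\<lambda>i. X i \<omega>) (\<lambda>i. Y i \<omega>) n z"
      by (rule cond_mean_cong) (simp_all add: xy, simp add: y)
    ultimately show ?thesis using that by (simp add: bad_def B_def y_def)
  qed
  define \<Phi> where "\<Phi> = (\<lambda>p. indicator B (fst p, noisy_path (h (fst p)) n (snd p)) :: ennreal)"
  have np_meas: "(\<lambda>p. noisy_path (h (fst p)) n (snd p)) \<in> measurable (MU \<Otimes>\<^sub>M ?R ?I) (?R ?I)"
  proof (rule measurable_noisy_path[where MU = MU])
    show "(\<lambda>p. snd p i) \<in> borel_measurable (MU \<Otimes>\<^sub>M ?R ?I)" if "i \<in> ?I" for i
      by (rule measurable_compose[OF measurable_snd y_meas[OF that]])
  qed (use h_meas in auto)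
  have \<Phi>_meas: "\<Phi> \<in> borel_measurable (MU \<Otimes>\<^sub>M ?R ?I)"
    unfolding \<Phi>_def
    using measurable_compose[OF measurable_Pair[OF measurable_fst np_meas] B_meas] by simp
  have pair_meas: "(\<lambda>\<omega>. (\<omega>, eI \<omega>)) \<in> measurable P (MU \<Otimes>\<^sub>M ?R ?I)"
    by (rule measurable_Pair[OF id_MU eI_meas])
  have bad_\<Phi>: "indicator bad \<omega> = \<Phi> (\<omega>, eI \<omega>)" if "\<omega> \<in> space P" for \<omega>
    using bad_iff[OF that] by (simp add: \<Phi>_def indicator_def)
  have "bad \<subseteq> space P" unfolding bad_def by blast
  moreover have "\<omega> \<in> bad \<longleftrightarrow> \<Phi> (\<omega>, eI \<omega>) = 1" if "\<omega> \<in> space P" for \<omega>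
    unfolding bad_\<Phi>[OF that, symmetric] by (cases "\<omega> \<in> bad") simp_all
  ultimately have "bad = (\<lambda>\<omega>. \<Phi> (\<omega>, eI \<omega>)) -` {1} \<inter> space P"
    by blast
  also have "\<dots> \<in> sets P"
    by (rule measurable_sets[OF measurable_compose[OF pair_meas \<Phi>_meas]]) simp
  finally show bad_sets: "bad \<in> sets P" .
  \<comment> \<open>On rectangles this is the assumed independence. Without observations the index set is empty, which is treated separately below.\<close>
  have joint: "distr P (MU \<Otimes>\<^sub>M ?R ?I) (\<lambda>\<omega>. (\<omega>, eI \<omega>)) = MU \<Otimes>\<^sub>M PiM ?I (\<lambda>_. gauss_measure s)" if "n \<ge> 1"
  proof -
    let ?V = "vimage_algebra (space P) (\<lambda>\<omega>. \<lambda>n\<in>{1..}. \<epsilon> n \<omega>) (?R {1..})"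
    have law: "distr P (?R ?I) eI = PiM ?I (\<lambda>_. gauss_measure s)"
    proof -
      have "indep_vars (\<lambda>n. borel) \<epsilon> ?I" by (rule indep_vars_subset[OF noise_indep]) auto
      then have "distr P (?R ?I) eI = PiM ?I (\<lambda>i. distr P borel (\<epsilon> i))"
        unfolding eI_def using \<open>n \<ge> 1\<close> eps_meas by (subst indep_vars_iff_distr_eq_PiM'[symmetric]) auto
      also have "\<dots> = PiM ?I (\<lambda>_. gauss_measure s)"
      proof (rule PiM_cong[OF refl])
        fix i assume "i \<in> ?I"
        then have "distr P lborel (\<epsilon> i) = gauss_measure s"
          using distributed_distr_eq_density[OF noise_law[of i]] by simp
        moreover have "distr P borel (\<epsilon> i) = distr P lborel (\<epsilon> i)" by (rule distr_cong) auto
        ultimately show "distr P borel (\<epsilon> i) = gauss_measure s" by simp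
      qed
      finally show ?thesis .
    qed
    interpret N: prob_space "distr P (?R ?I) eI" by (rule prob_space_distr[OF eI_meas])
    have eI_V: "eI \<in> measurable ?V (?R ?I)"
    proof -
      have r: "(\<lambda>f. restrict f ?I) \<in> measurable (?R {1..}) (?R ?I)"
        by (rule measurable_restrict_subset) auto
      have v: "(\<lambda>\<omega>. \<lambda>n\<in>{1..}. \<epsilon> n \<omega>) \<in> measurable ?V (?R {1..})"
        by (rule measurable_vimage_algebra1) (auto simp: space_PiM)
      have "(\<lambda>\<omega>. restrict (\<lambda>n\<in>{1..}. \<epsilon> n \<omega>) ?I) = eI"
        by (auto simp: eI_def restrict_def fun_eq_iff)
      with measurable_compose[OF v r] show ?thesis by (simp only:)
    qed
    have "MU \<Otimes>\<^sub>M distr P (?R ?I) eI = distr P (MU \<Otimes>\<^sub>M ?R ?I) (\<lambda>\<omega>. (\<omega>, eI \<omega>))"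
    proof (rule pair_measure_eqI)
      show "sigma_finite_measure MU" "sigma_finite_measure (distr P (?R ?I) eI)"
        by unfold_locales
      show "sets (MU \<Otimes>\<^sub>M distr P (?R ?I) eI) = sets (distr P (MU \<Otimes>\<^sub>M ?R ?I) (\<lambda>\<omega>. (\<omega>, eI \<omega>)))"
        unfolding sets_distr by (rule sets_pair_measure_cong) simp_all
      fix A C assume A: "A \<in> sets MU" and "C \<in> sets (distr P (?R ?I) eI)"
      then have C: "C \<in> sets (?R ?I)" by simp
      have A': "A \<in> sets F" "A \<in> sets P" "A \<subseteq> space P"
        using A subalg sets.sets_into_space[OF A] by (auto simp: MU_sets MU_space subalgebra_def)
      have C': "eI -` C \<inter> space P \<in> sets ?V"
        using measurable_sets[OF eI_V C] by simp
      have C'': "eI -` C \<inter> space P \<in> sets P"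
        by (rule measurable_sets[OF eI_meas C])
      have "emeasure MU A = emeasure P A"
        unfolding MU_def by (rule emeasure_restr_to_subalg[OF subalg A'(1)])
      moreover have "emeasure (distr P (?R ?I) eI) C = emeasure P (eI -` C \<inter> space P)"
        by (rule emeasure_distr[OF eI_meas C])
      moreover have "emeasure (distr P (MU \<Otimes>\<^sub>M ?R ?I) (\<lambda>\<omega>. (\<omega>, eI \<omega>))) (A \<times> C) =
          emeasure P ((\<lambda>\<omega>. (\<omega>, eI \<omega>)) -` (A \<times> C) \<inter> space P)"
        by (rule emeasure_distr[OF pair_meas]) (use A C in simp)
      moreover have "(\<lambda>\<omega>. (\<omega>, eI \<omega>)) -` (A \<times> C) \<inter> space P = A \<inter> (eI -` C \<inter> space P)"
        using A' by auto
      moreover have "prob (A \<inter> (eI -` C \<inter> space P)) = prob A * prob (eI -` C \<inter> space P)"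
        by (rule indep_setD[OF noise_U[folded F_def] A'(1) C'])
      ultimately show "emeasure MU A * emeasure (distr P (?R ?I) eI) C =
          emeasure (distr P (MU \<Otimes>\<^sub>M ?R ?I) (\<lambda>\<omega>. (\<omega>, eI \<omega>))) (A \<times> C)"
        by (simp add: emeasure_eq_measure ennreal_mult)
    qed
    then show ?thesis unfolding law by simp
  qed
  have tail: "(\<integral>\<^sup>+\<omega>. indicator B (\<omega>, y) * ennreal (\<Lambda> \<omega> y) \<partial>P)
      \<le> ennreal (2 * exp (- c\<^sup>2 / 2)) * (\<integral>\<^sup>+\<omega>. ennreal (\<Lambda> \<omega> y) \<partial>P)" for y
    using gaussian_posterior_tail[OF P gp pd k_pos s z _ c, of n "x y" y] q'_D
    by (simp add: B_def \<Lambda>_def indicator_def x_def)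
  show "emeasure P bad \<le> ennreal (2 * exp (- c\<^sup>2 / 2))"
  proof (cases "n = 0")
    case True
    have "emeasure P bad = (\<integral>\<^sup>+\<omega>. indicator B (\<omega>, \<lambda>_. undefined) * ennreal (\<Lambda> \<omega> (\<lambda>_. undefined)) \<partial>P)"
      unfolding nn_integral_indicator[OF bad_sets, symmetric]
      by (rule nn_integral_cong) (use True bad_iff in \<open>simp add: \<Lambda>_def indicator_def\<close>)
    also have "\<dots> \<le> ennreal (2 * exp (- c\<^sup>2 / 2)) * (\<integral>\<^sup>+\<omega>. ennreal (\<Lambda> \<omega> (\<lambda>_. undefined)) \<partial>P)" by (rule tail)
    also have "(\<integral>\<^sup>+\<omega>. ennreal (\<Lambda> \<omega> (\<lambda>_. undefined)) \<partial>P) = 1"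
      using True emeasure_space_1 by (simp add: \<Lambda>_def)
    finally show ?thesis by simp
  next
    case False
    let ?N = "PiM ?I (\<lambda>_. gauss_measure s)" and ?L = "PiM ?I (\<lambda>_. lborel :: real measure)"
    interpret N: prob_space ?N by (rule prob_space_PiM) (rule E.prob_space_axioms)
    interpret L: sigma_finite_measure ?L by (rule PL.sigma_finite) simp
    interpret MUL: pair_sigma_finite MU ?L ..
    have pair_sets_lborel: "sets (MU \<Otimes>\<^sub>M ?L) = sets (MU \<Otimes>\<^sub>M ?R ?I)"
      by (rule sets_pair_measure_cong[OF refl sets_PiM_lborel])
    have pair_sets_gauss: "sets (MU \<Otimes>\<^sub>M ?N) = sets (MU \<Otimes>\<^sub>M ?R ?I)"
      by (rule sets_pair_measure_cong[OF refl sets_PiM_gauss])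
    have shift: "(\<integral>\<^sup>+e. G (noisy_path (h \<omega>) n e) \<partial>?N) = (\<integral>\<^sup>+y. G y * ennreal (\<Lambda> \<omega> y) \<partial>?L)"
      if "\<omega> \<in> space MU" "G \<in> borel_measurable (?R ?I)" for \<omega> G
    proof -
      have "(\<integral>\<^sup>+e. G (noisy_path (h \<omega>) n e) \<partial>?N) =
          (\<integral>\<^sup>+y. (\<Prod>i=1..n. ennreal (normal_density 0 s (y i - h \<omega> i (restrict y {1..<i})))) * G y \<partial>?L)"
        by (rule nn_integral_noisy_path[OF s h_meas1 that(2)]) (use that MU_space in auto)
      also have "\<dots> = (\<integral>\<^sup>+y. G y * ennreal (\<Lambda> \<omega> y) \<partial>?L)"
        by (rule nn_integral_cong) (simp add: \<Lambda>_def h_def x_def prod_ennreal mult.commute)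
      finally show ?thesis .
    qed
    have BL_meas: "(\<lambda>p. indicator B (fst p, snd p) * ennreal (\<Lambda> (fst p) (snd p))) \<in> borel_measurable (MU \<Otimes>\<^sub>M ?R ?I)"
      using B_meas \<Lambda>_meas by measurable
    have L_meas: "(\<lambda>p. ennreal (\<Lambda> (fst p) (snd p))) \<in> borel_measurable (MU \<Otimes>\<^sub>M ?R ?I)"
      using \<Lambda>_meas by measurable
    have to_P: "(\<integral>\<^sup>+\<omega>. f (\<omega>, y) \<partial>MU) = (\<integral>\<^sup>+\<omega>. f (\<omega>, y) \<partial>P)"
      if "f \<in> borel_measurable (MU \<Otimes>\<^sub>M ?R ?I)" "y \<in> space ?L" for f :: "_ \<Rightarrow> ennreal" and y
    proof -
      have y: "y \<in> space (?R ?I)" using that(2) by (simp add: space_PiM)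
      have "(\<lambda>\<omega>. f (\<omega>, y)) \<in> borel_measurable MU"
        by (rule measurable_compose[OF measurable_Pair2'[OF y] that(1)])
      then have "(\<lambda>\<omega>. f (\<omega>, y)) \<in> borel_measurable F"
        using measurable_cong_sets[OF MU_sets refl] by blast
      then show ?thesis unfolding MU_def by (rule nn_integral_subalgebra2[OF subalg])
    qed
    have "emeasure P bad = (\<integral>\<^sup>+\<omega>. \<Phi> (\<omega>, eI \<omega>) \<partial>P)"
      unfolding nn_integral_indicator[OF bad_sets, symmetric] by (rule nn_integral_cong) (rule bad_\<Phi>)
    also have "\<dots> = (\<integral>\<^sup>+p. \<Phi> p \<partial>distr P (MU \<Otimes>\<^sub>M ?R ?I) (\<lambda>\<omega>. (\<omega>, eI \<omega>)))"
      using pair_meas \<Phi>_meas by (subst nn_integral_distr) auto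
    also have "\<dots> = (\<integral>\<^sup>+p. \<Phi> p \<partial>(MU \<Otimes>\<^sub>M ?N))" using joint False by simp
    also have "\<dots> = (\<integral>\<^sup>+\<omega>. \<integral>\<^sup>+e. \<Phi> (\<omega>, e) \<partial>?N \<partial>MU)"
      using \<Phi>_meas measurable_cong_sets[OF pair_sets_gauss refl]
      by (intro N.nn_integral_fst[symmetric]) blast
    also have "\<dots> = (\<integral>\<^sup>+\<omega>. \<integral>\<^sup>+y. indicator B (\<omega>, y) * ennreal (\<Lambda> \<omega> y) \<partial>?L \<partial>MU)"
    proof (rule nn_integral_cong)
      fix \<omega> assume \<omega>: "\<omega> \<in> space MU"
      have "(\<lambda>y. indicator B (\<omega>, y) :: ennreal) \<in> borel_measurable (?R ?I)"
        using measurable_compose[OF measurable_Pair1'[OF \<omega>] B_meas] by simp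
      from shift[OF \<omega> this] show "(\<integral>\<^sup>+e. \<Phi> (\<omega>, e) \<partial>?N) = (\<integral>\<^sup>+y. indicator B (\<omega>, y) * ennreal (\<Lambda> \<omega> y) \<partial>?L)"
        by (simp add: \<Phi>_def)
    qed
    also have "\<dots> = (\<integral>\<^sup>+y. \<integral>\<^sup>+\<omega>. indicator B (\<omega>, y) * ennreal (\<Lambda> \<omega> y) \<partial>MU \<partial>?L)"
      using MUL.Fubini[of "\<lambda>p. indicator B (fst p, snd p) * ennreal (\<Lambda> (fst p) (snd p))"] BL_meas
      unfolding measurable_cong_sets[OF pair_sets_lborel refl] by simp
    also have "\<dots> \<le> (\<integral>\<^sup>+y. ennreal (2 * exp (- c\<^sup>2 / 2)) * (\<integral>\<^sup>+\<omega>. ennreal (\<Lambda> \<omega> y) \<partial>MU) \<partial>?L)"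
    proof (rule nn_integral_mono)
      fix y assume y: "y \<in> space ?L"
      show "(\<integral>\<^sup>+\<omega>. indicator B (\<omega>, y) * ennreal (\<Lambda> \<omega> y) \<partial>MU) \<le>
          ennreal (2 * exp (- c\<^sup>2 / 2)) * (\<integral>\<^sup>+\<omega>. ennreal (\<Lambda> \<omega> y) \<partial>MU)"
        using tail[of y] to_P[OF BL_meas y] to_P[OF L_meas y] by simp
    qed
    also have "\<dots> = ennreal (2 * exp (- c\<^sup>2 / 2)) * (\<integral>\<^sup>+y. \<integral>\<^sup>+\<omega>. ennreal (\<Lambda> \<omega> y) \<partial>MU \<partial>?L)"
    proof (rule nn_integral_cmult)
      have "(\<lambda>(\<omega>, y). ennreal (\<Lambda> \<omega> y)) \<in> borel_measurable (MU \<Otimes>\<^sub>M ?L)"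
        using L_meas unfolding measurable_cong_sets[OF pair_sets_lborel refl] by (simp add: case_prod_beta)
      then have "(\<lambda>(y, \<omega>). ennreal (\<Lambda> \<omega> y)) \<in> borel_measurable (?L \<Otimes>\<^sub>M MU)"
        using measurable_pair_swap by (auto simp: case_prod_beta dest: measurable_pair_swap)
      then show "(\<lambda>y. \<integral>\<^sup>+\<omega>. ennreal (\<Lambda> \<omega> y) \<partial>MU) \<in> borel_measurable ?L"
        by (rule MU.borel_measurable_nn_integral)
    qed
    also have "(\<integral>\<^sup>+y. \<integral>\<^sup>+\<omega>. ennreal (\<Lambda> \<omega> y) \<partial>MU \<partial>?L) = (\<integral>\<^sup>+\<omega>. \<integral>\<^sup>+y. ennreal (\<Lambda> \<omega> y) \<partial>?L \<partial>MU)"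
      using MUL.Fubini[of "\<lambda>p. ennreal (\<Lambda> (fst p) (snd p))"] L_meas
      unfolding measurable_cong_sets[OF pair_sets_lborel refl] by simp
    also have "\<dots> = (\<integral>\<^sup>+\<omega>. 1 \<partial>MU)"
    proof (rule nn_integral_cong)
      fix \<omega> assume \<omega>: "\<omega> \<in> space MU"
      from shift[OF \<omega>, of "\<lambda>_. 1"] show "(\<integral>\<^sup>+y. ennreal (\<Lambda> \<omega> y) \<partial>?L) = 1"
        using N.emeasure_space_1 by simp
    qed
    also have "\<dots> = 1" using MU.emeasure_space_1 by simp
    finally show ?thesis by simp
  qed
qed

section \<open>Confidence bounds on the whole domain\<close>

text \<open>The squared distance of the sections \<open>k u\<close> and \<open>k v\<close> in the reproducing kernel Hilbert space.\<close>

definition kdist2 :: "('a \<Rightarrow> 'a \<Rightarrow> real) \<Rightarrow> 'a \<Rightarrow> 'a \<Rightarrow> real" where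
  "kdist2 k u v = k u u - 2 * k u v + k v v"

lemma psd_kernel_cauchy_schwarz_diff:
  assumes pd: "psd_kernel k"
  shows "(k u w - k v w)\<^sup>2 \<le> kdist2 k u v * k w w"
proof -
  have *: "0 \<le> kdist2 k u v + 2 * t * (k u w - k v w) + t\<^sup>2 * k w w" for t
  proof -
    define c where "c = (\<lambda>i::nat. if i = 0 then 1 else -1 :: real)"
    define x where "x = (\<lambda>i::nat. if i = 0 then u else v)"
    have "0 \<le> (\<Sum>i<2. \<Sum>j<2. c i * c j * k (x i) (x j)) + 2 * t * (\<Sum>i<2. c i * k (x i) w) + t\<^sup>2 * k w w"
      by (rule psd_kernel_extend[OF pd])
    then show ?thesis
      using psd_kernel_sym[OF pd, of u v]
      by (simp add: c_def x_def numeral_2_eq_2 kdist2_def)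
  qed
  show ?thesis
  proof (cases "k w w = 0")
    case True
    have "k u w = 0" "k v w = 0"
      using psd_kernel_cauchy_schwarz[OF pd, of u w] psd_kernel_cauchy_schwarz[OF pd, of v w] True by simp_all
    then show ?thesis using True by simp
  next
    case False
    with psd_kernel_diag_nonneg[OF pd, of w] have w: "k w w > 0" by simp
    define t where "t = - (k u w - k v w) / k w w"
    have "2 * t * (k u w - k v w) + t\<^sup>2 * k w w = - (k u w - k v w)\<^sup>2 / k w w"
      using w by (simp add: t_def power2_eq_square field_simps)
    with *[of t] have "(k u w - k v w)\<^sup>2 / k w w \<le> kdist2 k u v" by simp
    with w show ?thesis by (simp add: pos_divide_le_eq)
  qed
qed

lemma sqrt_diag_lipschitz:
  assumes pd: "psd_kernel k"
  shows "\<bar>sqrt (k u u) - sqrt (k v v)\<bar> \<le> sqrt (kdist2 k u v)"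
proof -
  have "k u v \<le> sqrt (k u u) * sqrt (k v v)"
  proof -
    have "\<bar>k u v\<bar> \<le> sqrt (k u u * k v v)"
      using psd_kernel_cauchy_schwarz[OF pd, of u v] by (metis real_sqrt_abs real_sqrt_le_iff)
    then show ?thesis by (simp add: real_sqrt_mult)
  qed
  then have "(sqrt (k u u) - sqrt (k v v))\<^sup>2 \<le> kdist2 k u v"
    using psd_kernel_diag_nonneg[OF pd] by (simp add: power2_diff kdist2_def)
  then show ?thesis by (metis real_sqrt_abs real_sqrt_le_iff)
qed

lemma kdist2_cond_cov_le:
  assumes pd: "psd_kernel k" and s: "s > 0"
  shows "kdist2 (cond_cov k s x n) u v \<le> kdist2 k u v"
proof (induction n)
  case 0
  show ?case by (simp add: kdist2_def)
next
  case (Suc n)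
  let ?c = "cond_cov k s x n" and ?z = "x (Suc n)"
  have "kdist2 (cond_cov k s x (Suc n)) u v = kdist2 ?c u v - (?c u ?z - ?c v ?z)\<^sup>2 / (s\<^sup>2 + ?c ?z ?z)"
    by (simp add: kdist2_def power2_eq_square algebra_simps add_divide_distrib diff_divide_distrib)
  also have "\<dots> \<le> kdist2 ?c u v"
    using cond_cov_denom_pos[OF pd s, of x n ?z] by simp
  finally show ?case using Suc by (rule order_trans)
qed

lemma kdist2_nonneg: "psd_kernel k \<Longrightarrow> 0 \<le> kdist2 k u v"
  using sqrt_diag_lipschitz[of k u v] by (metis abs_ge_zero order_trans real_sqrt_ge_0_iff)

text \<open>Each observation changes the mean by its prediction error times a section of the current covariance, and
such a section is Lipschitz for the kernel distance, which conditioning does not increase.\<close>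

lemma cond_mean_lipschitz:
  assumes pd: "psd_kernel k" and s: "s > 0" and k1: "\<And>u. k u u \<le> 1"
  shows "\<bar>cond_mean k s x y n u - cond_mean k s x y n v\<bar> \<le>
    sqrt (kdist2 k u v) * ((\<Sum>i=1..n. \<bar>y i - cond_mean k s x y (i - 1) (x i)\<bar>) / s\<^sup>2)"
proof (induction n)
  case 0
  show ?case by simp
next
  case (Suc n)
  let ?c = "cond_cov k s x n" and ?z = "x (Suc n)" and ?m = "cond_mean k s x y n"
  define r where "r = y (Suc n) - ?m ?z"
  have "(?c u ?z - ?c v ?z)\<^sup>2 \<le> kdist2 ?c u v * ?c ?z ?z"
    by (rule psd_kernel_cauchy_schwarz_diff[OF psd_cond_cov[OF pd s]])
  also have "\<dots> \<le> kdist2 k u v * 1"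
  proof (rule mult_mono)
    show "?c ?z ?z \<le> 1" using cond_cov_le_prior[OF pd s, of x n ?z] k1[of ?z] by linarith
    show "0 \<le> kdist2 k u v" by (rule kdist2_nonneg[OF pd])
  qed (use kdist2_cond_cov_le[OF pd s] cond_cov_nonneg[OF pd s] in auto)
  finally have "\<bar>?c u ?z - ?c v ?z\<bar> \<le> sqrt (kdist2 k u v)"
    by (metis mult.right_neutral real_sqrt_abs real_sqrt_le_iff)
  moreover have "s\<^sup>2 \<le> s\<^sup>2 + ?c ?z ?z" using cond_cov_nonneg[OF pd s] by simp
  ultimately have "\<bar>?c u ?z - ?c v ?z\<bar> * \<bar>r\<bar> / (s\<^sup>2 + ?c ?z ?z) \<le> sqrt (kdist2 k u v) * \<bar>r\<bar> / s\<^sup>2"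
    using s kdist2_nonneg[OF pd, of u v] by (intro frac_le mult_right_mono) auto
  moreover have "cond_mean k s x y (Suc n) u - cond_mean k s x y (Suc n) v =
      (?m u - ?m v) + (?c u ?z - ?c v ?z) * r / (s\<^sup>2 + ?c ?z ?z)"
    by (simp add: r_def left_diff_distrib diff_divide_distrib)
  moreover have "\<bar>(?c u ?z - ?c v ?z) * r / (s\<^sup>2 + ?c ?z ?z)\<bar> = \<bar>?c u ?z - ?c v ?z\<bar> * \<bar>r\<bar> / (s\<^sup>2 + ?c ?z ?z)"
    using cond_cov_denom_pos[OF pd s, of x n ?z] by (simp add: abs_mult)
  ultimately have "\<bar>cond_mean k s x y (Suc n) u - cond_mean k s x y (Suc n) v\<bar> \<le>
      \<bar>?m u - ?m v\<bar> + sqrt (kdist2 k u v) * \<bar>r\<bar> / s\<^sup>2"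
    by linarith
  also have "\<dots> \<le> sqrt (kdist2 k u v) * ((\<Sum>i=1..n. \<bar>y i - cond_mean k s x y (i - 1) (x i)\<bar>) / s\<^sup>2) + sqrt (kdist2 k u v) * \<bar>r\<bar> / s\<^sup>2"
    using Suc by simp
  also have "\<dots> = sqrt (kdist2 k u v) * ((\<Sum>i=1..Suc n. \<bar>y i - cond_mean k s x y (i - 1) (x i)\<bar>) / s\<^sup>2)"
    by (simp only: sum_upto_Suc diff_Suc_1 r_def) (simp add: add_divide_distrib distrib_left)
  finally show ?case .
qed

lemma cond_mean_bounded:
  assumes pd: "psd_kernel k" and s: "s > 0" and k1: "\<And>u. k u u \<le> 1"
  shows "\<exists>B. \<forall>u. \<bar>cond_mean k s x y n u\<bar> \<le> B"
proof (induction n)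
  case 0
  show ?case by auto
next
  case (Suc n)
  then obtain B where B: "\<And>u. \<bar>cond_mean k s x y n u\<bar> \<le> B" by blast
  let ?r = "\<bar>y (Suc n) - cond_mean k s x y n (x (Suc n))\<bar> / s\<^sup>2"
  have w: "sqrt (cond_cov k s x n u u) \<le> 1" for u
    using cond_cov_le_prior[OF pd s, of x n u] k1[of u] by simp
  have "\<bar>cond_mean k s x y (Suc n) u\<bar> \<le> B + ?r" for u
  proof -
    have "sqrt (cond_cov k s x n u u) * sqrt (cond_cov k s x n (x (Suc n)) (x (Suc n))) *
        \<bar>y (Suc n) - cond_mean k s x y n (x (Suc n))\<bar> / s\<^sup>2 \<le> 1 * 1 * \<bar>y (Suc n) - cond_mean k s x y n (x (Suc n))\<bar> / s\<^sup>2"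
      using w cond_cov_nonneg[OF pd s] by (intro divide_right_mono mult_right_mono mult_mono) auto
    then show ?thesis
      using cond_mean_step_bound[OF pd s, of x y n u] B[of u] by linarith
  qed
  then show ?case by blast
qed

lemma se_kernel_diag [simp]: "se_kernel l u u = 1"
  by (simp add: se_kernel_def)

lemma kdist2_se_kernel:
  assumes "l > 0"
  shows "sqrt (kdist2 (se_kernel l) u v) \<le> norm (u - v) / l"
proof -
  have "1 - exp (- 1 / (2 * l\<^sup>2) * (norm (u - v))\<^sup>2) \<le> 1 / (2 * l\<^sup>2) * (norm (u - v))\<^sup>2"
    using exp_ge_add_one_self[of "- 1 / (2 * l\<^sup>2) * (norm (u - v))\<^sup>2"] by simp
  then have "kdist2 (se_kernel l) u v \<le> (norm (u - v) / l)\<^sup>2"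
    by (simp add: kdist2_def) (simp add: se_kernel_def power_divide)
  then have "sqrt (kdist2 (se_kernel l) u v) \<le> sqrt ((norm (u - v) / l)\<^sup>2)" by (rule real_sqrt_le_mono)
  then show ?thesis using assms by simp
qed

text \<open>The Lipschitz constant of the posterior mean is a sum of earlier prediction errors. These are bounded by the confidence
bounds of the earlier rounds at the queries and by the noise, so the extension from the net to the domain
is an induction over the rounds. The mesh is chosen so that the error of the extension is at most \<open>\<kappa>\<close>.\<close>

lemma confidence_from_net:
  fixes x :: "nat \<Rightarrow> real ^ 'd"
  assumes l: "l > 0" and s: "s > 0"
    and xD: "\<And>n. n \<ge> 1 \<Longrightarrow> x n \<in> D" and y: "\<And>n. n \<ge> 1 \<Longrightarrow> y n = f (x n) + e n"
    and noise: "\<And>n. n \<ge> 1 \<Longrightarrow> \<bar>e n\<bar> \<le> s * b n"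
    and lip: "\<And>p q. p \<in> D \<Longrightarrow> q \<in> D \<Longrightarrow> \<bar>f p - f q\<bar> \<le> A * norm (p - q)" and A: "A \<ge> 0"
    and net: "\<And>n p. n \<ge> 1 \<Longrightarrow> p \<in> D \<Longrightarrow> \<exists>z\<in>Z n. norm (p - z) \<le> h n" and ZD: "\<And>n. Z n \<subseteq> D"
    and conf: "\<And>n z. n \<ge> 1 \<Longrightarrow> z \<in> Z n \<Longrightarrow>
        \<bar>f z - cond_mean (se_kernel l) s x y (n - 1) z\<bar> \<le> b n * sqrt (cond_cov (se_kernel l) s x (n - 1) z z)"
    and b: "\<And>n. b n \<ge> 0"
    and mesh: "\<And>n. n \<ge> 1 \<Longrightarrow> h n * (A + (\<Sum>i=1..<n. b i + \<kappa> + s * b i) / (l * s\<^sup>2) + b n / l) \<le> \<kappa>"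
    and n: "n \<ge> 1" and p: "p \<in> D"
  shows "\<bar>f p - cond_mean (se_kernel l) s x y (n - 1) p\<bar>
      \<le> b n * sqrt (cond_cov (se_kernel l) s x (n - 1) p p) + \<kappa>"
  using n p
proof (induction n arbitrary: p rule: less_induct)
  case (less n)
  let ?k = "se_kernel l :: real ^ 'd \<Rightarrow> _"
  note pd = psd_se_kernel[OF l]
  let ?m = "cond_mean ?k s x y" and ?c = "cond_cov ?k s x"
  obtain z where z: "z \<in> Z n" "norm (p - z) \<le> h n" using net[OF less.prems] by blast
  have zD: "z \<in> D" using z ZD by blast
  have resid: "\<bar>y i - ?m (i - 1) (x i)\<bar> \<le> b i + \<kappa> + s * b i" if "i \<in> {1..<n}" for i
  proof -
    have i: "i < n" "i \<ge> 1" using that by auto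
    have "\<bar>f (x i) - ?m (i - 1) (x i)\<bar> \<le> b i * sqrt (?c (i - 1) (x i) (x i)) + \<kappa>"
      by (rule less.IH[OF i(1,2) xD[OF i(2)]])
    also have "b i * sqrt (?c (i - 1) (x i) (x i)) \<le> b i * 1"
      using b[of i] cond_cov_le_prior[OF pd s, of x "i - 1" "x i"] by (intro mult_left_mono) auto
    finally show ?thesis using noise[OF i(2)] y[OF i(2)] by linarith
  qed
  define S where "S = (\<Sum>i=1..<n. b i + \<kappa> + s * b i)"
  have "{1..n - 1} = {1..<n}" using less.prems by auto
  then have "(\<Sum>i=1..n - 1. \<bar>y i - ?m (i - 1) (x i)\<bar>) \<le> S"
    unfolding S_def using resid by (auto intro: sum_mono)
  moreover have "0 \<le> (\<Sum>i=1..n - 1. \<bar>y i - ?m (i - 1) (x i)\<bar>)" by (intro sum_nonneg) auto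
  ultimately have S: "0 \<le> S" "(\<Sum>i=1..n - 1. \<bar>y i - ?m (i - 1) (x i)\<bar>) / s\<^sup>2 \<le> S / s\<^sup>2"
    by (linarith, intro divide_right_mono) simp_all
  define r where "r = norm (p - z)"
  have d: "sqrt (kdist2 ?k p z) \<le> r / l" unfolding r_def by (rule kdist2_se_kernel[OF l])
  have r0: "0 \<le> r" by (simp add: r_def)
  have "\<bar>?m (n - 1) p - ?m (n - 1) z\<bar> \<le> sqrt (kdist2 ?k p z) * ((\<Sum>i=1..n - 1. \<bar>y i - ?m (i - 1) (x i)\<bar>) / s\<^sup>2)"
    by (rule cond_mean_lipschitz[OF pd s]) simp
  also have "\<dots> \<le> r / l * (S / s\<^sup>2)"
    using d S(2) r0 l by (intro mult_mono) (auto intro!: divide_nonneg_nonneg sum_nonneg)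
  finally have 1: "\<bar>?m (n - 1) p - ?m (n - 1) z\<bar> \<le> r * (S / (l * s\<^sup>2))" by simp
  have "\<bar>sqrt (?c (n - 1) z z) - sqrt (?c (n - 1) p p)\<bar> \<le> sqrt (kdist2 (?c (n - 1)) z p)"
    by (rule sqrt_diag_lipschitz[OF psd_cond_cov[OF pd s]])
  also have "\<dots> \<le> sqrt (kdist2 ?k z p)" by (rule real_sqrt_le_mono[OF kdist2_cond_cov_le[OF pd s]])
  also have "\<dots> \<le> r / l" using kdist2_se_kernel[OF l, of z p] by (simp add: r_def norm_minus_commute)
  finally have "sqrt (?c (n - 1) z z) \<le> sqrt (?c (n - 1) p p) + r / l" by linarith
  then have 2: "b n * sqrt (?c (n - 1) z z) \<le> b n * sqrt (?c (n - 1) p p) + r * (b n / l)"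
    using mult_left_mono[OF _ b[of n]] by (fastforce simp: distrib_left mult.commute)
  have 3: "\<bar>f p - f z\<bar> \<le> r * A" using lip[OF less.prems(2) zD] by (simp add: r_def mult.commute)
  have "r * (A + S / (l * s\<^sup>2) + b n / l) \<le> h n * (A + S / (l * s\<^sup>2) + b n / l)"
    using z(2) A S(1) b[of n] l by (intro mult_right_mono) (auto simp: r_def intro!: add_nonneg_nonneg)
  then have "r * (A + S / (l * s\<^sup>2) + b n / l) \<le> \<kappa>" using mesh[OF less.prems(1)] unfolding S_def by linarith
  then have "r * A + r * (S / (l * s\<^sup>2)) + r * (b n / l) \<le> \<kappa>" by (simp only: distrib_left)
  with 1 2 3 conf[OF less.prems(1) z(1)] show ?case by linarith
qed

section \<open>Regret of a run with valid confidence bounds\<close>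

text \<open>The stronger claim with the additional summand \<open>\<eta> * e T\<close> on the left is inductive.\<close>

lemma contraction_sum:
  fixes e S :: "nat \<Rightarrow> real"
  assumes "0 \<le> \<eta>" "\<eta> \<le> 1" and e1: "e 1 \<le> M" and step: "\<And>n. n \<ge> 1 \<Longrightarrow> e (Suc n) \<le> \<eta> * (e n + 2 * S n)"
    and S: "\<And>n. S n \<ge> 0" and T: "T \<ge> 1" and e: "\<And>n. n \<ge> 1 \<Longrightarrow> e n \<ge> 0"
  shows "(1 - \<eta>) * (\<Sum>n=1..T. e n) \<le> M + 2 * (\<Sum>n=1..T. S n)"
proof -
  have "(1 - \<eta>) * (\<Sum>n=1..T. e n) + \<eta> * e T \<le> M + 2 * (\<Sum>n=1..<T. S n)"
    using T
  proof (induction T rule: dec_induct)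
    case base
    show ?case using e1 by (simp add: algebra_simps)
  next
    case (step T)
    have "(1 - \<eta>) * (\<Sum>n=1..Suc T. e n) + \<eta> * e (Suc T) = (1 - \<eta>) * (\<Sum>n=1..T. e n) + e (Suc T)"
      by (simp add: algebra_simps)
    also have "\<dots> \<le> (1 - \<eta>) * (\<Sum>n=1..T. e n) + \<eta> * e T + \<eta> * (2 * S T)"
      using assms(4)[of T] step.hyps by (simp add: distrib_left)
    also have "\<eta> * (2 * S T) \<le> 1 * (2 * S T)"
      using assms(1,2) S[of T] by (intro mult_right_mono) auto
    finally show ?case using step by simp
  qed
  moreover have "0 \<le> \<eta> * e T" using assms(1) e[OF T] by simp
  moreover have "(\<Sum>n=1..<T. S n) \<le> (\<Sum>n=1..T. S n)"
    using S by (intro sum_mono2) auto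
  ultimately show ?thesis by linarith
qed

text \<open>Here \<open>sb n\<close> is the factor of the exploration bonus and \<open>b n\<close> the confidence width, which differ by at most \<open>C2\<close>. Between
rounds \<open>n\<close> and \<open>n + 1\<close> the acquisition function moves by at most \<open>S n\<close>: the bounded drift of \<open>V\<close>, the change of the factor, and the
effect of the last observation on mean and deviation, both proportional to the deviation \<open>w n\<close> at the query. Only
products of \<open>w n\<close> with slowly growing factors occur, and \<open>2xy \<le> 1 + x\<^sup>2y\<^sup>2\<close> leaves the summable squares.\<close>

lemma regret_bound:
  fixes k :: "'a \<Rightarrow> 'a \<Rightarrow> real" and V :: "nat \<Rightarrow> 'a \<Rightarrow> real"
  assumes pd: "psd_kernel k" and k1: "\<And>u. k u u \<le> 1" and s: "s > 0"
    and xD: "\<And>n. x n \<in> D" and y: "\<And>n. n \<ge> 1 \<Longrightarrow> y n = f (x n) + e n"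
    and noise: "\<And>n. n \<ge> 1 \<Longrightarrow> \<bar>e n\<bar> \<le> s * b n"
    and V_bdd: "\<And>n. n \<ge> 1 \<Longrightarrow> \<exists>B. \<forall>p\<in>D. V n p \<le> B" and f_bdd: "\<exists>B. \<forall>p\<in>D. f p \<le> B"
    and drift: "\<And>n p. n \<ge> 1 \<Longrightarrow> p \<in> D \<Longrightarrow> \<bar>V (Suc n) p - V n p\<bar> \<le> \<Delta>"
    and conf: "\<And>n p. n \<ge> 1 \<Longrightarrow> p \<in> D \<Longrightarrow>
        \<bar>f p - cond_mean k s x y (n - 1) p\<bar> \<le> b n * sqrt (cond_cov k s x (n - 1) p p) + \<kappa>"
    and b: "\<And>n. b n \<ge> 0" and b_mono: "\<And>i j. 1 \<le> i \<Longrightarrow> i \<le> j \<Longrightarrow> b i \<le> b j"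
    and sb: "\<And>n. n \<ge> 1 \<Longrightarrow> \<bar>sb n\<bar> \<le> b n + C2" "\<And>n. n \<ge> 1 \<Longrightarrow> b n \<le> sb n + C2"
      "\<And>n. n \<ge> 1 \<Longrightarrow> \<bar>sb (Suc n) - sb n\<bar> \<le> C3"
    and C2: "C2 \<ge> 0" and \<kappa>: "\<kappa> \<ge> 0"
    and \<phi>: "\<And>n p. \<phi> n p = V n p + (cond_mean k s x y (n - 1) p + sb n * sqrt (cond_cov k s x (n - 1) p p))"
    and opt: "\<And>n. n \<ge> 1 \<Longrightarrow> (SUP p\<in>D. \<phi> n p) - \<phi> n (x n) \<le> \<eta> * ((SUP p\<in>D. \<phi> n p) - \<phi> n (x (n - 1)))"
    and \<eta>: "\<eta> < 1" and M: "(SUP p\<in>D. \<phi> 1 p) - \<phi> 1 (x 0) \<le> M"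
    and G: "(\<Sum>i=1..T. cond_cov k s x (i - 1) (x i) (x i)) \<le> G"
    and T: "T \<ge> 1"
  defines "q \<equiv> ((1 + s) * b T + \<kappa> + (b T + C2)) / s\<^sup>2"
  shows "0 \<le> cum_regret D (\<lambda>n p. V n p + f p) x T"
    and "cum_regret D (\<lambda>n p. V n p + f p) x T \<le>
      (M + 2 * (real T * (\<Delta> + C3 + 1) + q\<^sup>2 * G)) / (1 - max 0 \<eta>) +
      real T * (C2 + 2 * \<kappa> + 1) + (b T + C2)\<^sup>2 * G"
proof -
  let ?m = "cond_mean k s x y" and ?c = "cond_cov k s x"
  define w where "w = (\<lambda>n. sqrt (?c (n - 1) (x n) (x n)))"
  define qq where "qq = (\<lambda>n. ((1 + s) * b n + \<kappa> + (b n + C2)) / s\<^sup>2)"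
  define \<eta>' where "\<eta>' = max 0 \<eta>"
  have \<eta>': "0 \<le> \<eta>'" "\<eta>' < 1" using \<eta> by (auto simp: \<eta>'_def)
  have sq: "0 \<le> sqrt (?c n p p)" "sqrt (?c n p p) \<le> 1" for n p
    using cond_cov_nonneg[OF pd s] cond_cov_le_prior[OF pd s, of x n p] k1[of p] by simp_all
  have w: "0 \<le> w n" "w n \<le> 1" "(w n)\<^sup>2 = ?c (n - 1) (x n) (x n)" for n
    using sq cond_cov_nonneg[OF pd s] by (simp_all add: w_def)
  have w2: "(w n)\<^sup>2 \<le> w n" for n
    using mult_left_mono[OF w(2) w(1), of n n] by (simp add: power2_eq_square)
  have w2_nonneg: "0 \<le> (w n)\<^sup>2" for n by simp
  have D: "D \<noteq> {}" using xD by blast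
  have \<phi>_bdd: "bdd_above (\<phi> n ` D)" if n: "n \<ge> 1" for n
  proof -
    obtain B where B: "\<And>p. p \<in> D \<Longrightarrow> V n p \<le> B" using V_bdd[OF n] by blast
    obtain B' where B': "\<And>p. \<bar>?m (n - 1) p\<bar> \<le> B'" using cond_mean_bounded[OF pd s k1] by blast
    have "\<phi> n p \<le> B + (B' + \<bar>sb n\<bar>)" if "p \<in> D" for p
    proof -
      have "sb n * sqrt (?c (n - 1) p p) \<le> \<bar>sb n\<bar> * 1"
        using sq[of "n - 1" p] by (intro mult_mono) auto
      then show ?thesis using B[OF that] B'[of p] unfolding \<phi> by linarith
    qed
    then show ?thesis by (intro bdd_aboveI2)
  qed
  have up: "\<phi> n p \<le> (SUP p\<in>D. \<phi> n p)" if "n \<ge> 1" "p \<in> D" for n p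
    by (rule cSUP_upper[OF that(2) \<phi>_bdd[OF that(1)]])
  define er where "er = (\<lambda>n. (SUP p\<in>D. \<phi> n p) - \<phi> n (x n))"
  have er_nonneg: "0 \<le> er n" if "n \<ge> 1" for n
    using up[OF that xD] by (simp add: er_def)
  have er_le: "er n \<le> \<eta>' * ((SUP p\<in>D. \<phi> n p) - \<phi> n (x (n - 1)))" if "n \<ge> 1" for n
  proof -
    have "0 \<le> (SUP p\<in>D. \<phi> n p) - \<phi> n (x (n - 1))" using up[OF that xD, of "n - 1"] by simp
    then have "\<eta> * ((SUP p\<in>D. \<phi> n p) - \<phi> n (x (n - 1))) \<le> \<eta>' * ((SUP p\<in>D. \<phi> n p) - \<phi> n (x (n - 1)))"
      by (intro mult_right_mono) (simp_all add: \<eta>'_def)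
    with opt[OF that] show ?thesis by (simp add: er_def)
  qed
  define S where "S = (\<lambda>n. \<Delta> + C3 + 1 + (qq n)\<^sup>2 * (w n)\<^sup>2)"
  have step: "\<bar>\<phi> (Suc n) p - \<phi> n p\<bar> \<le> S n" if n: "n \<ge> 1" and p: "p \<in> D" for n p
  proof -
    obtain j where j: "n = Suc j" using n by (cases n) auto
    have r: "\<bar>y n - ?m j (x n)\<bar> \<le> (1 + s) * b n + \<kappa>"
    proof -
      have "b n * sqrt (?c j (x n) (x n)) \<le> b n * 1" using sq b by (intro mult_left_mono) auto
      then show ?thesis
        using conf[OF n xD, of n] noise[OF n] y[OF n] unfolding j by (simp add: distrib_right)
    qed
    have "\<bar>?m n p - ?m j p\<bar> \<le> sqrt (?c j p p) * sqrt (?c j (x n) (x n)) * \<bar>y n - ?m j (x n)\<bar> / s\<^sup>2"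
      using cond_mean_step_bound[OF pd s, of x y j p] unfolding j .
    also have "\<dots> \<le> 1 * w n * ((1 + s) * b n + \<kappa>) / s\<^sup>2"
      using sq r b[of n] s \<kappa> by (intro divide_right_mono mult_mono) (auto simp: w_def j)
    finally have 1: "\<bar>?m n p - ?m j p\<bar> \<le> w n * (((1 + s) * b n + \<kappa>) / s\<^sup>2)" by simp
    have dec: "0 \<le> sqrt (?c j p p) - sqrt (?c n p p)"
      using cond_cov_Suc_le[OF pd s, of x j p] unfolding j by (simp del: cond_cov.simps)
    have "sqrt (?c j p p) - sqrt (?c n p p) \<le> sqrt (?c j p p) * ?c j (x n) (x n) / s\<^sup>2"
      using sqrt_cond_cov_decrement[OF pd s, of x j p] unfolding j .
    also have "\<dots> \<le> 1 * (w n)\<^sup>2 / s\<^sup>2"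
      using sq w(3)[of n] cond_cov_nonneg[OF pd s] by (intro divide_right_mono mult_mono) (auto simp: j)
    also have "\<dots> \<le> w n / s\<^sup>2" using w2[of n] by (simp add: divide_right_mono)
    finally have dec2: "sqrt (?c j p p) - sqrt (?c n p p) \<le> w n / s\<^sup>2" .
    have "\<bar>sb (Suc n) * sqrt (?c n p p) - sb n * sqrt (?c j p p)\<bar>
        = \<bar>(sb (Suc n) - sb n) * sqrt (?c n p p) - sb n * (sqrt (?c j p p) - sqrt (?c n p p))\<bar>"
      by (simp add: algebra_simps)
    also have "\<dots> \<le> \<bar>sb (Suc n) - sb n\<bar> * sqrt (?c n p p) + \<bar>sb n\<bar> * (sqrt (?c j p p) - sqrt (?c n p p))"
      using abs_triangle_ineq4[of "(sb (Suc n) - sb n) * sqrt (?c n p p)" "sb n * (sqrt (?c j p p) - sqrt (?c n p p))"]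
        sq(1)[of n p] dec by (simp add: abs_mult)
    also have "\<dots> \<le> C3 * 1 + (b n + C2) * (w n / s\<^sup>2)"
    proof (intro add_mono mult_mono)
      show "0 \<le> C3" using sb(3)[OF n] by linarith
      show "0 \<le> b n + C2" using b[of n] C2 by linarith
    qed (use sq sb(1,3)[OF n] dec dec2 in auto)
    finally have 2: "\<bar>sb (Suc n) * sqrt (?c n p p) - sb n * sqrt (?c j p p)\<bar> \<le> C3 + w n * ((b n + C2) / s\<^sup>2)"
      by (simp add: mult.commute)
    have "w n * (((1 + s) * b n + \<kappa>) / s\<^sup>2) + w n * ((b n + C2) / s\<^sup>2) = w n * qq n"
      by (simp add: qq_def add_divide_distrib distrib_left)
    moreover have "w n * qq n \<le> 1 + (qq n)\<^sup>2 * (w n)\<^sup>2"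
    proof -
      have "0 \<le> (w n * qq n - 1)\<^sup>2" by simp
      then have "2 * (w n * qq n) \<le> 1 + (qq n)\<^sup>2 * (w n)\<^sup>2"
        by (simp add: power2_diff power_mult_distrib mult.commute)
      moreover have "0 \<le> (qq n)\<^sup>2 * (w n)\<^sup>2" by simp
      ultimately show ?thesis by linarith
    qed
    moreover have "n - 1 = j" "Suc n - 1 = n" using j by simp_all
    ultimately show ?thesis
      using 1 2 drift[OF n p] unfolding S_def \<phi> by (simp only:)
  qed
  have S_nonneg: "0 \<le> S n" for n
  proof -
    have "0 \<le> \<Delta>" "0 \<le> C3" using drift[OF le_refl xD, of 0] sb(3)[of 1] by auto
    then show ?thesis by (simp add: S_def)
  qed
  have er_step: "er (Suc n) \<le> \<eta>' * (er n + 2 * S n)" if n: "n \<ge> 1" for n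
  proof -
    have "(SUP p\<in>D. \<phi> (Suc n) p) \<le> (SUP p\<in>D. \<phi> n p) + S n"
    proof (rule cSUP_least[OF D])
      fix p assume "p \<in> D"
      then show "\<phi> (Suc n) p \<le> (SUP p\<in>D. \<phi> n p) + S n" using step[OF n] up[OF n] by fastforce
    qed
    moreover have "\<phi> n (x n) - S n \<le> \<phi> (Suc n) (x n)" using step[OF n xD[of n]] by linarith
    ultimately have "(SUP p\<in>D. \<phi> (Suc n) p) - \<phi> (Suc n) (x n) \<le> er n + 2 * S n"
      unfolding er_def by linarith
    then have "\<eta>' * ((SUP p\<in>D. \<phi> (Suc n) p) - \<phi> (Suc n) (x n)) \<le> \<eta>' * (er n + 2 * S n)"
      using \<eta>' by (intro mult_left_mono) auto
    with er_le[of "Suc n"] show ?thesis by simp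
  qed
  have "er 1 \<le> \<eta>' * ((SUP p\<in>D. \<phi> 1 p) - \<phi> 1 (x 0))" using er_le[of 1] by simp
  also have "\<dots> \<le> 1 * ((SUP p\<in>D. \<phi> 1 p) - \<phi> 1 (x 0))"
    using \<eta>' up[OF le_refl xD, of 0] by (intro mult_right_mono) auto
  finally have er1: "er 1 \<le> M" using M by simp
  have sum_w: "(\<Sum>n=1..T. (w n)\<^sup>2) \<le> G" using G w(3) by simp
  have b_T: "0 \<le> b n" "b n \<le> b T" if "n \<in> {1..T}" for n
    using b b_mono[of n T] that by auto
  have qq_T: "(qq n)\<^sup>2 \<le> q\<^sup>2" if "n \<in> {1..T}" for n
  proof (rule power_mono)
    show "qq n \<le> q" unfolding qq_def q_def
      using b_T[OF that] s by (intro divide_right_mono add_mono mult_left_mono) auto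
    show "0 \<le> qq n" unfolding qq_def using b[of n] \<kappa> C2 s
      by (intro divide_nonneg_nonneg add_nonneg_nonneg mult_nonneg_nonneg) auto
  qed
  have "(\<Sum>n=1..T. S n) \<le> (\<Sum>n=1..T. \<Delta> + C3 + 1 + q\<^sup>2 * (w n)\<^sup>2)"
    unfolding S_def using qq_T by (intro sum_mono add_left_mono mult_right_mono) auto
  also have "\<dots> = real T * (\<Delta> + C3 + 1) + q\<^sup>2 * (\<Sum>n=1..T. (w n)\<^sup>2)"
    by (simp add: sum.distrib sum_distrib_left)
  also have "\<dots> \<le> real T * (\<Delta> + C3 + 1) + q\<^sup>2 * G"
    using sum_w by (intro add_left_mono mult_left_mono) auto
  finally have sum_S: "(\<Sum>n=1..T. S n) \<le> real T * (\<Delta> + C3 + 1) + q\<^sup>2 * G" .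
  have "(1 - \<eta>') * (\<Sum>n=1..T. er n) \<le> M + 2 * (\<Sum>n=1..T. S n)"
    using \<eta>' by (intro contraction_sum er1 er_step S_nonneg T er_nonneg) auto
  also have "\<dots> \<le> M + 2 * (real T * (\<Delta> + C3 + 1) + q\<^sup>2 * G)" using sum_S by simp
  finally have sum_er: "(\<Sum>n=1..T. er n) \<le> (M + 2 * (real T * (\<Delta> + C3 + 1) + q\<^sup>2 * G)) / (1 - \<eta>')"
    using \<eta>' by (simp add: pos_le_divide_eq mult.commute)
  have reg: "0 \<le> (SUP p\<in>D. V n p + f p) - (V n (x n) + f (x n))"
    "(SUP p\<in>D. V n p + f p) - (V n (x n) + f (x n)) \<le> er n + (C2 + 2 * \<kappa> + 1) + (b T + C2)\<^sup>2 * (w n)\<^sup>2"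
    if "n \<in> {1..T}" for n
  proof -
    have n: "n \<ge> 1" using that by simp
    obtain B B' where "\<And>p. p \<in> D \<Longrightarrow> V n p \<le> B" "\<And>p. p \<in> D \<Longrightarrow> f p \<le> B'"
      using V_bdd[OF n] f_bdd by blast
    then have "V n p + f p \<le> B + B'" if "p \<in> D" for p using that by (simp add: add_mono)
    then have "bdd_above ((\<lambda>p. V n p + f p) ` D)" by (intro bdd_aboveI2)
    from cSUP_upper[OF xD[of n] this] show "0 \<le> (SUP p\<in>D. V n p + f p) - (V n (x n) + f (x n))" by simp
    have "(SUP p\<in>D. V n p + f p) \<le> (SUP p\<in>D. \<phi> n p) + (C2 + \<kappa>)"
    proof (rule cSUP_least[OF D])
      fix p assume p: "p \<in> D"
      have "(b n - sb n) * sqrt (?c (n - 1) p p) \<le> C2 * 1"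
        using sq[of "n - 1" p] sb(2)[OF n] C2 by (intro mult_mono) auto
      then have "b n * sqrt (?c (n - 1) p p) \<le> sb n * sqrt (?c (n - 1) p p) + C2"
        by (simp add: left_diff_distrib)
      then show "V n p + f p \<le> (SUP p\<in>D. \<phi> n p) + (C2 + \<kappa>)"
        using conf[OF n p] up[OF n p] unfolding \<phi> by linarith
    qed
    moreover have "\<phi> n (x n) \<le> V n (x n) + f (x n) + \<kappa> + (1 + (b T + C2)\<^sup>2 * (w n)\<^sup>2)"
    proof -
      have "b n * w n + sb n * w n \<le> 2 * ((b T + C2) * w n)"
      proof -
        have "b n * w n \<le> (b T + C2) * w n" "sb n * w n \<le> (b T + C2) * w n"
          using w(1)[of n] b_T[OF that] C2 sb(1)[OF n] by (auto intro!: mult_right_mono)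
        then show ?thesis by linarith
      qed
      also have "\<dots> \<le> 1 + (b T + C2)\<^sup>2 * (w n)\<^sup>2"
      proof -
        have "0 \<le> ((b T + C2) * w n - 1)\<^sup>2" by simp
        then show ?thesis by (simp add: power2_diff power_mult_distrib)
      qed
      finally show ?thesis
        using conf[OF n xD[of n]] unfolding \<phi> w_def by linarith
    qed
    ultimately show "(SUP p\<in>D. V n p + f p) - (V n (x n) + f (x n)) \<le> er n + (C2 + 2 * \<kappa> + 1) + (b T + C2)\<^sup>2 * (w n)\<^sup>2"
      unfolding er_def by linarith
  qed
  show "0 \<le> cum_regret D (\<lambda>n p. V n p + f p) x T"
    unfolding cum_regret_def by (intro sum_nonneg reg(1))
  have "cum_regret D (\<lambda>n p. V n p + f p) x T \<le>
      (\<Sum>n=1..T. er n + (C2 + 2 * \<kappa> + 1) + (b T + C2)\<^sup>2 * (w n)\<^sup>2)"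
    unfolding cum_regret_def by (intro sum_mono reg(2))
  also have "\<dots> = (\<Sum>n=1..T. er n) + real T * (C2 + 2 * \<kappa> + 1) + (b T + C2)\<^sup>2 * (\<Sum>n=1..T. (w n)\<^sup>2)"
    by (simp add: sum.distrib sum_distrib_left)
  also have "\<dots> \<le> (M + 2 * (real T * (\<Delta> + C3 + 1) + q\<^sup>2 * G)) / (1 - \<eta>') +
      real T * (C2 + 2 * \<kappa> + 1) + (b T + C2)\<^sup>2 * G"
    using sum_er sum_w by (intro add_mono mult_left_mono) auto
  finally show "cum_regret D (\<lambda>n p. V n p + f p) x T \<le>
      (M + 2 * (real T * (\<Delta> + C3 + 1) + q\<^sup>2 * G)) / (1 - max 0 \<eta>) +
      real T * (C2 + 2 * \<kappa> + 1) + (b T + C2)\<^sup>2 * G"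
    unfolding \<eta>'_def .
qed

section \<open>Nets, gradients and small balls\<close>

text \<open>One representative of the domain is taken from each nonempty cell of a cubic grid, so that the net lies in the domain.\<close>

lemma box_net:
  fixes D :: "(real ^ 'd) set"
  assumes r: "r \<ge> 0" and h: "h > 0" and D: "\<And>x j. x \<in> D \<Longrightarrow> 0 \<le> x $ j \<and> x $ j \<le> r"
  shows "\<exists>Z. finite Z \<and> Z \<subseteq> D \<and> (\<forall>p\<in>D. \<exists>z\<in>Z. norm (p - z) \<le> h) \<and>
     real (card Z) \<le> (r * real CARD('d) / h + 1) ^ CARD('d)"
proof -
  define m where "m = real CARD('d) / h"
  have m: "m > 0" using h by (simp add: m_def)
  define cell where "cell = (\<lambda>p :: real ^ 'd. \<lambda>j. nat \<lfloor>p $ j * m\<rfloor>)"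
  define N where "N = nat \<lfloor>r * m\<rfloor>"
  define Z where "Z = inv_into D cell ` cell ` D"
  have cells: "cell ` D \<subseteq> UNIV \<rightarrow>\<^sub>E {..N}"
    unfolding cell_def N_def using D m by (auto intro!: nat_mono floor_mono mult_right_mono)
  have fin: "finite (UNIV \<rightarrow>\<^sub>E {..N} :: ('d \<Rightarrow> nat) set)" by (simp add: finite_PiE)
  have "finite Z" unfolding Z_def using finite_subset[OF cells fin] by simp
  moreover have "Z \<subseteq> D" unfolding Z_def by (auto intro: inv_into_into)
  moreover have "\<exists>z\<in>Z. norm (p - z) \<le> h" if p: "p \<in> D" for p
  proof -
    define z where "z = inv_into D cell (cell p)"
    have z: "z \<in> Z" "z \<in> D" "cell z = cell p"
      using p by (auto simp: z_def Z_def intro: inv_into_into f_inv_into_f)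
    have "\<bar>(p - z) $ j\<bar> \<le> h / real CARD('d)" for j
    proof -
      have "nat \<lfloor>z $ j * m\<rfloor> = nat \<lfloor>p $ j * m\<rfloor>" using z(3) by (simp add: cell_def fun_eq_iff)
      moreover have "0 \<le> z $ j * m" "0 \<le> p $ j * m" using D[OF z(2)] D[OF p] m by auto
      then have "0 \<le> \<lfloor>z $ j * m\<rfloor>" "0 \<le> \<lfloor>p $ j * m\<rfloor>" by (simp_all only: zero_le_floor)
      ultimately have "\<lfloor>z $ j * m\<rfloor> = \<lfloor>p $ j * m\<rfloor>" by (simp only: eq_nat_nat_iff)
      then have "\<bar>p $ j * m - z $ j * m\<bar> \<le> 1" by linarith
      then have "\<bar>p $ j - z $ j\<bar> * m \<le> 1" using m by (simp add: abs_mult flip: left_diff_distrib)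
      then show ?thesis using h by (simp add: m_def field_simps)
    qed
    then have "(\<Sum>j\<in>UNIV. \<bar>(p - z) $ j\<bar>) \<le> (\<Sum>j\<in>(UNIV :: 'd set). h / real CARD('d))"
      by (intro sum_mono)
    also have "\<dots> = h" by simp
    finally have "norm (p - z) \<le> h" using norm_le_l1_cart[of "p - z"] by linarith
    with z show ?thesis by blast
  qed
  moreover have "real (card Z) \<le> (r * real CARD('d) / h + 1) ^ CARD('d)"
  proof -
    have "card Z \<le> card (cell ` D)" unfolding Z_def by (rule card_image_le[OF finite_subset[OF cells fin]])
    also have "\<dots> \<le> card (UNIV \<rightarrow>\<^sub>E {..N} :: ('d \<Rightarrow> nat) set)" by (rule card_mono[OF fin cells])
    also have "\<dots> = (N + 1) ^ CARD('d)" by (simp add: card_PiE)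
    finally have "real (card Z) \<le> (real N + 1) ^ CARD('d)"
      by (simp add: add.commute flip: of_nat_le_iff[where 'a = real])
    also have "\<dots> \<le> (r * m + 1) ^ CARD('d)"
      using r m unfolding N_def by (intro power_mono add_right_mono) (auto simp: mult_nonneg_nonneg less_imp_le)
    finally show ?thesis by (simp add: m_def)
  qed
  ultimately show ?thesis by blast
qed

text \<open>The square root is odd here, so its Hoelder estimate holds on the whole line, with the factor 2 for arguments of opposite sign.\<close>

lemma sqrt_diff_le: "\<bar>sqrt x - sqrt y\<bar> \<le> 2 * sqrt \<bar>x - y\<bar>"
proof -
  have *: "sqrt x - sqrt y \<le> 2 * sqrt (x - y)" if "y \<le> x" for x y :: real
  proof (cases "0 \<le> y")
    case True
    have "sqrt x \<le> sqrt y + sqrt (x - y)"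
      using sqrt_add_le_add_sqrt[of y "x - y"] True that by simp
    moreover have "0 \<le> sqrt (x - y)" using that by simp
    ultimately show ?thesis by linarith
  next
    case False
    show ?thesis
    proof (cases "0 \<le> x")
      case True
      have "sqrt x \<le> sqrt (x - y)" "sqrt (- y) \<le> sqrt (x - y)" using False True by auto
      then show ?thesis unfolding real_sqrt_minus by linarith
    next
      case x: False
      have "sqrt (- y) \<le> sqrt (- x) + sqrt (x - y)"
        using sqrt_add_le_add_sqrt[of "- x" "x - y"] x that by simp
      moreover have "0 \<le> sqrt (x - y)" using that by simp
      ultimately show ?thesis unfolding real_sqrt_minus by linarith
    qed
  qed
  have mono: "sqrt y \<le> sqrt x" if "y \<le> x" for x y :: real using that by simp
  show ?thesis
    using *[of x y] *[of y x] mono[of x y] mono[of y x] by (cases "x \<le> y") auto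
qed

lemma lipschitz_from_gradient:
  fixes f :: "real ^ 'd \<Rightarrow> real"
  assumes D: "convex D" and f: "\<And>x. x \<in> D \<Longrightarrow> (f has_derivative (\<lambda>h. g x \<bullet> h)) (at x within D)"
    and g: "\<And>x j. x \<in> D \<Longrightarrow> \<bar>g x $ j\<bar> \<le> c" and p: "p \<in> D" and q: "q \<in> D"
  shows "\<bar>f p - f q\<bar> \<le> real CARD('d) * c * norm (p - q)"
proof -
  have "onorm (\<lambda>h. g x \<bullet> h) \<le> real CARD('d) * c" if x: "x \<in> D" for x
  proof (rule onorm_bound)
    have "norm (g x) \<le> (\<Sum>j\<in>UNIV. \<bar>g x $ j\<bar>)" by (rule norm_le_l1_cart)
    also have "\<dots> \<le> (\<Sum>j\<in>(UNIV :: 'd set). c)" by (intro sum_mono g x)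
    finally have gx: "norm (g x) \<le> real CARD('d) * c" by simp
    then show "0 \<le> real CARD('d) * c" using norm_ge_zero[of "g x"] by linarith
    fix h
    have "norm (g x \<bullet> h) \<le> norm (g x) * norm h" using Cauchy_Schwarz_ineq2[of "g x" h] by simp
    also have "\<dots> \<le> real CARD('d) * c * norm h" using gx by (intro mult_right_mono) auto
    finally show "norm (g x \<bullet> h) \<le> real CARD('d) * c * norm h" .
  qed
  from differentiable_bound[OF D f this p q] show ?thesis by simp
qed

lemma normal_rv_small_ball:
  assumes P: "prob_space P" and Z: "normal_rv P Z" and var: "(\<integral>\<omega>. (Z \<omega>)\<^sup>2 \<partial>P) - (\<integral>\<omega>. Z \<omega> \<partial>P)\<^sup>2 \<noteq> 0"
  shows "\<exists>C. \<forall>t>0. measure P {\<omega>\<in>space P. \<bar>Z \<omega>\<bar> \<le> t} \<le> C * t"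
proof -
  interpret prob_space P by (rule P)
  from Z show ?thesis unfolding normal_rv_def
  proof (elim disjE exE conjE)
    fix m s :: real assume s: "s > 0" and D: "distributed P lborel Z (normal_density m s)"
    define C where "C = 1 / sqrt (2 * pi * s\<^sup>2)"
    have "measure P {\<omega>\<in>space P. \<bar>Z \<omega>\<bar> \<le> t} \<le> (C * 2) * t" if t: "t > 0" for t
    proof -
      have "emeasure P (Z -` {-t..t} \<inter> space P) = (\<integral>\<^sup>+x. ennreal (normal_density m s x) * indicator {-t..t} x \<partial>lborel)"
        by (rule distributed_emeasure[OF D]) simp
      also have "\<dots> \<le> (\<integral>\<^sup>+x. ennreal C * indicator {-t..t} x \<partial>lborel)"
        by (intro nn_integral_mono mult_right_mono ennreal_leI) (auto simp: C_def intro: normal_density_le)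
      also have "\<dots> = ennreal C * ennreal (2 * t)"
        using t by (simp add: nn_integral_cmult_indicator)
      also have "\<dots> = ennreal (C * 2 * t)"
        using t by (simp add: C_def ennreal_mult[symmetric])
      finally have "emeasure P {\<omega>\<in>space P. \<bar>Z \<omega>\<bar> \<le> t} \<le> ennreal (C * 2 * t)"
        by (simp add: vimage_def Int_def abs_le_iff conj_commute minus_le_iff)
      then show ?thesis
        using t by (simp add: emeasure_eq_measure C_def)
    qed
    then show ?thesis by blast
  next
    fix m assume [measurable]: "Z \<in> borel_measurable P" and m: "AE \<omega> in P. Z \<omega> = m"
    have "expectation Z = expectation (\<lambda>_. m)"
      by (rule integral_cong_AE) (use m in auto)
    moreover have "expectation (\<lambda>\<omega>. (Z \<omega>)\<^sup>2) = expectation (\<lambda>_. m\<^sup>2)"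
      by (rule integral_cong_AE) (use m in auto)
    ultimately show ?thesis using var by (simp add: prob_space)
  qed
qed

text \<open>Letting \<open>c\<close> tend to 0 in the tail bounds, the increment between \<open>p\<close> and \<open>q\<close> would be arbitrarily small with a fixed
positive probability if the constants added up to less than 1. A nondegenerate Gaussian increment has no atom.\<close>

lemma gradient_tail_constant_ge_1:
  fixes D :: "(real ^ 'd) set" and U :: "real ^ 'd \<Rightarrow> 'w \<Rightarrow> real"
  assumes P: "prob_space P" and gp: "gaussian_process P D (\<lambda>x. 0) k U" and D: "convex D"
    and p: "p \<in> D" and q: "q \<in> D" and pq: "kdist2 k p q \<noteq> 0" and sym: "k p q = k q p"
    and U_diff: "\<And>\<omega> x. \<omega> \<in> space P \<Longrightarrow> x \<in> D \<Longrightarrow>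
                   ((\<lambda>z. U z \<omega>) has_derivative (\<lambda>h. g \<omega> x \<bullet> h)) (at x within D)"
    and U_meas: "\<And>j c. c > 0 \<Longrightarrow> {\<omega> \<in> space P. (SUP x\<in>D. ereal \<bar>g \<omega> x $ j\<bar>) > ereal c} \<in> sets P"
    and U_tail: "\<And>j c. c > 0 \<Longrightarrow> measure P {\<omega> \<in> space P. (SUP x\<in>D. ereal \<bar>g \<omega> x $ j\<bar>) > ereal c} \<le> a"
  shows "1 \<le> real CARD('d) * a"
proof (rule ccontr)
  assume "\<not> 1 \<le> real CARD('d) * a"
  then have gap: "0 < 1 - real CARD('d) * a" by simp
  interpret prob_space P by (rule P)
  define Z where "Z = (\<lambda>\<omega>. U p \<omega> - U q \<omega>)"
  have "p \<noteq> q" using pq by (auto simp: kdist2_def)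
  have lin: "normal_rv P (\<lambda>\<omega>. \<Sum>x\<in>F. c x * U x \<omega>)" if "finite F" "F \<subseteq> D" for F c
    using gp that by (simp add: gaussian_process_def)
  have mean: "expectation (U u) = 0" if "u \<in> D" for u
    using gp that by (simp add: gaussian_process_def)
  have cov: "expectation (\<lambda>\<omega>. U u \<omega> * U v \<omega>) = k u v" if "u \<in> D" "v \<in> D" for u v
    using gp that by (simp add: gaussian_process_def)
  have Z: "normal_rv P Z"
    using lin[of "{p, q}" "\<lambda>x. if x = p then 1 else -1"] p q \<open>p \<noteq> q\<close> by (simp add: Z_def)
  have U_rv: "normal_rv P (U u)" if "u \<in> D" for u using lin[of "{u}" "\<lambda>_. 1"] that by simp
  have sum_rv: "normal_rv P (\<lambda>\<omega>. U p \<omega> + U q \<omega>)"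
    using lin[of "{p, q}" "\<lambda>_. 1"] p q \<open>p \<noteq> q\<close> by simp
  note int = normal_rv_char(1)[OF P U_rv[OF p]] normal_rv_char(1)[OF P U_rv[OF q]]
  note int2 = normal_rv_char(2)[OF P U_rv[OF p]] normal_rv_char(2)[OF P U_rv[OF q]]
  have int3: "integrable P (\<lambda>\<omega>. U p \<omega> * U q \<omega>)"
  proof -
    have "integrable P (\<lambda>\<omega>. ((U p \<omega> + U q \<omega>)\<^sup>2 - (U p \<omega>)\<^sup>2 - (U q \<omega>)\<^sup>2) / 2)"
      using int2 normal_rv_char(2)[OF P sum_rv] by simp
    then show ?thesis by (simp add: power2_sum)
  qed
  have E1: "expectation Z = 0" unfolding Z_def using int mean[OF p] mean[OF q] by simp
  have "expectation (\<lambda>\<omega>. (Z \<omega>)\<^sup>2) = expectation (\<lambda>\<omega>. (U p \<omega>)\<^sup>2 - 2 * (U p \<omega> * U q \<omega>) + (U q \<omega>)\<^sup>2)"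
    by (simp add: Z_def power2_diff algebra_simps)
  also have "\<dots> = kdist2 k p q"
    using int2 int3 cov[OF p p] cov[OF p q] cov[OF q q] by (simp add: kdist2_def power2_eq_square)
  finally have "expectation (\<lambda>\<omega>. (Z \<omega>)\<^sup>2) - (expectation Z)\<^sup>2 \<noteq> 0" using E1 pq by simp
  from normal_rv_small_ball[OF P Z this] obtain C where
    C: "\<And>t. t > 0 \<Longrightarrow> prob {\<omega>\<in>space P. \<bar>Z \<omega>\<bar> \<le> t} \<le> C * t" by blast
  have Z_meas [measurable]: "Z \<in> borel_measurable P" using normal_rv_char(1)[OF P Z] by simp
  define t where "t = (1 - real CARD('d) * a) / (2 * (\<bar>C\<bar> + 1))"
  have t: "t > 0" using gap by (simp add: t_def)
  define c where "c = t / (real CARD('d) * (norm (p - q) + 1))"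
  have c: "c > 0" using t by (simp add: c_def add_nonneg_pos)
  let ?B = "\<lambda>j. {\<omega> \<in> space P. (SUP x\<in>D. ereal \<bar>g \<omega> x $ j\<bar>) > ereal c}"
  have "space P - (\<Union>j\<in>UNIV. ?B j) \<subseteq> {\<omega>\<in>space P. \<bar>Z \<omega>\<bar> \<le> t}"
  proof
    fix \<omega> assume \<omega>: "\<omega> \<in> space P - (\<Union>j\<in>UNIV. ?B j)"
    have "\<bar>g \<omega> x $ j\<bar> \<le> c" if "x \<in> D" for x j
    proof -
      have "(SUP x\<in>D. ereal \<bar>g \<omega> x $ j\<bar>) \<le> ereal c" using \<omega> by (auto simp: not_less)
      moreover have "ereal \<bar>g \<omega> x $ j\<bar> \<le> (SUP x\<in>D. ereal \<bar>g \<omega> x $ j\<bar>)" by (rule SUP_upper[OF that])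
      ultimately have "ereal \<bar>g \<omega> x $ j\<bar> \<le> ereal c" by (rule order_trans[rotated])
      then show ?thesis by simp
    qed
    then have "\<bar>Z \<omega>\<bar> \<le> real CARD('d) * c * norm (p - q)"
      unfolding Z_def using \<omega> by (intro lipschitz_from_gradient[OF D U_diff _ p q]) auto
    also have "\<dots> \<le> t"
    proof -
      have "real CARD('d) * c * norm (p - q) = t * (norm (p - q) / (norm (p - q) + 1))"
        by (simp add: c_def)
      also have "\<dots> \<le> t * 1" using t by (intro mult_left_mono) (auto simp: divide_le_eq add_nonneg_pos)
      finally show ?thesis by simp
    qed
    finally show "\<omega> \<in> {\<omega>\<in>space P. \<bar>Z \<omega>\<bar> \<le> t}" using \<omega> by simp
  qed
  then have "prob (space P - (\<Union>j\<in>UNIV. ?B j)) \<le> prob {\<omega>\<in>space P. \<bar>Z \<omega>\<bar> \<le> t}"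
    by (intro finite_measure_mono) measurable
  also have "\<dots> \<le> C * t" by (rule C[OF t])
  also have "\<dots> \<le> (\<bar>C\<bar> + 1) * t" using t by (intro mult_right_mono) auto
  also have "\<dots> = (1 - real CARD('d) * a) / 2"
  proof -
    have "K * (v / (2 * K)) = v / 2" if "K > 0" for K v :: real using that by simp
    then show ?thesis unfolding t_def by (simp add: add_nonneg_pos del: mult_2 distrib_left_numeral)
  qed
  also have "\<dots> < 1 - real CARD('d) * a"
  proof -
    have "v / 2 < v" if "v > 0" for v :: real using that by simp
    from this[OF gap] show ?thesis .
  qed
  also have "\<dots> \<le> prob (space P - (\<Union>j\<in>UNIV. ?B j))"
  proof -
    have "prob (\<Union>j\<in>UNIV. ?B j) \<le> (\<Sum>j\<in>UNIV. prob (?B j))"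
      using U_meas[OF c] by (intro finite_measure_subadditive_finite) auto
    also have "\<dots> \<le> (\<Sum>j\<in>(UNIV :: 'd set). a)" by (intro sum_mono U_tail[OF c])
    finally have "prob (\<Union>j\<in>UNIV. ?B j) \<le> real CARD('d) * a" by simp
    moreover have "(\<Union>j\<in>UNIV. ?B j) \<in> events" using U_meas[OF c] by auto
    ultimately show ?thesis using prob_compl by simp
  qed
  finally show False by simp
qed

section \<open>The confidence event\<close>

text \<open>The growth is that of the square root of the exploration rate; the constant \<open>H\<close> makes the total failure probability small.\<close>

definition conf_width :: "nat \<Rightarrow> real \<Rightarrow> nat \<Rightarrow> real" where
  "conf_width d H n = sqrt ((4 + 4 * real d) * ln (real n) + H)"

lemma conf_width_arg_nonneg: "H \<ge> 0 \<Longrightarrow> 0 \<le> (4 + 4 * real d) * ln (real n) + H"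
  by (cases "n = 0") (auto intro!: add_nonneg_nonneg mult_nonneg_nonneg)

lemma conf_width_nonneg: "H \<ge> 0 \<Longrightarrow> 0 \<le> conf_width d H n"
  using conf_width_arg_nonneg[of H d n] by (simp add: conf_width_def)

lemma conf_width_mono: "1 \<le> i \<Longrightarrow> i \<le> j \<Longrightarrow> conf_width d H i \<le> conf_width d H j"
  unfolding conf_width_def by (intro real_sqrt_le_mono add_right_mono mult_left_mono) auto

lemma conf_width_linear:
  assumes H: "H \<ge> 0" and n: "n \<ge> 1"
  shows "conf_width d H n \<le> sqrt (4 + 4 * real d) * (1 + sqrt H) * real n"
proof -
  let ?c = "sqrt (4 + 4 * real d)"
  have c: "1 \<le> ?c" by simp
  have "ln (real n) \<le> real n" using n ln_le_minus_one[of "real n"] by simp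
  also have "\<dots> \<le> (real n)\<^sup>2" using n by (simp add: power2_eq_square)
  finally have ln: "ln (real n) \<le> (real n)\<^sup>2" .
  have "conf_width d H n \<le> sqrt ((4 + 4 * real d) * ln (real n)) + sqrt H"
    unfolding conf_width_def using n H by (intro sqrt_add_le_add_sqrt mult_nonneg_nonneg) auto
  also have "sqrt ((4 + 4 * real d) * ln (real n)) \<le> sqrt ((4 + 4 * real d) * (real n)\<^sup>2)"
    using ln by (intro real_sqrt_le_mono mult_left_mono) auto
  also have "\<dots> = ?c * real n" by (simp add: real_sqrt_mult)
  also have "sqrt H \<le> ?c * sqrt H * real n"
  proof -
    have "1 * sqrt H * 1 \<le> ?c * sqrt H * real n"
      using c n H by (intro mult_mono) auto
    then show ?thesis by simp
  qed
  finally show ?thesis by (simp add: algebra_simps)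
qed

text \<open>The failure probability of a single bound decays so fast that after a union over \<open>n\<^sup>2\<^sup>d\<close> net points the summable
\<open>n\<^sup>-\<^sup>2\<close> is left.\<close>

lemma exp_conf_width:
  assumes H: "H \<ge> 0" and n: "n \<ge> 1"
  shows "exp (- (conf_width d H n)\<^sup>2 / 2) * real n ^ (2 * d + 2) = exp (- H / 2)"
proof -
  have "(conf_width d H n)\<^sup>2 = (4 + 4 * real d) * ln (real n) + H"
    using conf_width_arg_nonneg[OF H] by (simp add: conf_width_def)
  then have "- (conf_width d H n)\<^sup>2 / 2 = - H / 2 - real (2 * d + 2) * ln (real n)"
    by (simp add: algebra_simps add_divide_distrib diff_divide_distrib)
  then have "exp (- (conf_width d H n)\<^sup>2 / 2) = exp (- H / 2) / exp (real (2 * d + 2) * ln (real n))"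
    by (simp only: exp_diff)
  also have "exp (real (2 * d + 2) * ln (real n)) = real n ^ (2 * d + 2)"
    using n by (simp only: exp_of_nat_mult) simp
  finally show ?thesis using n by simp
qed

lemma noise_tail:
  assumes P: "prob_space P" and D: "distributed P lborel \<epsilon> (normal_density 0 s)" and s: "s > 0" and c: "c \<ge> 0"
  shows "emeasure P {\<omega>\<in>space P. \<bar>\<epsilon> \<omega>\<bar> > s * c} \<le> ennreal (2 * exp (- c\<^sup>2 / 2))"
proof -
  interpret prob_space P by (rule P)
  have D': "distributed P lborel (\<lambda>\<omega>. (\<epsilon> \<omega> - 0) / s) std_normal_density"
    using normal_standard_normal_convert[OF s, of \<epsilon> 0] D by blast
  have meas: "(\<lambda>\<omega>. (\<epsilon> \<omega> - 0) / s) \<in> measurable P lborel" by (rule distributed_measurable[OF D'])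
  have "{\<omega>\<in>space P. \<bar>\<epsilon> \<omega>\<bar> > s * c} = (\<lambda>\<omega>. (\<epsilon> \<omega> - 0) / s) -` {x. \<bar>x\<bar> > c} \<inter> space P"
    using s by (auto simp: field_simps)
  also have "emeasure P \<dots> = emeasure (distr P lborel (\<lambda>\<omega>. (\<epsilon> \<omega> - 0) / s)) {x. \<bar>x\<bar> > c}"
    by (rule emeasure_distr[OF meas, symmetric]) simp
  also have "distr P lborel (\<lambda>\<omega>. (\<epsilon> \<omega> - 0) / s) = std_normal_distribution"
    by (rule distributed_distr_eq_density[OF D'])
  also have "emeasure std_normal_distribution {x. \<bar>x\<bar> > c} \<le> ennreal (2 * exp (- c\<^sup>2 / 2))"
    by (rule std_normal_tail[OF c])
  finally show ?thesis .
qed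

lemma se_kernel_measurable:
  "(\<lambda>p. se_kernel l (fst p) (snd p)) \<in> borel_measurable (borel \<Otimes>\<^sub>M (borel :: (real ^ 'd) measure))"
  unfolding se_kernel_def by measurable

text \<open>The mesh of the nets is a multiple of \<open>n\<^sup>-\<^sup>2\<close> whose factor must not depend on \<open>H\<close>: then the number of net points does not
depend on \<open>H\<close> either, and \<open>H\<close> can be chosen afterwards. To this end the admissible error \<open>\<kappa> = 1 + sqrt H\<close> grows with \<open>H\<close> like the widths do.\<close>

lemma uniform_confidence_event:
  fixes P :: "'w measure" and D :: "(real ^ 'd) set"
    and U :: "real ^ 'd \<Rightarrow> 'w \<Rightarrow> real" and g :: "'w \<Rightarrow> real ^ 'd \<Rightarrow> real ^ 'd"
    and \<epsilon> Y :: "nat \<Rightarrow> 'w \<Rightarrow> real" and X :: "nat \<Rightarrow> 'w \<Rightarrow> real ^ 'd"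
    and l s r a b \<delta> :: real
  defines "k \<equiv> se_kernel l :: real ^ 'd \<Rightarrow> real ^ 'd \<Rightarrow> real"
  assumes l: "l > 0" and s: "s > 0" and \<delta>: "0 < \<delta>"
    and P: "prob_space P" and gp: "gaussian_process P D (\<lambda>x. 0) k U"
    and noise_indep: "prob_space.indep_vars P (\<lambda>n. borel) \<epsilon> {1..}"
    and noise_law: "\<And>n. n \<ge> 1 \<Longrightarrow> distributed P lborel (\<epsilon> n) (normal_density 0 s)"
    and noise_U: "prob_space.indep_set P
          (sets (vimage_algebra (space P) (\<lambda>\<omega>. \<lambda>x\<in>D. U x \<omega>) (PiM D (\<lambda>x. borel))))
          (sets (vimage_algebra (space P) (\<lambda>\<omega>. \<lambda>n\<in>{1..}. \<epsilon> n \<omega>) (PiM {1..} (\<lambda>n. borel))))"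
    and X_D: "\<And>n \<omega>. n \<ge> 1 \<Longrightarrow> \<omega> \<in> space P \<Longrightarrow> X n \<omega> \<in> D"
    and feedback: "\<And>n \<omega>. n \<ge> 1 \<Longrightarrow> \<omega> \<in> space P \<Longrightarrow> Y n \<omega> = U (X n \<omega>) \<omega> + \<epsilon> n \<omega>"
    and X_adapted: "\<And>n. n \<ge> 1 \<Longrightarrow>
                      \<exists>q \<in> borel_measurable (PiM {1..<n} (\<lambda>i. borel)).
                        \<forall>\<omega>\<in>space P. X n \<omega> = q (\<lambda>i\<in>{1..<n}. Y i \<omega>)"
    and r: "r > 0" and D_box: "\<And>x j. x \<in> D \<Longrightarrow> 0 \<le> x $ j \<and> x $ j \<le> r"
    and D: "compact D" "convex D" and a: "a > 0" and b: "b > 0"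
    and U_diff: "\<And>\<omega> x. \<omega> \<in> space P \<Longrightarrow> x \<in> D \<Longrightarrow>
                   ((\<lambda>z. U z \<omega>) has_derivative (\<lambda>h. g \<omega> x \<bullet> h)) (at x within D)"
    and U_meas: "\<And>j c. c > 0 \<Longrightarrow> {\<omega> \<in> space P. (SUP x\<in>D. ereal \<bar>g \<omega> x $ j\<bar>) > ereal c} \<in> sets P"
    and U_tail: "\<And>j c. c > 0 \<Longrightarrow> measure P {\<omega> \<in> space P. (SUP x\<in>D. ereal \<bar>g \<omega> x $ j\<bar>) > ereal c}
                     \<le> a * exp (- (c / b)\<^sup>2)"
  shows "\<exists>H\<ge>0. \<exists>A\<in>sets P. measure P A \<ge> 1 - \<delta> \<and> A \<subseteq> space P \<and> (\<forall>\<omega>\<in>A. \<forall>n\<ge>1.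
      \<bar>\<epsilon> n \<omega>\<bar> \<le> s * conf_width CARD('d) H n \<and>
      (\<forall>p\<in>D. \<bar>U p \<omega> - cond_mean k s (\<lambda>i. X i \<omega>) (\<lambda>i. Y i \<omega>) (n - 1) p\<bar>
         \<le> conf_width CARD('d) H n * sqrt (cond_cov k s (\<lambda>i. X i \<omega>) (n - 1) p p) + (1 + sqrt H)))"
proof -
  interpret prob_space P by (rule P)
  define d where "d = CARD('d)"
  have d: "d \<ge> 1" unfolding d_def by (simp add: Suc_leI)
  note pd = psd_se_kernel[OF l, where 'd = 'd, folded k_def]
  have k_pos: "k u u > 0" for u by (simp add: k_def)
  have k_meas: "(\<lambda>p. k (fst p) (snd p)) \<in> borel_measurable (borel \<Otimes>\<^sub>M borel)"
    unfolding k_def by (rule se_kernel_measurable)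
  have U_cont: "continuous_on D (\<lambda>u. U u \<omega>)" if "\<omega> \<in> space P" for \<omega>
    using has_derivative_continuous[OF U_diff[OF that]] by (simp add: continuous_on_eq_continuous_within)
  \<comment> \<open>This bound on the partial derivatives fails with probability at most \<open>\<delta> / (2 d)\<close> in each coordinate.\<close>
  define cU where "cU = b * sqrt (ln (1 + 2 * real d * a / \<delta>))"
  have arg: "1 < 1 + 2 * real d * a / \<delta>" using d a \<delta> by simp
  have cU: "cU > 0" unfolding cU_def using arg b by simp
  let ?B = "\<lambda>j. {\<omega> \<in> space P. (SUP x\<in>D. ereal \<bar>g \<omega> x $ j\<bar>) > ereal cU}"
  have "a * exp (- (cU / b)\<^sup>2) \<le> \<delta> / (2 * real d)"
  proof -
    have "(cU / b)\<^sup>2 = ln (1 + 2 * real d * a / \<delta>)" using arg b by (simp add: cU_def)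
    moreover have "exp (- ln q) = 1 / q" if "q > 1" for q :: real
      using that by (simp add: exp_minus inverse_eq_divide)
    ultimately have "a * exp (- (cU / b)\<^sup>2) = a / (1 + 2 * real d * a / \<delta>)"
      using arg by (simp only: mult_1_right times_divide_eq_right)
    also have "\<dots> \<le> a / (2 * real d * a / \<delta>)"
      using a d \<delta> by (intro frac_le) auto
    also have "\<dots> = \<delta> / (2 * real d)" using a by simp
    finally show ?thesis .
  qed
  then have B_prob: "prob (?B j) \<le> \<delta> / (2 * real d)" for j
    using U_tail[OF cU, of j] by linarith
  define B0 where "B0 = (\<Union>j\<in>UNIV. ?B j)"
  have B0_sets: "B0 \<in> events" unfolding B0_def using U_meas[OF cU] by auto
  have "prob B0 \<le> (\<Sum>j\<in>UNIV. prob (?B j))"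
    unfolding B0_def using U_meas[OF cU] by (intro finite_measure_subadditive_finite) auto
  also have "\<dots> \<le> (\<Sum>j\<in>(UNIV :: 'd set). \<delta> / (2 * real d))" by (intro sum_mono B_prob)
  also have "\<dots> = \<delta> / 2" using d by (simp add: d_def)
  finally have B0_prob: "prob B0 \<le> \<delta> / 2" .
  define A where "A = real d * cU"
  have A: "A \<ge> 0" using cU by (simp add: A_def)
  have lip: "\<bar>U p \<omega> - U q \<omega>\<bar> \<le> A * norm (p - q)" if "\<omega> \<in> space P - B0" "p \<in> D" "q \<in> D" for \<omega> p q
  proof -
    have "\<bar>g \<omega> x $ j\<bar> \<le> cU" if "x \<in> D" for x j
    proof -
      have "\<not> (SUP x\<in>D. ereal \<bar>g \<omega> x $ j\<bar>) > ereal cU"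
        using \<open>\<omega> \<in> space P - B0\<close> unfolding B0_def by blast
      then have "(SUP x\<in>D. ereal \<bar>g \<omega> x $ j\<bar>) \<le> ereal cU" by simp
      moreover have "ereal \<bar>g \<omega> x $ j\<bar> \<le> (SUP x\<in>D. ereal \<bar>g \<omega> x $ j\<bar>)" by (rule SUP_upper[OF that])
      ultimately have "ereal \<bar>g \<omega> x $ j\<bar> \<le> ereal cU" by (rule order_trans[rotated])
      then show ?thesis by simp
    qed
    then show ?thesis
      unfolding A_def d_def using that by (intro lipschitz_from_gradient[OF D(2) U_diff]) auto
  qed
  \<comment> \<open>\<open>W\<close> collects the Lipschitz constants of path, mean and deviation after division by \<open>\<kappa> * n\<^sup>2\<close>.\<close>
  define c1 where "c1 = sqrt (4 + 4 * real d)"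
  have c1: "c1 \<ge> 0" by (simp add: c1_def)
  define W where "W = A + ((1 + s) * c1 + 1) / (l * s\<^sup>2) + c1 / l + 1"
  have W: "W \<ge> 1" unfolding W_def using A c1 l s by (intro add_increasing) (auto intro!: add_nonneg_nonneg)
  define h where "h = (\<lambda>n. 1 / (W * (real n)\<^sup>2))"
  have h_pos: "h n > 0" if "n \<ge> 1" for n using W that by (simp add: h_def)
  have "\<exists>Z. \<forall>n\<ge>1. finite (Z n) \<and> Z n \<subseteq> D \<and> (\<forall>p\<in>D. \<exists>z\<in>Z n. norm (p - z) \<le> h n) \<and>
     real (card (Z n)) \<le> (r * real d / h n + 1) ^ d"
    using box_net[of r "h n" D for n] h_pos r D_box unfolding d_def
    by (intro choice allI) (metis less_imp_le)
  then obtain Z0 where Z0: "\<And>n. n \<ge> 1 \<Longrightarrow> finite (Z0 n) \<and> Z0 n \<subseteq> D \<and> (\<forall>p\<in>D. \<exists>z\<in>Z0 n. norm (p - z) \<le> h n) \<and>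
     real (card (Z0 n)) \<le> (r * real d / h n + 1) ^ d" by blast
  define Z where "Z = (\<lambda>n. if n \<ge> 1 then Z0 n else {})"
  have Z: "finite (Z n)" "Z n \<subseteq> D" for n using Z0[of n] by (auto simp: Z_def)
  have Z_net: "\<exists>z\<in>Z n. norm (p - z) \<le> h n" if "n \<ge> 1" "p \<in> D" for n p
    using Z0[OF that(1)] that by (simp add: Z_def)
  define CZ where "CZ = (r * real d * W + 1) ^ d"
  have CZ: "CZ \<ge> 0" unfolding CZ_def using r W by simp
  have Z_card: "real (card (Z n)) \<le> CZ * real n ^ (2 * d)" if n: "n \<ge> 1" for n
  proof -
    have "real (card (Z n)) \<le> (r * real d / h n + 1) ^ d" using Z0[OF n] n by (simp add: Z_def)
    also have "\<dots> \<le> ((r * real d * W + 1) * (real n)\<^sup>2) ^ d"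
    proof (rule power_mono)
      have "1 \<le> (real n)\<^sup>2" using n by (simp add: one_le_power)
      then show "r * real d / h n + 1 \<le> (r * real d * W + 1) * (real n)\<^sup>2"
        by (simp add: h_def distrib_right)
      show "0 \<le> r * real d / h n + 1" using r h_pos[OF n] by (simp add: less_imp_le)
    qed
    also have "\<dots> = CZ * real n ^ (2 * d)" by (simp add: CZ_def power_mult_distrib power_mult)
    finally show ?thesis .
  qed
  \<comment> \<open>The failure probabilities of noise and net bounds sum to at most \<open>K * exp (- H / 2)\<close>.\<close>
  have summ: "summable (\<lambda>n. 1 / (real (Suc n))\<^sup>2)"
  proof -
    have "summable (\<lambda>n. 1 / (real n)\<^sup>2)"
      using inverse_power_summable[of 2, where 'a = real] by (simp add: inverse_eq_divide)
    then show ?thesis by (subst summable_Suc_iff)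
  qed
  define S0 where "S0 = (\<Sum>n. 1 / (real (Suc n))\<^sup>2)"
  have S0: "S0 \<ge> 0" unfolding S0_def by (rule suminf_nonneg[OF summ]) simp
  define K where "K = 2 * (1 + CZ) * S0"
  have K: "K \<ge> 0" using S0 CZ by (simp add: K_def)
  define H where "H = 2 * ln (1 + 2 * K / \<delta>)"
  have argH: "1 \<le> 1 + 2 * K / \<delta>" using K \<delta> by simp
  have H: "H \<ge> 0" unfolding H_def using argH by simp
  have H_exp: "exp (- H / 2) * K \<le> \<delta> / 2"
  proof -
    have "exp (- H / 2) = 1 / (1 + 2 * K / \<delta>)"
      using argH by (simp add: H_def exp_minus inverse_eq_divide)
    moreover have "K \<le> \<delta> / 2 * (1 + 2 * K / \<delta>)" using \<delta> by (simp add: field_simps)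
    ultimately show ?thesis using argH by (simp add: pos_divide_le_eq)
  qed
  define bb where "bb = conf_width d H"
  define \<kappa> where "\<kappa> = 1 + sqrt H"
  have \<kappa>: "\<kappa> \<ge> 1" using H by (simp add: \<kappa>_def)
  have bb: "bb n \<ge> 0" for n unfolding bb_def by (rule conf_width_nonneg[OF H])
  have bb_lin: "bb n \<le> c1 * \<kappa> * real n" if "n \<ge> 1" for n
    unfolding bb_def c1_def \<kappa>_def by (rule conf_width_linear[OF H that])
  define m where "m = (\<lambda>n \<omega>. cond_mean k s (\<lambda>i. X i \<omega>) (\<lambda>i. Y i \<omega>) n)"
  define v where "v = (\<lambda>n \<omega> p. cond_cov k s (\<lambda>i. X i \<omega>) n p p)"
  define Bn where "Bn = (\<lambda>n. {\<omega>\<in>space P. \<bar>\<epsilon> n \<omega>\<bar> > s * bb n} \<union>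
      (\<Union>z\<in>Z n. {\<omega>\<in>space P. \<bar>U z \<omega> - m (n - 1) \<omega> z\<bar> > bb n * sqrt (v (n - 1) \<omega> z)}))"
  have conf_z: "{\<omega>\<in>space P. \<bar>U z \<omega> - m (n - 1) \<omega> z\<bar> > bb n * sqrt (v (n - 1) \<omega> z)} \<in> sets P"
    "prob {\<omega>\<in>space P. \<bar>U z \<omega> - m (n - 1) \<omega> z\<bar> > bb n * sqrt (v (n - 1) \<omega> z)} \<le> 2 * exp (- (bb n)\<^sup>2 / 2)"
    if z: "z \<in> D" for n z
  proof -
    note conf = adaptive_gaussian_confidence[OF P gp pd k_pos k_meas s noise_indep noise_law
        noise_U compact_imp_closed[OF D(1)] U_cont X_D feedback X_adapted z bb]
    show "{\<omega>\<in>space P. \<bar>U z \<omega> - m (n - 1) \<omega> z\<bar> > bb n * sqrt (v (n - 1) \<omega> z)} \<in> sets P"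
      unfolding m_def v_def by (rule conf(1))
    have "emeasure P {\<omega>\<in>space P. \<bar>U z \<omega> - m (n - 1) \<omega> z\<bar> > bb n * sqrt (v (n - 1) \<omega> z)} \<le> ennreal (2 * exp (- (bb n)\<^sup>2 / 2))"
      unfolding m_def v_def by (rule conf(2))
    then show "prob {\<omega>\<in>space P. \<bar>U z \<omega> - m (n - 1) \<omega> z\<bar> > bb n * sqrt (v (n - 1) \<omega> z)} \<le> 2 * exp (- (bb n)\<^sup>2 / 2)"
      by (simp add: emeasure_eq_measure)
  qed
  have noise_n: "{\<omega>\<in>space P. \<bar>\<epsilon> n \<omega>\<bar> > s * bb n} \<in> sets P"
    "prob {\<omega>\<in>space P. \<bar>\<epsilon> n \<omega>\<bar> > s * bb n} \<le> 2 * exp (- (bb n)\<^sup>2 / 2)" if n: "n \<ge> 1" for n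
  proof -
    have [measurable]: "\<epsilon> n \<in> borel_measurable P" using distributed_measurable[OF noise_law[OF n]] by simp
    show "{\<omega>\<in>space P. \<bar>\<epsilon> n \<omega>\<bar> > s * bb n} \<in> sets P" by measurable
    show "prob {\<omega>\<in>space P. \<bar>\<epsilon> n \<omega>\<bar> > s * bb n} \<le> 2 * exp (- (bb n)\<^sup>2 / 2)"
      using noise_tail[OF P noise_law[OF n] s bb[of n]] by (simp add: emeasure_eq_measure)
  qed
  have Bn_sets: "Bn n \<in> events" if "n \<ge> 1" for n
    unfolding Bn_def using noise_n(1)[OF that] conf_z(1) Z[of n] by (intro sets.Un sets.finite_UN) auto
  have Bn_prob: "prob (Bn n) \<le> 2 * (1 + CZ) * exp (- H / 2) * (1 / (real n)\<^sup>2)" if n: "n \<ge> 1" for n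
  proof -
    let ?E = "exp (- (bb n)\<^sup>2 / 2)"
    have "prob (Bn n) \<le> prob {\<omega>\<in>space P. \<bar>\<epsilon> n \<omega>\<bar> > s * bb n} +
        prob (\<Union>z\<in>Z n. {\<omega>\<in>space P. \<bar>U z \<omega> - m (n - 1) \<omega> z\<bar> > bb n * sqrt (v (n - 1) \<omega> z)})"
      unfolding Bn_def using noise_n(1)[OF n] conf_z(1) Z[of n]
      by (intro measure_Un_le sets.finite_UN) auto
    also have "prob (\<Union>z\<in>Z n. {\<omega>\<in>space P. \<bar>U z \<omega> - m (n - 1) \<omega> z\<bar> > bb n * sqrt (v (n - 1) \<omega> z)})
       \<le> (\<Sum>z\<in>Z n. prob {\<omega>\<in>space P. \<bar>U z \<omega> - m (n - 1) \<omega> z\<bar> > bb n * sqrt (v (n - 1) \<omega> z)})"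
      using conf_z(1) Z[of n] by (intro finite_measure_subadditive_finite) auto
    also have "\<dots> \<le> (\<Sum>z\<in>Z n. 2 * ?E)" using conf_z(2) Z[of n] by (intro sum_mono) auto
    also have "\<dots> = real (card (Z n)) * (2 * ?E)" by simp
    also have "\<dots> \<le> CZ * real n ^ (2 * d) * (2 * ?E)" by (intro mult_right_mono Z_card[OF n]) auto
    also have "prob {\<omega>\<in>space P. \<bar>\<epsilon> n \<omega>\<bar> > s * bb n} \<le> real n ^ (2 * d) * (2 * ?E)"
    proof -
      have "1 \<le> real n ^ (2 * d)" using n by (simp add: one_le_power)
      then have "1 * (2 * ?E) \<le> real n ^ (2 * d) * (2 * ?E)" by (intro mult_right_mono) auto
      then show ?thesis using noise_n(2)[OF n] by linarith
    qed
    finally have "prob (Bn n) \<le> 2 * (1 + CZ) * (?E * real n ^ (2 * d))"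
      by (simp add: algebra_simps)
    also have "?E * real n ^ (2 * d) = exp (- H / 2) * (1 / (real n)\<^sup>2)"
      using exp_conf_width[OF H n, of d] n by (simp add: bb_def power_add field_simps power2_eq_square)
    finally show ?thesis by (simp only: mult.assoc)
  qed
  define B1 where "B1 = (\<Union>n. Bn (Suc n))"
  have B1_sets: "B1 \<in> events" unfolding B1_def using Bn_sets by auto
  have B1_prob: "prob B1 \<le> \<delta> / 2"
  proof -
    let ?u = "\<lambda>n. 2 * (1 + CZ) * exp (- H / 2) * (1 / (real (Suc n))\<^sup>2)"
    have u: "summable ?u" by (intro summable_mult summ)
    have le: "prob (Bn (Suc n)) \<le> ?u n" for n by (rule Bn_prob) simp
    have s': "summable (\<lambda>n. prob (Bn (Suc n)))"
      by (rule summable_comparison_test'[OF u, of 0]) (use le in simp)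
    have "prob B1 \<le> (\<Sum>n. prob (Bn (Suc n)))"
      unfolding B1_def using Bn_sets s' by (intro finite_measure_subadditive_countably) auto
    also have "\<dots> \<le> (\<Sum>n. ?u n)" by (rule suminf_le[OF le s' u])
    also have "\<dots> = exp (- H / 2) * K"
      unfolding suminf_mult[OF summ] K_def S0_def by simp
    also have "\<dots> \<le> \<delta> / 2" by (rule H_exp)
    finally show ?thesis .
  qed
  define G where "G = space P - (B0 \<union> B1)"
  have G_sets: "G \<in> sets P" unfolding G_def using B0_sets B1_sets by auto
  have "prob (B0 \<union> B1) \<le> prob B0 + prob B1" using B0_sets B1_sets by (rule measure_Un_le)
  then have "prob (B0 \<union> B1) \<le> \<delta>" using B0_prob B1_prob by linarith
  then have G_prob: "prob G \<ge> 1 - \<delta>"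
    unfolding G_def using prob_compl[of "B0 \<union> B1"] B0_sets B1_sets by simp
  have mesh: "h n * (A + (\<Sum>i=1..<n. bb i + \<kappa> + s * bb i) / (l * s\<^sup>2) + bb n / l) \<le> \<kappa>" if n: "n \<ge> 1" for n
  proof -
    let ?n2 = "(real n)\<^sup>2"
    have "1 \<le> ?n2" using n by (simp add: one_le_power)
    moreover have "real n \<le> ?n2" using n by (simp add: power2_eq_square)
    ultimately have n2: "real n \<le> ?n2" "1 \<le> ?n2" by simp_all
    have "(\<Sum>i=1..<n. bb i + \<kappa> + s * bb i) \<le> (\<Sum>i=1..<n. \<kappa> * ((1 + s) * c1 + 1) * real n)"
    proof (rule sum_mono)
      fix i assume i: "i \<in> {1..<n}"
      have "bb i \<le> c1 * \<kappa> * real i" using i by (intro bb_lin) simp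
      also have "\<dots> \<le> c1 * \<kappa> * real n" using i c1 \<kappa> by (intro mult_left_mono) auto
      finally have b: "bb i \<le> c1 * \<kappa> * real n" .
      have "bb i + \<kappa> + s * bb i = (1 + s) * bb i + \<kappa> * 1" by (simp add: algebra_simps)
      also have "\<dots> \<le> (1 + s) * (c1 * \<kappa> * real n) + \<kappa> * real n"
        using b s \<kappa> n by (intro add_mono mult_left_mono) auto
      finally show "bb i + \<kappa> + s * bb i \<le> \<kappa> * ((1 + s) * c1 + 1) * real n" by (simp add: algebra_simps)
    qed
    also have "\<dots> = real (n - 1) * (\<kappa> * ((1 + s) * c1 + 1) * real n)" by simp
    also have "\<dots> \<le> real n * (\<kappa> * ((1 + s) * c1 + 1) * real n)"
      using \<kappa> s c1 by (intro mult_right_mono) auto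
    finally have "(\<Sum>i=1..<n. bb i + \<kappa> + s * bb i) \<le> \<kappa> * ?n2 * ((1 + s) * c1 + 1)"
      by (simp add: power2_eq_square mult_ac)
    then have 1: "(\<Sum>i=1..<n. bb i + \<kappa> + s * bb i) / (l * s\<^sup>2) \<le> \<kappa> * ?n2 * (((1 + s) * c1 + 1) / (l * s\<^sup>2))"
      using l s by (simp add: divide_right_mono)
    have "bb n \<le> c1 * \<kappa> * ?n2"
      using bb_lin[OF n] mult_left_mono[OF n2(1), of "c1 * \<kappa>"] c1 \<kappa> by simp
    then have "bb n / l \<le> c1 * \<kappa> * ?n2 / l" using l by (simp add: divide_right_mono)
    then have 2: "bb n / l \<le> \<kappa> * ?n2 * (c1 / l)" by (simp add: mult_ac)
    have 3: "A \<le> \<kappa> * ?n2 * A"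
    proof -
      have "1 * 1 * A \<le> \<kappa> * ?n2 * A" using \<kappa> n2 A by (intro mult_mono) auto
      then show ?thesis by simp
    qed
    have "A + (\<Sum>i=1..<n. bb i + \<kappa> + s * bb i) / (l * s\<^sup>2) + bb n / l \<le> \<kappa> * ?n2 * (W - 1)"
      using 1 2 3 unfolding W_def by (simp add: distrib_left)
    also have "\<dots> \<le> \<kappa> * ?n2 * W" using \<kappa> by (intro mult_left_mono) auto
    finally have "h n * (A + (\<Sum>i=1..<n. bb i + \<kappa> + s * bb i) / (l * s\<^sup>2) + bb n / l) \<le> h n * (\<kappa> * ?n2 * W)"
      using h_pos[OF n] by (intro mult_left_mono) auto
    also have "\<dots> = \<kappa>" using W n by (simp add: h_def)
    finally show ?thesis .
  qed
  have good: "\<bar>\<epsilon> n \<omega>\<bar> \<le> s * bb n" "z \<in> Z n \<Longrightarrow> \<bar>U z \<omega> - m (n - 1) \<omega> z\<bar> \<le> bb n * sqrt (v (n - 1) \<omega> z)"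
    if \<omega>: "\<omega> \<in> G" and n: "n \<ge> 1" for \<omega> n z
  proof -
    have "\<omega> \<notin> Bn (Suc (n - 1))" "\<omega> \<in> space P" using \<omega> by (auto simp: G_def B1_def)
    then have "\<omega> \<notin> Bn n" using n by simp
    then show "\<bar>\<epsilon> n \<omega>\<bar> \<le> s * bb n" "z \<in> Z n \<Longrightarrow> \<bar>U z \<omega> - m (n - 1) \<omega> z\<bar> \<le> bb n * sqrt (v (n - 1) \<omega> z)"
      using \<open>\<omega> \<in> space P\<close> by (auto simp: Bn_def not_less)
  qed
  have "\<bar>U p \<omega> - m (n - 1) \<omega> p\<bar> \<le> bb n * sqrt (v (n - 1) \<omega> p) + \<kappa>"
    if \<omega>: "\<omega> \<in> G" and n: "n \<ge> 1" and p: "p \<in> D" for \<omega> n p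
  proof -
    have sp: "\<omega> \<in> space P" using \<omega> by (simp add: G_def)
    show ?thesis
      unfolding m_def v_def k_def
    proof (rule confidence_from_net[OF l s, where D = D and e = "\<lambda>n. \<epsilon> n \<omega>" and A = A and Z = Z and h = h])
      show "\<bar>U z \<omega> - cond_mean (se_kernel l) s (\<lambda>i. X i \<omega>) (\<lambda>i. Y i \<omega>) (n - 1) z\<bar>
          \<le> bb n * sqrt (cond_cov (se_kernel l) s (\<lambda>i. X i \<omega>) (n - 1) z z)" if "n \<ge> 1" "z \<in> Z n" for n z
        using good(2)[OF \<omega> that] unfolding m_def v_def k_def .
      show "\<bar>U p \<omega> - U q \<omega>\<bar> \<le> A * norm (p - q)" if "p \<in> D" "q \<in> D" for p q
        using lip[OF _ that, of \<omega>] \<omega> by (simp add: G_def)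
    qed (use X_D feedback good(1)[OF \<omega>] Z_net Z(2) bb mesh A sp n p in auto)
  qed
  then show ?thesis
    using G_sets G_prob H good(1) unfolding bb_def \<kappa>_def m_def v_def d_def
    by (intro exI[of _ H] conjI bexI[of _ G]) (auto simp: G_def)
qed

section \<open>Asymptotics of the bound and the theorem\<close>

lemma ln_power_bigo_linear: "(\<lambda>n. ln (real n) ^ m) \<in> O(\<lambda>n. real n)"
proof -
  have "((\<lambda>x::real. x ^ m / exp x) \<longlongrightarrow> 0) at_top" by (rule tendsto_power_div_exp_0)
  moreover have "filterlim (\<lambda>n. ln (real n)) at_top sequentially" by real_asymp
  ultimately have "(\<lambda>n. ln (real n) ^ m / exp (ln (real n))) \<longlonglongrightarrow> 0"
    by (rule filterlim_compose)
  moreover have "eventually (\<lambda>n. ln (real n) ^ m / exp (ln (real n)) = ln (real n) ^ m / real n) sequentially"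
    by (rule eventually_sequentiallyI[of 1]) simp
  ultimately have "(\<lambda>n. ln (real n) ^ m / real n) \<longlonglongrightarrow> 0"
    by (rule Lim_transform_eventually)
  then have "(\<lambda>n. ln (real n) ^ m) \<in> o(\<lambda>n. real n)"
    by (rule smalloI_tendsto) (rule eventually_sequentiallyI[of 1], simp)
  then show ?thesis by (rule landau_o.small_imp_big)
qed

lemma conf_width_bigo: "conf_width d H \<in> O(\<lambda>n. sqrt (ln (real n)))"
proof -
  have "(\<lambda>n. sqrt (c * ln (real n) + H)) \<in> O(\<lambda>n. sqrt (ln (real n)))" if "c > 0" for c
    using that by real_asymp
  from this[of "4 + 4 * real d"] show ?thesis by (simp add: conf_width_def[abs_def])
qed

lemma square_times_gain_bigo:
  assumes f: "f \<in> O(\<lambda>n. sqrt (ln (real n)))"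
  shows "(\<lambda>T. (f T)\<^sup>2 * (c * se_gain_bound l s r TYPE('d::finite) T)) \<in> O(\<lambda>T. real T)"
proof -
  have "(\<lambda>T. (f T)\<^sup>2) \<in> O(\<lambda>T. sqrt (ln (real T)) ^ 2)" by (rule landau_o.big_power[OF f])
  also have "(\<lambda>T. sqrt (ln (real T)) ^ 2) \<in> O(\<lambda>T. ln (real T))"
    by (intro bigoI[of _ 1] eventually_sequentiallyI[of 1]) simp
  finally have 1: "(\<lambda>T. (f T)\<^sup>2) \<in> O(\<lambda>T. ln (real T))" .
  have 2: "(\<lambda>T. c * se_gain_bound l s r TYPE('d) T) \<in> O(\<lambda>T. ln (real T) ^ (CARD('d) + 1))"
    using se_gain_bound_bigo[of l s r, where 'd = 'd] by (cases "c = 0") simp_all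
  have "(\<lambda>T. (f T)\<^sup>2 * (c * se_gain_bound l s r TYPE('d) T)) \<in> O(\<lambda>T. ln (real T) * ln (real T) ^ (CARD('d) + 1))"
    by (rule landau_o.big.mult[OF 1 2])
  also have "(\<lambda>T. ln (real T) * ln (real T) ^ (CARD('d) + 1)) = (\<lambda>T. ln (real T) ^ (CARD('d) + 2))"
    by simp
  also have "\<dots> \<in> O(\<lambda>T. real T)" by (rule ln_power_bigo_linear)
  finally show ?thesis .
qed

text \<open>The hypothesis excludes the value \<open>ln 0 = 0\<close>, for which the rate would grow more slowly.\<close>

lemma agp_beta_log:
  assumes \<delta>: "\<delta> > 0" and K: "real d * b * r * sqrt (ln (4 * real d * a / \<delta>)) \<noteq> 0" and n: "n \<ge> 1"
  shows "agp_beta d a b r \<delta> n = (4 + 4 * real d) * ln (real n) + agp_beta d a b r \<delta> 1"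
proof -
  have n2: "ln ((real n)\<^sup>2) = 2 * ln (real n)" using n by (simp add: ln_realpow)
  have 1: "ln (2 * (real n)\<^sup>2 * pi\<^sup>2 / (3 * \<delta>)) = 2 * ln (real n) + ln (2 * pi\<^sup>2 / (3 * \<delta>))"
  proof -
    have "ln (2 * (real n)\<^sup>2 * pi\<^sup>2 / (3 * \<delta>)) = ln ((real n)\<^sup>2 * (2 * pi\<^sup>2 / (3 * \<delta>)))"
      by (simp add: mult_ac)
    also have "\<dots> = ln ((real n)\<^sup>2) + ln (2 * pi\<^sup>2 / (3 * \<delta>))"
      using n \<delta> by (subst ln_mult) auto
    finally show ?thesis using n2 by simp
  qed
  let ?K = "real d * b * r * sqrt (ln (4 * real d * a / \<delta>))"
  have 2: "ln (real d * (real n)\<^sup>2 * b * r * sqrt (ln (4 * real d * a / \<delta>))) = 2 * ln (real n) + ln ?K"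
  proof -
    have "ln (real d * (real n)\<^sup>2 * b * r * sqrt (ln (4 * real d * a / \<delta>))) = ln ((real n)\<^sup>2 * ?K)"
      by (simp add: mult_ac)
    also have "\<dots> = ln ((real n)\<^sup>2) + ln ?K"
      using n K by (subst ln_mult) auto
    finally show ?thesis using n2 by simp
  qed
  show ?thesis
    unfolding agp_beta_def 1 2 by (simp add: algebra_simps)
qed

text \<open>By \<open>ln (1 + v) \<ge> v / (1 + v)\<close> the logarithm of each factor of the product dominates a multiple of the variance.\<close>

lemma sum_cond_var_le:
  assumes pd: "psd_kernel k" and s: "s > 0" and k1: "\<And>u. k u u \<le> 1"
  shows "(\<Sum>i=1..T. cond_cov k s x (i - 1) (x i) (x i)) \<le> (s\<^sup>2 + 1) * ln (gain_product k s x T)"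
proof -
  let ?c = "\<lambda>i. cond_cov k s x (i - 1) (x i) (x i)"
  have c: "0 \<le> ?c i" "?c i \<le> 1" for i
    using cond_cov_nonneg[OF pd s] cond_cov_le_prior[OF pd s, of x "i - 1" "x i"] k1[of "x i"] by simp_all
  have pos: "1 + ?c i / s\<^sup>2 > 0" for i
    using c(1)[of i] by (intro add_pos_nonneg) auto
  have "(\<Sum>i=1..T. ?c i) \<le> (\<Sum>i=1..T. (s\<^sup>2 + 1) * ln (1 + ?c i / s\<^sup>2))"
  proof (rule sum_mono)
    fix i
    have "ln (1 / (1 + ?c i / s\<^sup>2)) \<le> 1 / (1 + ?c i / s\<^sup>2) - 1"
      using pos[of i] by (intro ln_le_minus_one) simp
    then have "1 - 1 / (1 + ?c i / s\<^sup>2) \<le> ln (1 + ?c i / s\<^sup>2)"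
      using pos[of i] by (simp add: ln_div)
    moreover have "1 - 1 / (1 + ?c i / s\<^sup>2) = ?c i / (s\<^sup>2 + ?c i)"
      using s c(1)[of i] by (simp add: field_simps add_nonneg_eq_0_iff)
    moreover have "?c i / (s\<^sup>2 + 1) \<le> ?c i / (s\<^sup>2 + ?c i)"
      using s c[of i] by (intro divide_left_mono) (auto simp: add_pos_nonneg)
    ultimately have "?c i / (s\<^sup>2 + 1) \<le> ln (1 + ?c i / s\<^sup>2)" by linarith
    then show "?c i \<le> (s\<^sup>2 + 1) * ln (1 + ?c i / s\<^sup>2)"
      by (simp add: pos_divide_le_eq add_nonneg_pos mult.commute)
  qed
  also have "\<dots> = (s\<^sup>2 + 1) * (\<Sum>i=1..T. ln (1 + ?c i / s\<^sup>2))" by (simp add: sum_distrib_left)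
  also have "(\<Sum>i=1..T. ln (1 + ?c i / s\<^sup>2)) = ln (gain_product k s x T)"
    unfolding gain_product_def
  proof (rule ln_prod[symmetric])
    show "1 + ?c i / s\<^sup>2 \<noteq> 0" for i using pos[of i] by linarith
  qed simp
  finally show ?thesis .
qed

theorem theorem2:
  fixes P :: "'w measure"
    and D :: "(real ^ 'd) set"
    and V :: "real \<Rightarrow> real ^ 'd \<Rightarrow> real"
    and U :: "real ^ 'd \<Rightarrow> 'w \<Rightarrow> real"
    and grad_U :: "'w \<Rightarrow> real ^ 'd \<Rightarrow> real ^ 'd"
    and \<epsilon> Y :: "nat \<Rightarrow> 'w \<Rightarrow> real"
    and X :: "nat \<Rightarrow> 'w \<Rightarrow> real ^ 'd"
    and scheme :: "(real ^ 'd \<Rightarrow> real) \<Rightarrow> real ^ 'd \<Rightarrow> nat \<Rightarrow> real ^ 'd"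
    and steps :: "nat \<Rightarrow> 'w \<Rightarrow> nat"
    and k :: "real ^ 'd \<Rightarrow> real ^ 'd \<Rightarrow> real"
    and t \<beta> :: "nat \<Rightarrow> real"
    and \<phi> :: "nat \<Rightarrow> 'w \<Rightarrow> real ^ 'd \<Rightarrow> real"
    and \<nu> :: "(real ^ 'd) measure"
    and e :: "nat \<Rightarrow> real ^ 'd \<Rightarrow> real"
    and lam :: "nat \<Rightarrow> real"
    and x0 :: "real ^ 'd"
    and l \<sigma> L r a b t0 \<tau> \<Delta> \<eta> \<delta> :: real
  defines "k \<equiv> se_kernel l"
    and "\<beta> \<equiv> agp_beta CARD('d) a b r \<delta>"
    and "t \<equiv> (\<lambda>n. t0 + real n * \<tau>)"
    and "\<phi> \<equiv> (\<lambda>n \<omega>. agp_acquisition k \<sigma> \<beta> (\<lambda>i. X i \<omega>) (\<lambda>i. Y i \<omega>) n (V (t n)))"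
  assumes "l > 0" and "\<sigma> > 0" and "t0 \<ge> 0" and "\<tau> > 0" and "0 < \<delta>" and "\<delta> < 1"
    and prob: "prob_space P"
    and gp: "gaussian_process P D (\<lambda>x. 0) k U"
    and noise_indep: "prob_space.indep_vars P (\<lambda>n. borel) \<epsilon> {1..}"
    and noise_law: "\<And>n. n \<ge> 1 \<Longrightarrow> distributed P lborel (\<epsilon> n) (normal_density 0 \<sigma>)"
    and noise_U: "prob_space.indep_set P
          (sets (vimage_algebra (space P) (\<lambda>\<omega>. \<lambda>x\<in>D. U x \<omega>) (PiM D (\<lambda>x. borel))))
          (sets (vimage_algebra (space P) (\<lambda>\<omega>. \<lambda>n\<in>{1..}. \<epsilon> n \<omega>) (PiM {1..} (\<lambda>n. borel))))"
    \<comment> \<open>\<open>scheme \<psi> x i\<close> is the \<open>i\<close>-th iterate on objective \<open>\<psi>\<close> from start \<open>x\<close>\<close>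
    and scheme_start: "\<And>\<psi> x. scheme \<psi> x 0 = x"
    and x0: "x0 \<in> D"
    and X_0: "\<And>\<omega>. \<omega> \<in> space P \<Longrightarrow> X 0 \<omega> = x0"
    and X_step: "\<And>n \<omega>. n \<ge> 1 \<Longrightarrow> \<omega> \<in> space P \<Longrightarrow>
                   X n \<omega> = scheme (\<phi> n \<omega>) (X (n - 1) \<omega>) (steps n \<omega>)"
    and X_D: "\<And>n \<omega>. n \<ge> 1 \<Longrightarrow> \<omega> \<in> space P \<Longrightarrow> X n \<omega> \<in> D"
    and feedback: "\<And>n \<omega>. n \<ge> 1 \<Longrightarrow> \<omega> \<in> space P \<Longrightarrow> Y n \<omega> = U (X n \<omega>) \<omega> + \<epsilon> n \<omega>"
    and X_adapted: "\<And>n. n \<ge> 1 \<Longrightarrow>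
                      \<exists>q \<in> borel_measurable (PiM {1..<n} (\<lambda>i. borel)).
                        \<forall>\<omega>\<in>space P. X n \<omega> = q (\<lambda>i\<in>{1..<n}. Y i \<omega>)"
    and V_convex: "\<And>s. s \<ge> 0 \<Longrightarrow> convex_on D (\<lambda>x. - V s x)"
    and V_smooth: "\<And>s. s \<ge> 0 \<Longrightarrow> strongly_smooth_on L D (\<lambda>x. - V s x)"
    and "r > 0" and D_box: "\<And>x j. x \<in> D \<Longrightarrow> 0 \<le> x $ j \<and> x $ j \<le> r"
    and "compact D" and "convex D"
    and "a > 0" and "b > 0"
    and U_diff: "\<And>\<omega> x. \<omega> \<in> space P \<Longrightarrow> x \<in> D \<Longrightarrow>
                   ((\<lambda>z. U z \<omega>) has_derivative (\<lambda>h. grad_U \<omega> x \<bullet> h)) (at x within D)"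
    and U_meas: "\<And>j c. c > 0 \<Longrightarrow>
                   {\<omega> \<in> space P. (SUP x\<in>D. ereal \<bar>grad_U \<omega> x $ j\<bar>) > ereal c} \<in> sets P"
    and U_tail: "\<And>j c. c > 0 \<Longrightarrow>
                   measure P {\<omega> \<in> space P. (SUP x\<in>D. ereal \<bar>grad_U \<omega> x $ j\<bar>) > ereal c}
                     \<le> a * exp (- (c / b)\<^sup>2)"
    and drift: "\<And>n. n \<ge> 2 \<Longrightarrow> (SUP x\<in>D. \<bar>V (t n) x - V (t (n - 1)) x\<bar>) \<le> \<Delta>"
    and "\<eta> < 1"
    and approx_opt: "\<And>n \<omega>. n \<ge> 1 \<Longrightarrow> \<omega> \<in> space P \<Longrightarrow>
                       (SUP x\<in>D. \<phi> n \<omega> x) - \<phi> n \<omega> (X n \<omega>)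
                         \<le> \<eta> * ((SUP x\<in>D. \<phi> n \<omega> x) - \<phi> n \<omega> (X (n - 1) \<omega>))"
    and "finite_measure \<nu>" and "sets \<nu> = sets borel" and "emeasure \<nu> (- D) = 0"
    and basis: "kernel_eigenbasis \<nu> D k e lam"
    and nondegenerate: "infinite {i. lam i \<noteq> 0}"
    and mean_repr: "\<And>n \<omega>. \<omega> \<in> space P \<Longrightarrow>
          fourier_representable \<nu> e
            (post_mean k \<sigma> (map (\<lambda>i. X i \<omega>) [1..<Suc n]) (map (\<lambda>i. Y i \<omega>) [1..<Suc n]))"
    and var_repr: "\<And>n \<omega>. \<omega> \<in> space P \<Longrightarrow>
          fourier_representable \<nu> e
            (\<lambda>x. post_cov k \<sigma> (map (\<lambda>i. X i \<omega>) [1..<Suc n]) x x)"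
  shows "info_gain k \<sigma> D \<in> O(\<lambda>T. ln (real T) ^ (CARD('d) + 1)) \<and>
    (\<exists>R1 \<in> bigo_star (\<lambda>T. sqrt (real CARD('d) * real T * ln (real T) ^ (CARD('d) + 1))).
     \<exists>R2 \<in> O(\<lambda>T. real T).
     \<exists>A \<in> sets P. measure P A \<ge> 1 - \<delta> \<and>
       (\<forall>\<omega>\<in>A. \<forall>T\<ge>1.
          \<bar>cum_regret D (\<lambda>n x. V (t n) x + U x \<omega>) (\<lambda>n. X n \<omega>) T\<bar> \<le> R1 T + R2 T))"
proof (rule conjI)
  have l: "l > 0" and s: "\<sigma> > 0" and \<delta>: "0 < \<delta>" by fact+
  show "info_gain k \<sigma> D \<in> O(\<lambda>T. ln (real T) ^ (CARD('d) + 1))"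
    unfolding k_def by (rule info_gain_se_kernel[OF l s]) (use D_box in \<open>auto intro: power_mono\<close>)
  interpret prob_space P by (rule prob)
  have X_D': "X n \<omega> \<in> D" if "\<omega> \<in> space P" for n \<omega>
    using X_0[OF that] x0 X_D[OF _ that, of n] by (cases "n = 0") auto
  have t_pos: "t n \<ge> 0" for n
    using \<open>t0 \<ge> 0\<close> \<open>\<tau> > 0\<close> by (simp add: t_def)
  show "\<exists>R1 \<in> bigo_star (\<lambda>T. sqrt (real CARD('d) * real T * ln (real T) ^ (CARD('d) + 1))).
     \<exists>R2 \<in> O(\<lambda>T. real T).
     \<exists>A \<in> sets P. measure P A \<ge> 1 - \<delta> \<and>
       (\<forall>\<omega>\<in>A. \<forall>T\<ge>1.
          \<bar>cum_regret D (\<lambda>n x. V (t n) x + U x \<omega>) (\<lambda>n. X n \<omega>) T\<bar> \<le> R1 T + R2 T)"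
  proof (cases "\<exists>p\<in>D. \<exists>q\<in>D. p \<noteq> q")
    case False
    then have D: "D = {x0}" using x0 by blast
    have "cum_regret D (\<lambda>n x. V (t n) x + U x \<omega>) (\<lambda>n. X n \<omega>) T = 0" if "\<omega> \<in> space P" for \<omega> T
      using X_D'[OF that] unfolding cum_regret_def D by simp
    then show ?thesis
      using \<delta> prob_space
      by (intro bexI[of _ "\<lambda>_. 0"] bexI[of _ "space P"]) (auto simp: bigo_star_def)
  next
    case True
    then obtain p q where pq: "p \<in> D" "q \<in> D" "p \<noteq> q" by blast
    have "1 \<le> real CARD('d) * a"
    proof (rule gradient_tail_constant_ge_1[OF prob gp \<open>convex D\<close> pq(1,2) _ _ U_diff U_meas])
      show "kdist2 k p q \<noteq> 0"
        using pq(3) l by (simp add: k_def kdist2_def se_kernel_def)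
      show "k p q = k q p" unfolding k_def by (rule psd_kernel_sym[OF psd_se_kernel[OF l]])
      show "prob {\<omega> \<in> space P. ereal c < (SUP x\<in>D. ereal \<bar>grad_U \<omega> x $ j\<bar>)} \<le> a" if "c > 0" for j c
      proof -
        have "a * exp (- (c / b)\<^sup>2) \<le> a * 1" using \<open>a > 0\<close> by (intro mult_left_mono) auto
        then show ?thesis using U_tail[OF that, of j] by linarith
      qed
    qed
    \<comment> \<open>Hence no logarithm in the exploration rate vanishes, and the rate has its full growth.\<close>
    then have "1 < 4 * real CARD('d) * a / \<delta>"
      using \<delta> \<open>\<delta> < 1\<close> by (simp add: pos_less_divide_eq)
    then have "0 < sqrt (ln (4 * real CARD('d) * a / \<delta>))" by simp
    then have "real CARD('d) * b * r * sqrt (ln (4 * real CARD('d) * a / \<delta>)) \<noteq> 0"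
      using \<open>b > 0\<close> \<open>r > 0\<close> by simp
    note \<beta>_log = agp_beta_log[OF \<delta> this, folded \<beta>_def]
    obtain H A where H: "H \<ge> 0" and A: "A \<in> sets P" "measure P A \<ge> 1 - \<delta>" "A \<subseteq> space P"
      and good: "\<And>\<omega> n. \<omega> \<in> A \<Longrightarrow> n \<ge> 1 \<Longrightarrow> \<bar>\<epsilon> n \<omega>\<bar> \<le> \<sigma> * conf_width CARD('d) H n"
        "\<And>\<omega> n p. \<omega> \<in> A \<Longrightarrow> n \<ge> 1 \<Longrightarrow> p \<in> D \<Longrightarrow>
          \<bar>U p \<omega> - cond_mean k \<sigma> (\<lambda>i. X i \<omega>) (\<lambda>i. Y i \<omega>) (n - 1) p\<bar>
            \<le> conf_width CARD('d) H n * sqrt (cond_cov k \<sigma> (\<lambda>i. X i \<omega>) (n - 1) p p) + (1 + sqrt H)"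
      using uniform_confidence_event[OF l s \<delta> prob gp[unfolded k_def] noise_indep noise_law noise_U X_D feedback X_adapted
          \<open>r > 0\<close> D_box \<open>compact D\<close> \<open>convex D\<close> \<open>a > 0\<close> \<open>b > 0\<close> U_diff U_meas U_tail]
      unfolding k_def by blast
    define c1 where "c1 = 4 + 4 * real CARD('d)"
    have c1: "c1 > 0" by (simp add: c1_def add_pos_nonneg)
    define bb where "bb = conf_width CARD('d) H"
    define \<kappa> where "\<kappa> = 1 + sqrt H"
    define sb where "sb = (\<lambda>n. sqrt (\<beta> n))"
    define C2 where "C2 = 2 * sqrt \<bar>\<beta> 1 - H\<bar>"
    define C3 where "C3 = 2 * sqrt c1"
    have bb: "bb n \<ge> 0" for n unfolding bb_def by (rule conf_width_nonneg[OF H])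
    have sb_bb: "\<bar>sb n - bb n\<bar> \<le> C2" if "n \<ge> 1" for n
    proof -
      have "\<bar>sb n - bb n\<bar> \<le> 2 * sqrt \<bar>\<beta> n - (c1 * ln (real n) + H)\<bar>"
        unfolding sb_def bb_def conf_width_def c1_def by (rule sqrt_diff_le)
      then show ?thesis by (simp add: \<beta>_log[OF that] C2_def c1_def)
    qed
    have sb_step: "\<bar>sb (Suc n) - sb n\<bar> \<le> C3" if n: "n \<ge> 1" for n
    proof -
      have "\<bar>sb (Suc n) - sb n\<bar> \<le> 2 * sqrt \<bar>\<beta> (Suc n) - \<beta> n\<bar>"
        unfolding sb_def by (rule sqrt_diff_le)
      also have "\<beta> (Suc n) - \<beta> n = c1 * (ln (real (Suc n)) - ln (real n))"
        using \<beta>_log[of "Suc n"] \<beta>_log[OF n] by (simp add: c1_def right_diff_distrib)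
      also have "\<bar>c1 * (ln (real (Suc n)) - ln (real n))\<bar> \<le> c1 * 1"
      proof -
        have "ln (real (Suc n) / real n) \<le> real (Suc n) / real n - 1"
          using n by (intro ln_le_minus_one) simp
        also have "\<dots> \<le> 1" using n by (simp add: field_simps)
        finally have "ln (real (Suc n)) - ln (real n) \<le> 1"
          using n by (subst (asm) ln_div) auto
        moreover have "0 \<le> ln (real (Suc n)) - ln (real n)" using n by simp
        ultimately show ?thesis using c1 by (simp add: abs_mult)
      qed
      finally show ?thesis by (simp add: C3_def)
    qed
    have V_cont: "continuous_on D (V (t n))" for n
    proof -
      obtain gr where gr: "\<And>y. y \<in> D \<Longrightarrow> ((\<lambda>x. - V (t n) x) has_derivative (\<lambda>h. gr y \<bullet> h)) (at y within D)"
        using V_smooth[OF t_pos[of n]] unfolding strongly_smooth_on_def by blast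
      have "continuous_on D (\<lambda>x. - V (t n) x)"
        unfolding continuous_on_eq_continuous_within using has_derivative_continuous[OF gr] by blast
      from continuous_on_minus[OF this] show ?thesis by simp
    qed
    have V_bdd: "\<exists>B. \<forall>p\<in>D. \<bar>V (t n) p\<bar> \<le> B" for n
      using compact_imp_bounded[OF compact_continuous_image[OF V_cont \<open>compact D\<close>, of n]]
      by (auto simp: bounded_iff)
    have V_drift: "\<bar>V (t (Suc n)) p - V (t n) p\<bar> \<le> \<Delta>" if n: "n \<ge> 1" and p: "p \<in> D" for n p
    proof -
      obtain B where B: "\<And>p. p \<in> D \<Longrightarrow> \<bar>V (t (Suc n)) p\<bar> \<le> B" using V_bdd[of "Suc n"] by blast
      obtain B' where B': "\<And>p. p \<in> D \<Longrightarrow> \<bar>V (t n) p\<bar> \<le> B'" using V_bdd[of n] by blast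
      have "\<bar>V (t (Suc n)) u - V (t n) u\<bar> \<le> B + B'" if "u \<in> D" for u
        using B[OF that] B'[OF that] by linarith
      then have "bdd_above ((\<lambda>u. \<bar>V (t (Suc n)) u - V (t n) u\<bar>) ` D)" by (intro bdd_aboveI2)
      from cSUP_upper[OF p this] drift[of "Suc n"] n show ?thesis by simp
    qed
    define M where "M = (SUP p\<in>D. V (t 1) p + sb 1) - (V (t 1) x0 + sb 1)"
    define q where "q = (\<lambda>T. ((1 + \<sigma>) * bb T + \<kappa> + (bb T + C2)) / \<sigma>\<^sup>2)"
    define G where "G = (\<lambda>T. (\<sigma>\<^sup>2 + 1) * se_gain_bound l \<sigma> r TYPE('d) T)"
    define R where "R = (\<lambda>T. (M + 2 * (real T * (\<Delta> + C3 + 1) + (q T)\<^sup>2 * G T)) / (1 - max 0 \<eta>) +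
      real T * (C2 + 2 * \<kappa> + 1) + (bb T + C2)\<^sup>2 * G T)"
    have bound: "0 \<le> cum_regret D (\<lambda>n x. V (t n) x + U x \<omega>) (\<lambda>n. X n \<omega>) T \<and>
        cum_regret D (\<lambda>n x. V (t n) x + U x \<omega>) (\<lambda>n. X n \<omega>) T \<le> R T"
      if \<omega>: "\<omega> \<in> A" and T: "T \<ge> 1" for \<omega> T
    proof -
      have sp: "\<omega> \<in> space P" using \<omega> A(3) by blast
      have pd: "psd_kernel k" unfolding k_def by (rule psd_se_kernel[OF l])
      have \<phi>_eq: "\<phi> n \<omega> p = V (t n) p + (cond_mean k \<sigma> (\<lambda>i. X i \<omega>) (\<lambda>i. Y i \<omega>) (n - 1) p +
          sb n * sqrt (cond_cov k \<sigma> (\<lambda>i. X i \<omega>) (n - 1) p p))" for n p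
      proof -
        have "[1..<n] = [1..<Suc (n - 1)]" by (cases n) auto
        then show ?thesis
          unfolding \<phi>_def agp_acquisition_def post_sd_def sb_def
          by (simp only: post_eq_cond[OF pd s])
      qed
      have U_bdd: "\<exists>B. \<forall>p\<in>D. U p \<omega> \<le> B"
      proof -
        have "continuous_on D (\<lambda>p. U p \<omega>)"
          using has_derivative_continuous[OF U_diff[OF sp]] by (simp add: continuous_on_eq_continuous_within)
        from compact_imp_bounded[OF compact_continuous_image[OF this \<open>compact D\<close>]]
        obtain B where "\<And>p. p \<in> D \<Longrightarrow> \<bar>U p \<omega>\<bar> \<le> B" by (auto simp: bounded_iff)
        then show ?thesis by (meson abs_le_D1)
      qed
      have info: "(\<Sum>i=1..T. cond_cov k \<sigma> (\<lambda>i. X i \<omega>) (i - 1) (X i \<omega>) (X i \<omega>)) \<le> G T"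
      proof -
        have "(\<Sum>i=1..T. cond_cov k \<sigma> (\<lambda>i. X i \<omega>) (i - 1) (X i \<omega>) (X i \<omega>))
            \<le> (\<sigma>\<^sup>2 + 1) * ln (gain_product k \<sigma> (\<lambda>i. X i \<omega>) T)"
          by (rule sum_cond_var_le[OF pd s]) (simp add: k_def)
        also have "\<dots> \<le> G T"
          unfolding G_def k_def
          by (intro mult_left_mono ln_gain_product_le_se_gain_bound[OF l s _ T])
            (use D_box X_D'[OF sp] in \<open>auto intro: power_mono\<close>)
        finally show ?thesis .
      qed
      have k1: "k u u \<le> 1" for u by (simp add: k_def)
      have V_above: "\<exists>B. \<forall>p\<in>D. V (t n) p \<le> B" for n
        using V_bdd[of n] by (meson abs_le_D1)
      have sb1: "\<bar>sb n\<bar> \<le> bb n + C2" and sb2: "bb n \<le> sb n + C2" if "n \<ge> 1" for n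
        using sb_bb[OF that] bb[of n] by linarith+
      have bb_mono: "bb i \<le> bb j" if "1 \<le> i" "i \<le> j" for i j
        unfolding bb_def by (rule conf_width_mono[OF that])
      have start: "(SUP p\<in>D. \<phi> 1 \<omega> p) - \<phi> 1 \<omega> (X 0 \<omega>) \<le> M"
        unfolding \<phi>_eq M_def using X_0[OF sp] by (simp add: k_def)
      have C2: "C2 \<ge> 0" and \<kappa>: "\<kappa> \<ge> 0" using H by (simp_all add: C2_def \<kappa>_def)
      note regret = regret_bound[OF pd k1 s X_D'[OF sp] feedback[OF _ sp] good(1)[OF \<omega>, folded bb_def] V_above U_bdd
          V_drift good(2)[OF \<omega>, folded bb_def \<kappa>_def] bb bb_mono sb1 sb2 sb_step C2 \<kappa> \<phi>_eq approx_opt[OF _ sp]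
          \<open>\<eta> < 1\<close> start info T]
      show ?thesis
        unfolding R_def q_def using regret by (intro conjI)
    qed
    have R_bigo: "R \<in> O(\<lambda>T. real T)"
    proof -
      have const: "(\<lambda>_. c) \<in> O(\<lambda>n. sqrt (ln (real n)))" for c :: real by real_asymp
      have bw: "bb \<in> O(\<lambda>n. sqrt (ln (real n)))" unfolding bb_def by (rule conf_width_bigo)
      have b2: "(\<lambda>T. bb T + C2) \<in> O(\<lambda>n. sqrt (ln (real n)))" by (intro sum_in_bigo bw const)
      have b3: "(\<lambda>T. (1 + \<sigma>) * bb T) \<in> O(\<lambda>n. sqrt (ln (real n)))" using bw s by simp
      have "(\<lambda>T. (1 + \<sigma>) * bb T + \<kappa> + (bb T + C2)) \<in> O(\<lambda>n. sqrt (ln (real n)))"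
        by (intro sum_in_bigo b3 b2 const)
      then have q: "q \<in> O(\<lambda>n. sqrt (ln (real n)))" unfolding q_def using s by simp
      note sq = square_times_gain_bigo[where 'd = 'd and c = "\<sigma>\<^sup>2 + 1" and l = l and s = \<sigma> and r = r, folded G_def]
      have lin: "(\<lambda>T. real T * c) \<in> O(\<lambda>T. real T)" for c by (cases "c = 0") simp_all
      have cst: "(\<lambda>_. c) \<in> O(\<lambda>T. real T)" for c :: real by real_asymp
      have qG: "(\<lambda>T. (q T)\<^sup>2 * G T) \<in> O(\<lambda>T. real T)" using sq[OF q] by (simp add: G_def)
      have bG: "(\<lambda>T. (bb T + C2)\<^sup>2 * G T) \<in> O(\<lambda>T. real T)" using sq[OF b2] by (simp add: G_def)
      have "(\<lambda>T. real T * (\<Delta> + C3 + 1) + (q T)\<^sup>2 * G T) \<in> O(\<lambda>T. real T)"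
        by (intro sum_in_bigo lin qG)
      then have "(\<lambda>T. 2 * (real T * (\<Delta> + C3 + 1) + (q T)\<^sup>2 * G T)) \<in> O(\<lambda>T. real T)"
        by (subst landau_o.big.cmult_in_iff) simp_all
      then have "(\<lambda>T. M + 2 * (real T * (\<Delta> + C3 + 1) + (q T)\<^sup>2 * G T)) \<in> O(\<lambda>T. real T)"
        by (intro sum_in_bigo cst)
      then have "(\<lambda>T. (M + 2 * (real T * (\<Delta> + C3 + 1) + (q T)\<^sup>2 * G T)) / (1 - max 0 \<eta>)) \<in> O(\<lambda>T. real T)"
        unfolding divide_inverse_commute by (subst landau_o.big.cmult_in_iff) (use \<open>\<eta> < 1\<close> in auto)
      then show ?thesis unfolding R_def by (intro sum_in_bigo lin bG)
    qed
    have "\<forall>\<omega>\<in>A. \<forall>T\<ge>1.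
        \<bar>cum_regret D (\<lambda>n x. V (t n) x + U x \<omega>) (\<lambda>n. X n \<omega>) T\<bar> \<le> 0 + R T"
      using bound by simp
    then show ?thesis
      using A R_bigo
      by (intro bexI[where x = "\<lambda>_. 0" and A = "bigo_star _"] bexI[where x = R and A = "O(\<lambda>T. real T)"]
            bexI[where x = A and A = "sets P"] conjI) (auto simp: bigo_star_def)
  qed
qed

end
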